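(* Let $\mu$ be a partition of $n$ and $\lambda$ a composition of $n$, and let $l$ be maximal such that $\mu_l>0$. Suppose $A_1,\dots,A_r$ are row-standard $\mu$-tableaux of type $\lambda$ which are identical in row $l$. Write $\tilde\mu=(\mu_1,\dots,\mu_{l-1},0,0,\dots)$, and let $\tilde A_1,\dots,\tilde A_r$ be the $\tilde\mu$-tableaux obtained by deleting the $l$th row from each of $A_1,\dots,A_r$. If $c_1,\dots,c_r\in\mathbb F$ are such that $\sum_{i=1}^rc_i\hat\phi_{\tilde A_i}=0$, then $\sum_{i=1}^rc_i\hat\phi_{A_i}=0$.
   Context: $\mathbb F$ is an arbitrary field and $q\in\mathbb F$ is a fixed non-zero element. $\mathfrak S_n$ is the symmetric group on $\{1,\dots,n\}$, acting on the right (in a product $uv$, $u$ is applied first), with Coxeter length function $l(\cdot)$ and simple transpositions $s_i=(i\ i{+}1)$. $\mathcal H_n$ is the unital associative $\mathbb F$-algebra with generators $T_1,\dots,T_{n-1}$ and relations $(T_i-q)(T_i+1)=0$, $T_iT_j=T_jT_i$ for $i\le j-2$, and $T_iT_{i+1}T_i=T_{i+1}T_iT_{i+1}$ (so $\mathcal H_0=\mathcal H_1=\mathbb F$). For $w\in\mathfrak S_n$ with reduced expression $w=s_{i_1}\cdots s_{i_k}$, put $T_w=T_{i_1}\cdots T_{i_k}$. Modules are right modules and maps are written on the right. A composition of $n$ is a sequence of non-negative integers (zeros allowed, trailing zeros ignored) with sum $n$; a partition is a weakly decreasing composition; $\mu'$ is the conjugate of a partition $\mu$. For a composition $\lambda$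 of $n$, $W_\lambda\le\mathfrak S_n$ is the standard Young subgroup, $x_\lambda=\sum_{w\in W_\lambda}T_w$, $y_\lambda=\sum_{w\in W_\lambda}(-q)^{-l(w)}T_w$ and $M^\lambda=x_\lambda\mathcal H_n$. $\mathfrak t^\lambda$ is the $\lambda$-tableau with $1,\dots,n$ in order along successive rows; for a partition $\mu$, $\mathfrak t_\mu$ is the $\mu$-tableau with $1,\dots,n$ in order down successive columns, $w_\mu$ is the permutation with $\mathfrak t^\mu w_\mu=\mathfrak t_\mu$ (permutations act on entries), and $S^\mu=x_\mu T_{w_\mu}y_{\mu'}\mathcal H_n\subseteq M^\mu$ is the Specht module. For compositions $\mu,\lambda$ of $n$, a $\mu$-tableau of type $\lambda$ is a filling of the Young diagram of $\mu$ with positive integers in which each $i$ occurs $\lambda_i$ times; it is row-standard if entries weakly increase along rows. For a row-standard $\mu$-tableau $A$ of type $\lambda$, $1_A\in\mathfrak S_n$ is the permutation such that $\mathfrak t^\lambda1_A$ is the $\lambda$-tableau with entries $1,\dots,n$, increasing along rows, in which $i$ lies in row $r$ if the position occupied by $i$ in $\mathfrak t^\mu$ is occupied by $r$ in $A$. The homomorphism $\phi_A:M^\mu\to M^\lambda$ of $\mathcal H_n$-modules is given by $x_\mu\phi_A=\sum_{w\in W_\lambda1_AW_\mu}T_w$. If $\mu$ is a partition, $\hat\phi_A$ is the restriction of $\phi_A$ to $S^\mu$. The homomorphisms $\hat\phi_{\tilde A_i}$ are defined in the same way over $\mathcal H_{n-\mu_l}$. *)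

theory Defs
  imports "HOL-Library.Poly_Mapping" "HOL-Library.FuncSet" "HOL-Combinatorics.Permutations"
    "HOL-Algebra.QuotRing"
begin

section \<open>The free algebra on $n - 1$ generators\<close>

text \<open>The free monoid on the natural numbers, written additively: then the finitely supported
  functions on it carry the convolution product of \<^theory>\<open>HOL-Library.Poly_Mapping\<close>, which makes
  them the free associative algebra on countably many generators.\<close>

datatype word = Word (letters: "nat list")

instantiation word :: monoid_add
begin

definition zero_word :: word where
  "0 = Word []"

definition plus_word :: "word \<Rightarrow> word \<Rightarrow> word" where
  "u + v = Word (letters u @ letters v)"

instance
  by standard (simp_all add: zero_word_def plus_word_def)

end

type_synonym 'f free_alg = "word \<Rightarrow>\<^sub>0 'f"

definition const :: "'f::field \<Rightarrow> 'f free_alg" where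
  "const c = Poly_Mapping.single 0 c"

definition gen :: "nat \<Rightarrow> 'f::field free_alg" where
  "gen i = Poly_Mapping.single (Word [i]) 1"

definition free_algebra :: "nat \<Rightarrow> 'f::field free_alg ring" where
  "free_algebra n =
    \<lparr>carrier = {p. \<forall>w\<in>Poly_Mapping.keys p. set (letters w) \<subseteq> {1..<n}},
     mult = (*), one = 1, zero = 0, add = (+)\<rparr>"


section \<open>The Hecke algebra\<close>

definition hecke_relations :: "'f::field \<Rightarrow> nat \<Rightarrow> 'f free_alg set" where
  "hecke_relations q n =
    {(gen i - const q) * (gen i + 1) | i. i \<in> {1..<n}} \<union>
    {gen i * gen j - gen j * gen i | i j. i \<in> {1..<n} \<and> j \<in> {1..<n} \<and> i + 2 \<le> j} \<union>
    {gen i * gen (i + 1) * gen i - gen (i + 1) * gen i * gen (i + 1) | i.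
       i \<in> {1..<n} \<and> i + 1 \<in> {1..<n}}"

definition hecke_ideal :: "'f::field \<Rightarrow> nat \<Rightarrow> 'f free_alg set" where
  "hecke_ideal q n = Idl\<^bsub>free_algebra n\<^esub> (hecke_relations q n)"

definition hecke :: "'f::field \<Rightarrow> nat \<Rightarrow> 'f free_alg set ring" where
  "hecke q n = free_algebra n Quot hecke_ideal q n"

definition hecke_class :: "'f::field \<Rightarrow> nat \<Rightarrow> 'f free_alg \<Rightarrow> 'f free_alg set" where
  "hecke_class q n p = hecke_ideal q n +>\<^bsub>free_algebra n\<^esub> p"

definition hecke_smult :: "'f::field \<Rightarrow> nat \<Rightarrow> 'f \<Rightarrow> 'f free_alg set \<Rightarrow> 'f free_alg set" where
  "hecke_smult q n c h = hecke_class q n (const c) \<otimes>\<^bsub>hecke q n\<^esub> h"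


section \<open>The symmetric group\<close>

text \<open>Elements of the symmetric group are functions \<open>w\<close> with \<open>w permutes {1..n}\<close>. As they act on the
  right, the product \<open>u v\<close> is the function \<open>v \<circ> u\<close>.\<close>

definition perm_mult :: "(nat \<Rightarrow> nat) \<Rightarrow> (nat \<Rightarrow> nat) \<Rightarrow> nat \<Rightarrow> nat" (infixl "\<cdot>" 70) where
  "u \<cdot> v = v \<circ> u"

definition simple_transp :: "nat \<Rightarrow> nat \<Rightarrow> nat" where
  "simple_transp i = Transposition.transpose i (i + 1)"

fun word_perm :: "nat list \<Rightarrow> nat \<Rightarrow> nat" where
  "word_perm [] = id"
| "word_perm (i # is) = simple_transp i \<cdot> word_perm is"

definition expression :: "nat \<Rightarrow> (nat \<Rightarrow> nat) \<Rightarrow> nat list \<Rightarrow> bool" where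
  "expression n w is \<longleftrightarrow> set is \<subseteq> {1..<n} \<and> word_perm is = w"

definition coxeter_length :: "nat \<Rightarrow> (nat \<Rightarrow> nat) \<Rightarrow> nat" where
  "coxeter_length n w = (LEAST k. \<exists>is. expression n w is \<and> length is = k)"

definition reduced_expression :: "nat \<Rightarrow> (nat \<Rightarrow> nat) \<Rightarrow> nat list \<Rightarrow> bool" where
  "reduced_expression n w is \<longleftrightarrow> expression n w is \<and> length is = coxeter_length n w"

fun hecke_word :: "'f::field \<Rightarrow> nat \<Rightarrow> nat list \<Rightarrow> 'f free_alg set" where
  "hecke_word q n [] = \<one>\<^bsub>hecke q n\<^esub>"
| "hecke_word q n (i # is) = hecke_class q n (gen i) \<otimes>\<^bsub>hecke q n\<^esub> hecke_word q n is"

text \<open>The element $T_w$; by Matsumoto's theorem it does not depend on the reduced expression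
  that is chosen.\<close>

definition hecke_T :: "'f::field \<Rightarrow> nat \<Rightarrow> (nat \<Rightarrow> nat) \<Rightarrow> 'f free_alg set" where
  "hecke_T q n w = hecke_word q n (SOME is. reduced_expression n w is)"


section \<open>Compositions and tableaux\<close>

text \<open>Parts, rows and columns are numbered from 1; the value of a composition at 0 is a dummy, fixed
  to be 0.\<close>

definition is_composition :: "nat \<Rightarrow> (nat \<Rightarrow> nat) \<Rightarrow> bool" where
  "is_composition n lam \<longleftrightarrow> lam 0 = 0 \<and> finite {i. lam i \<noteq> 0} \<and> (\<Sum>i | lam i \<noteq> 0. lam i) = n"

definition is_partition :: "nat \<Rightarrow> (nat \<Rightarrow> nat) \<Rightarrow> bool" where
  "is_partition n \<mu> \<longleftrightarrow> is_composition n \<mu> \<and> (\<forall>i\<ge>1. \<mu> (i + 1) \<le> \<mu> i)"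

definition conjugate :: "(nat \<Rightarrow> nat) \<Rightarrow> nat \<Rightarrow> nat" where
  "conjugate \<mu> j = (if j = 0 then 0 else card {i. 1 \<le> i \<and> j \<le> \<mu> i})"

definition diagram :: "(nat \<Rightarrow> nat) \<Rightarrow> (nat \<times> nat) set" where
  "diagram \<mu> = {(a, b). 1 \<le> a \<and> 1 \<le> b \<and> b \<le> \<mu> a}"

text \<open>A tableau is a function of the row and the column; only its values on the diagram of its shape
  matter.\<close>

type_synonym tableau = "nat \<Rightarrow> nat \<Rightarrow> nat"

definition row_tableau :: "(nat \<Rightarrow> nat) \<Rightarrow> tableau" where
  "row_tableau lam a b = (\<Sum>i\<in>{1..<a}. lam i) + b"

definition column_tableau :: "(nat \<Rightarrow> nat) \<Rightarrow> tableau" where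
  "column_tableau \<mu> a b = (\<Sum>j\<in>{1..<b}. conjugate \<mu> j) + a"

definition content :: "(nat \<Rightarrow> nat) \<Rightarrow> tableau \<Rightarrow> nat \<Rightarrow> nat" where
  "content \<mu> A i = card {(a, b) \<in> diagram \<mu>. A a b = i}"

text \<open>As \<open>lam 0 = 0\<close> for a composition \<open>lam\<close>, the entries of a tableau of type \<open>lam\<close> are positive.\<close>

definition has_type :: "(nat \<Rightarrow> nat) \<Rightarrow> (nat \<Rightarrow> nat) \<Rightarrow> tableau \<Rightarrow> bool" where
  "has_type \<mu> lam A \<longleftrightarrow> (\<forall>i. content \<mu> A i = lam i)"

definition row_standard :: "(nat \<Rightarrow> nat) \<Rightarrow> tableau \<Rightarrow> bool" where
  "row_standard \<mu> A \<longleftrightarrow>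
    (\<forall>a b. (a, b) \<in> diagram \<mu> \<and> (a, b + 1) \<in> diagram \<mu> \<longrightarrow> A a b \<le> A a (b + 1))"

text \<open>The shape of \<open>delete_row l A\<close> is \<open>\<mu>(l := 0)\<close>, if \<open>\<mu>\<close> is that of \<open>A\<close> and \<open>l\<close> is its
  last row.\<close>

definition delete_row :: "nat \<Rightarrow> tableau \<Rightarrow> tableau" where
  "delete_row l A = A(l := (\<lambda>_. 0))"

definition young_subgroup :: "nat \<Rightarrow> (nat \<Rightarrow> nat) \<Rightarrow> (nat \<Rightarrow> nat) set" where
  "young_subgroup n lam =
    {w. w permutes {1..n} \<and>
        (\<forall>a\<ge>1. w ` (row_tableau lam a ` {1..lam a}) = row_tableau lam a ` {1..lam a})}"

definition specht_perm :: "nat \<Rightarrow> (nat \<Rightarrow> nat) \<Rightarrow> nat \<Rightarrow> nat" where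
  "specht_perm n \<mu> = (THE w. w permutes {1..n} \<and>
    (\<forall>(a, b)\<in>diagram \<mu>. w (row_tableau \<mu> a b) = column_tableau \<mu> a b))"

text \<open>The permutation $1_A$, for a \<open>\<mu>\<close>-tableau \<open>A\<close> of type \<open>lam\<close>.\<close>

definition tableau_perm :: "nat \<Rightarrow> (nat \<Rightarrow> nat) \<Rightarrow> (nat \<Rightarrow> nat) \<Rightarrow> tableau \<Rightarrow> nat \<Rightarrow> nat" where
  "tableau_perm n \<mu> lam A = (THE w. w permutes {1..n} \<and>
    (\<forall>a b. (a, b) \<in> diagram lam \<and> (a, b + 1) \<in> diagram lam \<longrightarrow>
       w (row_tableau lam a b) < w (row_tableau lam a (b + 1))) \<and>
    (\<forall>(a, b)\<in>diagram \<mu>. \<exists>c. (A a b, c) \<in> diagram lam \<and>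
       w (row_tableau lam (A a b) c) = row_tableau \<mu> a b))"


section \<open>Permutation modules, Specht modules and homomorphisms\<close>

definition x_elt :: "'f::field \<Rightarrow> nat \<Rightarrow> (nat \<Rightarrow> nat) \<Rightarrow> 'f free_alg set" where
  "x_elt q n lam = (\<Oplus>\<^bsub>hecke q n\<^esub> w\<in>young_subgroup n lam. hecke_T q n w)"

definition y_elt :: "'f::field \<Rightarrow> nat \<Rightarrow> (nat \<Rightarrow> nat) \<Rightarrow> 'f free_alg set" where
  "y_elt q n lam = (\<Oplus>\<^bsub>hecke q n\<^esub> w\<in>young_subgroup n lam.
     hecke_smult q n ((- q) powi (- int (coxeter_length n w))) (hecke_T q n w))"

definition perm_module :: "'f::field \<Rightarrow> nat \<Rightarrow> (nat \<Rightarrow> nat) \<Rightarrow> 'f free_alg set set" where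
  "perm_module q n lam = {x_elt q n lam \<otimes>\<^bsub>hecke q n\<^esub> h | h. h \<in> carrier (hecke q n)}"

definition specht_module :: "'f::field \<Rightarrow> nat \<Rightarrow> (nat \<Rightarrow> nat) \<Rightarrow> 'f free_alg set set" where
  "specht_module q n \<mu> =
    {x_elt q n \<mu> \<otimes>\<^bsub>hecke q n\<^esub> hecke_T q n (specht_perm n \<mu>)
       \<otimes>\<^bsub>hecke q n\<^esub> y_elt q n (conjugate \<mu>) \<otimes>\<^bsub>hecke q n\<^esub> h | h. h \<in> carrier (hecke q n)}"

text \<open>Homomorphisms between right ideals of the Hecke algebra, as right modules. Scalars act through
  the algebra, so linearity over the field is included.\<close>

definition hecke_hom ::
  "'f::field \<Rightarrow> nat \<Rightarrow> 'f free_alg set set \<Rightarrow> 'f free_alg set set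
    \<Rightarrow> ('f free_alg set \<Rightarrow> 'f free_alg set) set" where
  "hecke_hom q n M N = {f \<in> M \<rightarrow>\<^sub>E N.
     (\<forall>u\<in>M. \<forall>v\<in>M. f (u \<oplus>\<^bsub>hecke q n\<^esub> v) = f u \<oplus>\<^bsub>hecke q n\<^esub> f v) \<and>
     (\<forall>v\<in>M. \<forall>h\<in>carrier (hecke q n). f (v \<otimes>\<^bsub>hecke q n\<^esub> h) = f v \<otimes>\<^bsub>hecke q n\<^esub> h)}"

definition double_coset :: "nat \<Rightarrow> (nat \<Rightarrow> nat) \<Rightarrow> (nat \<Rightarrow> nat) \<Rightarrow> (nat \<Rightarrow> nat) \<Rightarrow> (nat \<Rightarrow> nat) set" where
  "double_coset n lam w \<mu> = {u \<cdot> w \<cdot> v | u v. u \<in> young_subgroup n lam \<and> v \<in> young_subgroup n \<mu>}"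

text \<open>The homomorphism $\phi_A : M^\mu \to M^\lambda$, for a row-standard \<open>\<mu>\<close>-tableau \<open>A\<close> of type
  \<open>lam\<close>; here \<open>lam\<close> is recovered from \<open>A\<close> as its content.\<close>

definition phi :: "'f::field \<Rightarrow> nat \<Rightarrow> (nat \<Rightarrow> nat) \<Rightarrow> tableau \<Rightarrow> 'f free_alg set \<Rightarrow> 'f free_alg set" where
  "phi q n \<mu> A = (let lam = content \<mu> A in
    THE f. f \<in> hecke_hom q n (perm_module q n \<mu>) (perm_module q n lam) \<and>
      f (x_elt q n \<mu>) =
        (\<Oplus>\<^bsub>hecke q n\<^esub> w\<in>double_coset n lam (tableau_perm n \<mu> lam A) \<mu>. hecke_T q n w))"

definition phi_hat :: "'f::field \<Rightarrow> nat \<Rightarrow> (nat \<Rightarrow> nat) \<Rightarrow> tableau \<Rightarrow> 'f free_alg set \<Rightarrow> 'f free_alg set" where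
  "phi_hat q n \<mu> A = restrict (phi q n \<mu> A) (specht_module q n \<mu>)"

definition phi_hat_combination_zero ::
  "'f::field \<Rightarrow> nat \<Rightarrow> (nat \<Rightarrow> nat) \<Rightarrow> 'i set \<Rightarrow> ('i \<Rightarrow> 'f) \<Rightarrow> ('i \<Rightarrow> tableau) \<Rightarrow> bool" where
  "phi_hat_combination_zero q n \<mu> I c A \<longleftrightarrow>
    (\<forall>v\<in>specht_module q n \<mu>.
       (\<Oplus>\<^bsub>hecke q n\<^esub> i\<in>I. hecke_smult q n (c i) (phi_hat q n \<mu> (A i) v)) = \<zero>\<^bsub>hecke q n\<^esub>)"

end

theory Submission
  imports Defs
begin

text \<open>Let $m = n - \mu_l$ and $\tilde\mu = (\mu_1, \dots, \mu_{l-1})$. Two factorisations with additive lengths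
  are combined. First, an element of the double coset of $A$ is determined by the set of positions that it
  sends to $\{m+1, \dots, n\}$, an element of the double coset of $\tilde A$ and a permutation of
  $\{m+1, \dots, n\}$. Hence $x_\mu\phi_A = E \cdot x_{\tilde\mu}\phi_{\tilde A} \cdot X$, where
  $X = \sum_v T_v$ over the permutations of $\{m+1, \dots, n\}$ commutes with $\mathcal H_m$, and $E$ depends only on
  row $l$ of $A$ and the type of $A$. Second, $w_\mu = w_{\tilde\mu} d$, and $d$ conjugates the Young
  subgroup of $\tilde\mu'$ to a parabolic subgroup of the Young subgroup of $\mu'$, which gives
  $T_{w_\mu} y_{\mu'} = T_{w_{\tilde\mu}} y_{\tilde\mu'} T_d Z$. Therefore the image of the generator of
  $S^\mu$ under $\phi_A$ is $E \cdot s \cdot X T_d Z$, with $s$ the image of the generator of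
  $S^{\tilde\mu}$ under $\phi_{\tilde A}$, and the outer factors are the same for all $A_i$.\<close>

text \<open>The hypothesis lives in H_m and the conclusion in H_n, and each algebra makes its own
  choice of reduced expressions. Elements are therefore handled as polynomials in the free algebra
  modulo the ideal, where passing from m to n is an inclusion of ideals. The multiplicative
  information is T_u T_v = T_uv for additive lengths, where the product uv is the function
  \<open>v \<circ> u\<close>. Length is computed as the number of inversions, so additivity is
  checked on pairs of points. Sums over sets of permutations carry a weight c^l(w): c = 1 gives x
  and c = -1/q gives y. The weight is multiplicative when lengths add, so a unique factorisation of
  sets of permutations becomes a factorisation of elements. A double coset is recognised by a matrix
  of counts indexed by the rows of \<lambda> and of \<mu>. The shuffle e of w = e u v accounts for
  column l of this matrix and u for the other columns. The obstacle is that X stands between the two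
  factors whose product is the image s; as it commutes with H_m, it can be moved to the right of
  both.\<close>

declare One_nat_def [simp del]

section \<open>Inversions as a measure of length\<close>

definition inversions :: "(nat \<Rightarrow> nat) \<Rightarrow> (nat \<times> nat) set" where
  "inversions w = {(i, j). i < j \<and> w j < w i}"

text \<open>No ambient n occurs: a permutation of {1..m} keeps its length when it is regarded as a
  permutation of {1..n}. This is what makes lengths comparable between the two symmetric
  groups.\<close>

definition ilen :: "(nat \<Rightarrow> nat) \<Rightarrow> nat" where
  "ilen w = card (inversions w)"

lemma inversions_subset:
  assumes "w permutes {1..n}"
  shows "inversions w \<subseteq> {1..n} \<times> {1..n}"
proof safe
  fix i j assume "(i, j) \<in> inversions w"
  then have ij: "i < j" "w j < w i" by (auto simp: inversions_def)
  have fix_out: "w k = k" if "k \<notin> {1..n}" for k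
    using assms that by (rule permutes_not_in)
  have mem: "w k \<in> {1..n} \<longleftrightarrow> k \<in> {1..n}" for k
    using assms by (rule permutes_in_image)
  show "i \<in> {1..n}" "j \<in> {1..n}"
    using ij fix_out[of i] fix_out[of j] mem[of i] mem[of j] by auto
qed

lemma finite_inversions: "w permutes {1..n} \<Longrightarrow> finite (inversions w)"
  by (rule finite_subset[OF inversions_subset]) auto

text \<open>The assumption says that \<open>v\<close> undoes no inversion of \<open>u\<close>. The
  inversions of \<open>v \<circ> u\<close> are then those of \<open>u\<close> together with the
  pairs that \<open>u\<close> keeps in order and \<open>v\<close> inverts, and \<open>u\<close> maps
  the latter bijectively onto the inversions of \<open>v\<close>.\<close>

lemma ilen_comp:
  assumes "u permutes {1..n}" "v permutes {1..n}"
    and "\<And>i j. i < j \<Longrightarrow> u j < u i \<Longrightarrow> v (u j) < v (u i)"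
  shows "ilen (v \<circ> u) = ilen u + ilen v"
proof -
  let ?N = "{(i, j). i < j \<and> u i < u j \<and> v (u j) < v (u i)}"
  have u: "inj u" "surj u" using permutes_inj[OF assms(1)] permutes_surj[OF assms(1)] by auto
  have inv_eq: "inversions (v \<circ> u) = inversions u \<union> ?N"
  proof -
    have "u i < u j \<or> u j < u i" if "i < j" for i j
      using that inj_eq[OF u(1), of i j] by auto
    then have "i < j \<and> v (u j) < v (u i) \<longleftrightarrow>
        i < j \<and> u j < u i \<or> i < j \<and> u i < u j \<and> v (u j) < v (u i)" for i j
      using assms(3)[of i j] by blast
    then show ?thesis by (simp add: inversions_def set_eq_iff)
  qed
  have "bij_betw (map_prod u u) ?N (inversions v)"
  proof (rule bij_betw_imageI)
    show "inj_on (map_prod u u) ?N"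
      using u(1) by (intro inj_on_subset[OF prod.inj_map]) auto
    show "map_prod u u ` ?N = inversions v"
    proof (intro equalityI subsetI)
      fix x assume "x \<in> map_prod u u ` ?N"
      then show "x \<in> inversions v" by (auto simp: inversions_def)
    next
      fix x assume "x \<in> inversions v"
      then obtain a b where x: "x = (a, b)" and ab: "a < b" "v b < v a"
        by (auto simp: inversions_def)
      obtain i j where [simp]: "a = u i" "b = u j" using u(2) by (metis surjD)
      \<comment> \<open>If \<open>j < i\<close>, then \<open>(j, i)\<close> is an inversion of
        \<open>u\<close>, and by assumption \<open>v\<close> would keep \<open>u i\<close> and
        \<open>u j\<close> in order, against the choice of \<open>(a, b)\<close>.\<close>
      have "\<not> j \<le> i"
      proof
        assume "j \<le> i"
        then show False using assms(3)[of j i] ab by (cases "i = j") auto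
      qed
      then show "x \<in> map_prod u u ` ?N"
        using ab by (auto intro!: image_eqI[where x = "(i, j)"] simp: x)
    qed
  qed
  then have "card ?N = ilen v" by (simp add: ilen_def bij_betw_same_card)
  moreover have "card (inversions (v \<circ> u)) = card (inversions u) + card ?N"
    unfolding inv_eq
  proof (rule card_Un_disjoint)
    have "finite (inversions (v \<circ> u))"
      using assms by (intro finite_inversions permutes_compose)
    then show "finite (inversions u)" "finite ?N" by (auto simp: inv_eq)
    show "inversions u \<inter> ?N = {}" by (auto simp: inversions_def)
  qed
  ultimately show ?thesis by (simp add: ilen_def)
qed

lemma ilen_id [simp]: "ilen id = 0"
proof -
  have "inversions id = {}" by (auto simp: inversions_def)
  then show ?thesis by (simp add: ilen_def)
qed

lemma simple_transp_apply:
  "simple_transp i k = (if k = i then i + 1 else if k = i + 1 then i else k)"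
  by (simp add: simple_transp_def Transposition.transpose_def)

lemma simple_transp_permutes: "i \<in> {1..<n} \<Longrightarrow> simple_transp i permutes {1..n}"
  unfolding simple_transp_def by (rule permutes_swap_id) auto

lemma simple_transp_invol [simp]: "simple_transp i \<circ> simple_transp i = id"
  by (auto simp: simple_transp_apply)

lemma ilen_simple_transp [simp]: "ilen (simple_transp i) = 1"
proof -
  have "inversions (simple_transp i) = {(i, i + 1)}"
    by (auto simp: inversions_def simple_transp_apply split: if_splits)
  then show ?thesis by (simp add: ilen_def)
qed

lemma ilen_comp_simple:
  assumes "w permutes {1..n}" "i \<in> {1..<n}" "w i < w (i + 1)"
  shows "ilen (w \<circ> simple_transp i) = Suc (ilen w)"
proof -
  have "ilen (w \<circ> simple_transp i) = ilen (simple_transp i) + ilen w"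
    using assms by (intro ilen_comp[of _ n] simple_transp_permutes)
      (auto simp: simple_transp_apply split: if_splits)
  then show ?thesis by simp
qed

lemma ilen_comp_simple':
  assumes "w permutes {1..n}" "i \<in> {1..<n}" "w (i + 1) < w i"
  shows "ilen w = Suc (ilen (w \<circ> simple_transp i))"
proof -
  have "ilen (w \<circ> simple_transp i \<circ> simple_transp i) = Suc (ilen (w \<circ> simple_transp i))"
    using assms by (intro ilen_comp_simple[of _ n] permutes_compose simple_transp_permutes)
      (auto simp: simple_transp_apply)
  then show ?thesis by (simp add: comp_assoc)
qed

text \<open>Increasing values force \<open>w i \<ge> i\<close> everywhere. A permutation preserves
  the sum of 1, ..., n, so none of these inequalities is strict.\<close>

lemma permutes_increasing_eq_id:
  assumes w: "w permutes {1..n::nat}" and inc: "\<And>i. i \<in> {1..<n} \<Longrightarrow> w i < w (i + 1)"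
  shows "w = id"
proof -
  have step: "w i \<ge> i" if "i \<in> {1..n}" for i
    using that
  proof (induction i)
    case (Suc i)
    show ?case
    proof (cases "i = 0")
      case True
      then show ?thesis using permutes_in_image[OF w, of "Suc 0"] Suc.prems by auto
    next
      case False
      then show ?thesis using Suc inc[of i] by (auto simp flip: Suc_eq_plus1)
    qed
  qed simp
  have "w i = i" if "i \<in> {1..n}" for i
  proof (rule ccontr)
    assume "w i \<noteq> i"
    then have "(\<Sum>k\<in>{1..n}. k) < (\<Sum>k\<in>{1..n}. w k)"
      using step that by (intro sum_strict_mono_ex1) (auto intro!: bexI[of _ i] simp: le_neq_implies_less)
    moreover have "(\<Sum>k\<in>{1..n}. w k) = (\<Sum>k\<in>{1..n}. k)"
      using sum.permute[OF w, of "\<lambda>k. k"] by (simp add: comp_def)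
    ultimately show False by simp
  qed
  then show ?thesis using permutes_not_in[OF w] by (auto simp: fun_eq_iff)
qed

lemma exists_descent:
  assumes "w permutes {1..n::nat}" "w \<noteq> id"
  obtains i where "i \<in> {1..<n}" "w (i + 1) < w i"
proof -
  obtain i where i: "i \<in> {1..<n}" "\<not> w i < w (i + 1)"
    using permutes_increasing_eq_id[OF assms(1)] assms(2) by blast
  moreover have "w i \<noteq> w (i + 1)"
    using permutes_inj[OF assms(1)] by (auto simp: inj_eq)
  ultimately show thesis using that by fastforce
qed

lemma ilen_eq_0_iff: "w permutes {1..n} \<Longrightarrow> ilen w = 0 \<longleftrightarrow> w = id"
  by (metis exists_descent ilen_comp_simple' ilen_id nat.distinct(1))

section \<open>Words in the simple transpositions and reduced expressions\<close>

lemma word_perm_Cons: "word_perm (i # is) = word_perm is \<circ> simple_transp i"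
  by (simp add: perm_mult_def)

declare word_perm.simps(2) [simp del]

lemma word_perm_permutes: "set is \<subseteq> {1..<n} \<Longrightarrow> word_perm is permutes {1..n}"
proof (induction "is")
  case (Cons i "is")
  then show ?case
    unfolding word_perm_Cons by (intro permutes_compose simple_transp_permutes) auto
qed (simp add: permutes_id)

lemma ilen_word_perm_le: "set is \<subseteq> {1..<n} \<Longrightarrow> ilen (word_perm is) \<le> length is"
proof (induction "is")
  case (Cons i "is")
  have p: "word_perm is permutes {1..n}" and i: "i \<in> {1..<n}"
    using Cons.prems word_perm_permutes by auto
  let ?w = "word_perm is"
  have "?w i \<noteq> ?w (i + 1)"
    using permutes_inj[OF p] by (auto simp: inj_eq)
  then have "ilen (?w \<circ> simple_transp i) \<le> Suc (ilen ?w)"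
    using ilen_comp_simple[OF p i] ilen_comp_simple'[OF p i] by linarith
  moreover have "ilen ?w \<le> length is" using Cons by simp
  ultimately have "ilen (?w \<circ> simple_transp i) \<le> length (i # is)" by simp
  then show ?case by (simp only: word_perm_Cons)
qed simp

text \<open>Multiplying by the simple transposition at a descent removes exactly one inversion, and
  every permutation other than the identity has a descent.\<close>

lemma exists_expression:
  "w permutes {1..n} \<Longrightarrow> \<exists>is. expression n w is \<and> length is = ilen w"
proof (induction "ilen w" arbitrary: w)
  case 0
  then show ?case using ilen_eq_0_iff by (intro exI[of _ "[]"]) (auto simp: expression_def)
next
  case (Suc k)
  then have "w \<noteq> id" by auto
  then obtain i where i: "i \<in> {1..<n}" "w (i + 1) < w i"
    using exists_descent[OF Suc.prems] by blast
  let ?w = "w \<circ> simple_transp i"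
  have w: "?w permutes {1..n}" using Suc.prems i(1) by (intro permutes_compose simple_transp_permutes)
  have "ilen w = Suc (ilen ?w)" using ilen_comp_simple'[OF Suc.prems i] .
  then obtain "is" where "expression n ?w is" "length is = ilen ?w"
    using Suc.hyps w by auto
  then show ?case
    using i \<open>ilen w = _\<close> by (intro exI[of _ "i # is"])
      (auto simp: expression_def word_perm_Cons comp_assoc)
qed

text \<open>A letter changes the number of inversions by one, so no expression is shorter than
  \<open>ilen w\<close>, and \<open>exists_expression\<close> attains this bound.\<close>

lemma coxeter_length_eq_ilen:
  assumes "w permutes {1..n}"
  shows "coxeter_length n w = ilen w"
  unfolding coxeter_length_def
proof (rule Least_equality)
  show "ilen w \<le> k" if "\<exists>is. expression n w is \<and> length is = k" for k
    using that ilen_word_perm_le unfolding expression_def by blast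
qed (rule exists_expression[OF assms])

lemma reduced_expression_iff:
  "reduced_expression n w is \<longleftrightarrow> set is \<subseteq> {1..<n} \<and> word_perm is = w \<and> length is = ilen w"
  using word_perm_permutes coxeter_length_eq_ilen
  by (auto simp: reduced_expression_def expression_def)

lemma exists_reduced_expression: "w permutes {1..n} \<Longrightarrow> \<exists>is. reduced_expression n w is"
  using exists_expression by (auto simp: reduced_expression_iff expression_def)

lemma word_perm_append: "word_perm (is @ js) = word_perm is \<cdot> word_perm js"
  by (induction "is") (auto simp: word_perm_Cons perm_mult_def comp_assoc)

abbreviation pinv :: "('a \<Rightarrow> 'b) \<Rightarrow> 'b \<Rightarrow> 'a" where
  "pinv \<equiv> inv_into UNIV"

lemma ilen_inv:
  assumes "w permutes {1..n}"
  shows "ilen (pinv w) = ilen w"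
proof -
  have [simp]: "pinv w (w x) = x" "w (pinv w x) = x" for x
    using permutes_inverses[OF assms] by auto
  have "bij_betw (\<lambda>(i, j). (w j, w i)) (inversions w) (inversions (pinv w))"
    by (rule bij_betw_byWitness[where f' = "\<lambda>(i, j). (pinv w j, pinv w i)"])
      (auto simp: inversions_def)
  then show ?thesis by (simp add: ilen_def bij_betw_same_card)
qed

section \<open>Minimal coset representatives\<close>

text \<open>If \<open>\<rho>\<close> is weakly increasing, \<open>stab n \<rho>\<close> is a standard Young subgroup, \<open>incr n \<rho>\<close> consists of the
  representatives of minimal length of the cosets \<open>{d \<circ> v | v. v \<in> stab n \<rho>}\<close>, and \<open>cinc n \<rho>\<close>
  of those of the cosets \<open>{v \<circ> e | v. v \<in> stab n \<rho>}\<close>.\<close>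

definition stab :: "nat \<Rightarrow> (nat \<Rightarrow> nat) \<Rightarrow> (nat \<Rightarrow> nat) set" where
  "stab n \<rho> = {w. w permutes {1..n} \<and> (\<forall>p\<in>{1..n}. \<rho> (w p) = \<rho> p)}"

definition incr :: "nat \<Rightarrow> (nat \<Rightarrow> nat) \<Rightarrow> (nat \<Rightarrow> nat) set" where
  "incr n \<rho> = {d. d permutes {1..n} \<and>
     (\<forall>i\<in>{1..n}. \<forall>j\<in>{1..n}. i < j \<longrightarrow> \<rho> i = \<rho> j \<longrightarrow> d i < d j)}"

lemma stab_permutes: "v \<in> stab n \<rho> \<Longrightarrow> v permutes {1..n}"
  by (simp add: stab_def)

lemma incr_permutes: "d \<in> incr n \<rho> \<Longrightarrow> d permutes {1..n}"
  by (simp add: incr_def)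

lemma stab_comp: "u \<in> stab n \<rho> \<Longrightarrow> v \<in> stab n \<rho> \<Longrightarrow> u \<circ> v \<in> stab n \<rho>"
  using permutes_in_image[of v "{1..n}"] by (auto simp: stab_def permutes_compose)

lemma stab_inv: 
  assumes "v \<in> stab n \<rho>" shows "pinv v \<in> stab n \<rho>"
proof -
  have v: "v permutes {1..n}" "\<And>p. p \<in> {1..n} \<Longrightarrow> \<rho> (v p) = \<rho> p" using assms by (auto simp: stab_def)
  have "\<rho> (pinv v p) = \<rho> p" if "p \<in> {1..n}" for p
    using v(2)[of "pinv v p"] that permutes_inverses[OF v(1)] permutes_in_image[OF permutes_inv[OF v(1)]]
    by auto
  then show ?thesis using v(1) by (auto simp: stab_def permutes_inv)
qed

lemma id_in_stab: "id \<in> stab n \<rho>"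
  by (simp add: stab_def permutes_id)

text \<open>As \<open>\<rho>\<close> is monotone and \<open>v\<close> preserves it, both points of
  an inversion of \<open>v\<close> lie in one block. There \<open>d\<close> is increasing, so it
  undoes no inversion of \<open>v\<close>.\<close>

lemma ilen_incr_comp_stab:
  assumes d: "d \<in> incr n \<rho>" and v: "v \<in> stab n \<rho>" and \<rho>: "mono_on {1..n} \<rho>"
  shows "ilen (d \<circ> v) = ilen v + ilen d"
proof (rule ilen_comp)
  fix i j assume ij: "i < j" "v j < v i"
  have vp: "v permutes {1..n}" using v by (rule stab_permutes)
  have "(i, j) \<in> {1..n} \<times> {1..n}"
    using ij inversions_subset[OF vp] by (auto simp: inversions_def)
  then have *: "i \<in> {1..n}" "j \<in> {1..n}" "v i \<in> {1..n}" "v j \<in> {1..n}"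
    using permutes_in_image[OF vp] by auto
  have "\<rho> i \<le> \<rho> j" "\<rho> (v j) \<le> \<rho> (v i)"
    using ij * \<rho> by (auto simp: mono_on_def)
  then have "\<rho> i = \<rho> j" using v * by (auto simp: stab_def)
  then have "\<rho> (v i) = \<rho> (v j)" using v * by (auto simp: stab_def)
  then show "d (v j) < d (v i)" using d * ij by (auto simp: incr_def)
qed (rule stab_permutes[OF v] incr_permutes[OF d])+

text \<open>The two representatives differ by an element \<open>z\<close> of the stabiliser.
  Additivity in both directions gives l(d) = l(z) + l(d') and l(d') = l(z) + l(d), hence l(z) =
  0.\<close>

lemma incr_comp_stab_unique:
  assumes "d \<in> incr n \<rho>" "d' \<in> incr n \<rho>" "v \<in> stab n \<rho>" "v' \<in> stab n \<rho>" "mono_on {1..n} \<rho>"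
    and eq: "d \<circ> v = d' \<circ> v'"
  shows "d = d' \<and> v = v'"
proof -
  have p: "v permutes {1..n}" "v' permutes {1..n}" using assms stab_permutes by auto
  let ?z = "v' \<circ> pinv v"
  have z: "?z \<in> stab n \<rho>" "pinv ?z \<in> stab n \<rho>" using assms stab_comp stab_inv by auto
  have d: "d = d' \<circ> ?z"
    using eq permutes_inv_o[OF p(1)] by (metis comp_assoc comp_id)
  have zp: "?z permutes {1..n}" using z(1) by (rule stab_permutes)
  have "d' = d \<circ> pinv ?z" unfolding d using permutes_inv_o[OF zp] by (metis comp_assoc comp_id)
  then have "ilen d' = ilen (pinv ?z) + ilen d" "ilen d = ilen ?z + ilen d'"
    using ilen_incr_comp_stab[of d n \<rho> "pinv ?z"] ilen_incr_comp_stab[of d' n \<rho> "?z"] d assms z by auto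
  then have "ilen ?z = 0" by simp
  then have "?z = id" using ilen_eq_0_iff[OF zp] by simp
  then have "d = d'" using d by simp
  moreover have "v' = ?z \<circ> v" using permutes_inv_o[OF p(1)] by (simp add: comp_assoc)
  ultimately show ?thesis using \<open>?z = id\<close> by simp
qed

text \<open>Since \<open>\<rho>\<close> is monotone, its fibres are intervals, so two points of a
  fibre are joined by adjacent steps inside it.\<close>

lemma incr_if_adjacent:
  assumes w: "w permutes {1..n}" and \<rho>: "mono_on {1..n} \<rho>"
    and adj: "\<And>i. i \<in> {1..<n} \<Longrightarrow> \<rho> i = \<rho> (i + 1) \<Longrightarrow> w i < w (i + 1)"
  shows "w \<in> incr n \<rho>"
proof -
  have "w i < w (i + Suc k)" if "i \<in> {1..n}" "i + Suc k \<in> {1..n}" "\<rho> i = \<rho> (i + Suc k)" for i k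
    using that
  proof (induction k)
    case 0
    then show ?case using adj[of i] by (auto simp flip: Suc_eq_plus1)
  next
    case (Suc k)
    have "\<rho> i \<le> \<rho> (i + Suc k)" "\<rho> (i + Suc k) \<le> \<rho> (i + Suc (Suc k))"
      using Suc.prems(1,2) by (auto intro!: mono_onD[OF \<rho>])
    with Suc.prems(3) have "\<rho> i = \<rho> (i + Suc k)" "\<rho> (i + Suc k) = \<rho> (i + Suc k + 1)"
      by (auto simp flip: Suc_eq_plus1)
    then show ?case using Suc adj[of "i + Suc k"] by (auto simp flip: Suc_eq_plus1)
  qed
  then show ?thesis
    unfolding incr_def using w by (auto dest!: less_imp_Suc_add)
qed

text \<open>Induction on length: while \<open>w\<close> has a descent inside a block, the
  corresponding simple transposition lies in the stabiliser and can be split off, which shortens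
  \<open>w\<close>.\<close>

lemma incr_stab_decomp:
  assumes "w permutes {1..n}" and \<rho>: "mono_on {1..n} \<rho>"
  shows "\<exists>d\<in>incr n \<rho>. \<exists>v\<in>stab n \<rho>. w = d \<circ> v"
  using assms(1)
proof (induction "ilen w" arbitrary: w rule: less_induct)
  case less
  show ?case
  proof (cases "w \<in> incr n \<rho>")
    case True
    then show ?thesis using id_in_stab by (intro bexI[of _ w] bexI[of _ id]) auto
  next
    case False
    then obtain i where i: "i \<in> {1..<n}" "\<rho> i = \<rho> (i + 1)" "\<not> w i < w (i + 1)"
      using incr_if_adjacent[OF less.prems \<rho>] by blast
    moreover have "w i \<noteq> w (i + 1)" using permutes_inj[OF less.prems] by (auto simp: inj_eq)
    ultimately have "ilen (w \<circ> simple_transp i) < ilen w"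
      using ilen_comp_simple'[OF less.prems i(1)] by auto
    moreover have "w \<circ> simple_transp i permutes {1..n}"
      using less.prems i(1) by (intro permutes_compose simple_transp_permutes)
    ultimately obtain d v where dv: "d \<in> incr n \<rho>" "v \<in> stab n \<rho>" "w \<circ> simple_transp i = d \<circ> v"
      using less.hyps by blast
    have "w = d \<circ> (v \<circ> simple_transp i)"
      using dv(3) by (metis comp_assoc comp_id simple_transp_invol)
    moreover have "simple_transp i \<in> stab n \<rho>"
      using i by (auto simp: stab_def simple_transp_apply intro: simple_transp_permutes)
    ultimately show ?thesis using dv stab_comp by blast
  qed
qed

section \<open>Congruences modulo the relations of the Hecke algebra\<close>

abbreviation free_carrier :: "nat \<Rightarrow> 'f::field free_alg set" where
  "free_carrier n \<equiv> carrier (free_algebra n)"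

lemma free_algebra_simps [simp]:
  "mult (free_algebra n) = (*)" "one (free_algebra n) = 1"
  "zero (free_algebra n) = 0" "add (free_algebra n) = (+)"
  by (simp_all add: free_algebra_def)

lemma mem_free_carrier:
  "p \<in> free_carrier n \<longleftrightarrow> (\<forall>w\<in>Poly_Mapping.keys p. set (letters w) \<subseteq> {1..<n})"
  by (simp add: free_algebra_def)

lemma zero_in_free_carrier [simp]: "0 \<in> free_carrier n"
  by (simp add: mem_free_carrier)

lemma single_in_free_carrier: "set is \<subseteq> {1..<n} \<Longrightarrow> Poly_Mapping.single (Word is) c \<in> free_carrier n"
  by (simp add: mem_free_carrier)

lemma const_in_free_carrier [simp]: "const c \<in> free_carrier n"
  by (simp add: const_def zero_word_def single_in_free_carrier)

lemma one_in_free_carrier [simp]: "1 \<in> free_carrier n"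
  using const_in_free_carrier[of 1] by (simp add: const_def)

lemma gen_in_free_carrier: "i \<in> {1..<n} \<Longrightarrow> gen i \<in> free_carrier n"
  by (simp add: gen_def single_in_free_carrier)

lemma add_in_free_carrier: "p \<in> free_carrier n \<Longrightarrow> p' \<in> free_carrier n \<Longrightarrow> p + p' \<in> free_carrier n"
  using keys_add[of p p'] unfolding mem_free_carrier by blast

lemma mult_in_free_carrier:
  assumes "p \<in> free_carrier n" "p' \<in> free_carrier n"
  shows "p * p' \<in> free_carrier n"
  unfolding mem_free_carrier
proof
  fix w assume "w \<in> Poly_Mapping.keys (p * p')"
  then obtain u v where "w = u + v" "u \<in> Poly_Mapping.keys p" "v \<in> Poly_Mapping.keys p'"
    using keys_mult[of p p'] by blast
  then show "set (letters w) \<subseteq> {1..<n}"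
    using assms by (auto simp: mem_free_carrier plus_word_def)
qed

lemma uminus_in_free_carrier: "p \<in> free_carrier n \<Longrightarrow> - p \<in> free_carrier n"
  by (simp add: mem_free_carrier)

lemma diff_in_free_carrier: "p \<in> free_carrier n \<Longrightarrow> p' \<in> free_carrier n \<Longrightarrow> p - p' \<in> free_carrier n"
  using add_in_free_carrier[of p n "- p'"] uminus_in_free_carrier[of p' n] by simp

lemma sum_in_free_carrier: "(\<And>x. x \<in> X \<Longrightarrow> p x \<in> free_carrier n) \<Longrightarrow> sum p X \<in> free_carrier n"
  by (induction X rule: infinite_finite_induct) (auto intro: add_in_free_carrier)

lemmas free_carrier_intros = add_in_free_carrier mult_in_free_carrier diff_in_free_carrier
  sum_in_free_carrier gen_in_free_carrier

lemma free_carrier_mono: "m \<le> n \<Longrightarrow> p \<in> free_carrier m \<Longrightarrow> p \<in> free_carrier n"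
  by (fastforce simp: mem_free_carrier)

lemma ring_free_algebra: "ring (free_algebra n :: 'f::field free_alg ring)"
proof (rule ringI)
  show "abelian_group (free_algebra n :: 'f free_alg ring)"
    by (rule abelian_groupI)
      (auto simp: add_in_free_carrier algebra_simps intro!: bexI[of _ "- x" for x] uminus_in_free_carrier)
  show "Group.monoid (free_algebra n :: 'f free_alg ring)"
    by (rule Group.monoidI) (auto simp: mult_in_free_carrier mult.assoc)
qed (auto simp: algebra_simps)

lemma const_0 [simp]: "const 0 = 0" and const_1 [simp]: "const 1 = 1"
  by (simp_all add: const_def)

lemma const_mult: "const (a * b) = const a * const b"
  by (simp add: const_def mult_single)

lemma const_commute: "const c * p = p * const c"
proof (induction p rule: update_induct)
  case (update f a b)
  have "Poly_Mapping.update a b f = Poly_Mapping.single a b + f"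
    using update(1) by (intro poly_mapping_eqI) (auto simp: lookup_update lookup_add lookup_single in_keys_iff)
  then show ?case
    using update.IH by (simp add: algebra_simps const_def mult_single mult.commute)
qed simp

lemma hecke_relations_subset: "hecke_relations q n \<subseteq> free_carrier n"
  unfolding hecke_relations_def
  by (auto intro!: free_carrier_intros const_in_free_carrier one_in_free_carrier)

lemma ideal_hecke_ideal: "ideal (hecke_ideal q n) (free_algebra n)"
  unfolding hecke_ideal_def
  by (rule ring.genideal_ideal[OF ring_free_algebra hecke_relations_subset])

lemma hecke_relations_subset_ideal: "hecke_relations q n \<subseteq> hecke_ideal q n"
  unfolding hecke_ideal_def
  by (rule ring.genideal_self[OF ring_free_algebra hecke_relations_subset])

lemma
  assumes "p \<in> hecke_ideal q n"
  shows hecke_ideal_lmult: "r \<in> free_carrier n \<Longrightarrow> r * p \<in> hecke_ideal q n"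
    and hecke_ideal_rmult: "r \<in> free_carrier n \<Longrightarrow> p * r \<in> hecke_ideal q n"
    and hecke_ideal_add: "p' \<in> hecke_ideal q n \<Longrightarrow> p + p' \<in> hecke_ideal q n"
  using ideal.I_l_closed[OF ideal_hecke_ideal assms] ideal.I_r_closed[OF ideal_hecke_ideal assms]
    additive_subgroup.a_closed[OF ideal.axioms(1)[OF ideal_hecke_ideal] assms] by auto

lemma zero_in_hecke_ideal [simp]: "0 \<in> hecke_ideal q n"
  using additive_subgroup.zero_closed[OF ideal.axioms(1)[OF ideal_hecke_ideal]] by auto

lemma hecke_ideal_uminus: "p \<in> hecke_ideal q n \<Longrightarrow> - p \<in> hecke_ideal q n"
  using hecke_ideal_lmult[of p q n "- 1"] by (simp add: uminus_in_free_carrier)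

text \<open>The two ideals are generated in different rings. The larger one, intersected with the
  smaller free algebra, is an ideal there and contains the relations, so minimality of the generated
  ideal applies.\<close>

lemma hecke_ideal_mono:
  assumes "m \<le> n" shows "hecke_ideal q m \<subseteq> hecke_ideal q n"
proof -
  have "ideal (hecke_ideal q n \<inter> free_carrier m) (free_algebra m)"
  proof (rule idealI[OF ring_free_algebra])
    show "subgroup (hecke_ideal q n \<inter> free_carrier m) (add_monoid (free_algebra m))"
    proof (rule group.subgroupI)
      show "Group.group (add_monoid (free_algebra m))"
        using ring_free_algebra by (rule abelian_group.a_group[OF ring.is_abelian_group])
      show "hecke_ideal q n \<inter> free_carrier m \<noteq> {}"
        using zero_in_hecke_ideal zero_in_free_carrier by blast
      fix a assume a: "a \<in> hecke_ideal q n \<inter> free_carrier m"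
      have "inv\<^bsub>add_monoid (free_algebra m)\<^esub> a = - a"
        using abelian_group.minus_equality[OF ring.is_abelian_group[OF ring_free_algebra[of m]], of "- a" a]
        using a by (auto simp: a_inv_def uminus_in_free_carrier)
      then show "inv\<^bsub>add_monoid (free_algebra m)\<^esub> a \<in> hecke_ideal q n \<inter> free_carrier m"
        using a by (simp add: hecke_ideal_uminus uminus_in_free_carrier)
    qed (auto simp: hecke_ideal_add add_in_free_carrier)
  qed (auto simp: hecke_ideal_lmult hecke_ideal_rmult free_carrier_mono[OF assms] mult_in_free_carrier)
  moreover have "hecke_relations q m \<subseteq> hecke_ideal q n \<inter> free_carrier m"
  proof
    fix p assume p: "p \<in> hecke_relations q m"
    moreover have "{1..<m} \<subseteq> {1..<n}" using assms by auto
    ultimately have "p \<in> hecke_relations q n"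
      unfolding hecke_relations_def by blast
    then show "p \<in> hecke_ideal q n \<inter> free_carrier m"
      using p hecke_relations_subset hecke_relations_subset_ideal by blast
  qed
  ultimately show ?thesis
    unfolding hecke_ideal_def[of q m] using ring.genideal_minimal[OF ring_free_algebra] by blast
qed

text \<open>Working with representatives in the free algebra makes the passage from a smaller Hecke algebra
  to a larger one the identity on representatives.\<close>

definition hcong :: "'f::field \<Rightarrow> nat \<Rightarrow> 'f free_alg \<Rightarrow> 'f free_alg \<Rightarrow> bool" where
  "hcong q n p p' \<longleftrightarrow> p \<in> free_carrier n \<and> p' \<in> free_carrier n \<and> p - p' \<in> hecke_ideal q n"

lemma hcong_refl: "p \<in> free_carrier n \<Longrightarrow> hcong q n p p"
  by (simp add: hcong_def)

lemma hcong_sym: "hcong q n p p' \<Longrightarrow> hcong q n p' p"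
  unfolding hcong_def using hecke_ideal_uminus[of "p - p'"] by auto

lemma hcong_trans [trans]: "hcong q n p p' \<Longrightarrow> hcong q n p' p'' \<Longrightarrow> hcong q n p p''"
  unfolding hcong_def using hecke_ideal_add[of "p - p'" q n "p' - p''"] by auto

text \<open>Allows equations in the free algebra and congruences to be mixed in one
  calculation.\<close>

lemma hcong_eq_trans [trans]:
  "p = p' \<Longrightarrow> hcong q n p' p'' \<Longrightarrow> hcong q n p p''"
  "hcong q n p p' \<Longrightarrow> p' = p'' \<Longrightarrow> hcong q n p p''"
  by simp_all

lemma hcong_add: "hcong q n p p' \<Longrightarrow> hcong q n r r' \<Longrightarrow> hcong q n (p + r) (p' + r')"
  unfolding hcong_def using hecke_ideal_add[of "p - p'" q n "r - r'"]
  by (auto simp: add_in_free_carrier algebra_simps)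

lemma hcong_mult:
  assumes "hcong q n p p'" "hcong q n r r'"
  shows "hcong q n (p * r) (p' * r')"
proof -
  have "p * r - p' * r' = (p - p') * r + p' * (r - r')" by (simp add: algebra_simps)
  then show ?thesis
    using assms hecke_ideal_add hecke_ideal_lmult hecke_ideal_rmult mult_in_free_carrier
    unfolding hcong_def by metis
qed

lemma hcong_sum:
  "(\<And>x. x \<in> X \<Longrightarrow> hcong q n (p x) (p' x)) \<Longrightarrow> hcong q n (sum p X) (sum p' X)"
  by (induction X rule: infinite_finite_induct) (auto intro: hcong_add hcong_refl)

lemma hcong_mono: "m \<le> n \<Longrightarrow> hcong q m p p' \<Longrightarrow> hcong q n p p'"
  unfolding hcong_def using free_carrier_mono hecke_ideal_mono by blast

lemma hcong_carrier: "hcong q n p p' \<Longrightarrow> p \<in> free_carrier n" "hcong q n p p' \<Longrightarrow> p' \<in> free_carrier n"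
  by (simp_all add: hcong_def)

lemma hcong_relation: 
  assumes "p - p' \<in> hecke_relations q n" "p \<in> free_carrier n" "p' \<in> free_carrier n"
  shows "hcong q n p p'"
  using assms hecke_relations_subset_ideal by (auto simp: hcong_def)

lemma hcong_commute:
  assumes "i \<in> {1..<n}" "j \<in> {1..<n}" "i + 2 \<le> j"
  shows "hcong q n (gen i * gen j) (gen j * gen i)"
proof (rule hcong_relation)
  show "gen i * gen j - gen j * gen i \<in> hecke_relations q n"
    unfolding hecke_relations_def using assms by blast
qed (use assms in \<open>auto intro!: mult_in_free_carrier gen_in_free_carrier\<close>)

lemma hcong_braid:
  assumes "i \<in> {1..<n}" "i + 1 \<in> {1..<n}"
  shows "hcong q n (gen i * gen (i + 1) * gen i) (gen (i + 1) * gen i * gen (i + 1))"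
proof (rule hcong_relation)
  show "gen i * gen (i + 1) * gen i - gen (i + 1) * gen i * gen (i + 1) \<in> hecke_relations q n"
    unfolding hecke_relations_def using assms by blast
qed (use assms in \<open>auto intro!: mult_in_free_carrier gen_in_free_carrier\<close>)

section \<open>The quotient\<close>

lemma ring_hecke: "ring (hecke q n)"
  unfolding hecke_def by (rule ideal.quotient_is_ring[OF ideal_hecke_ideal])

lemma hecke_class_eq: "hecke_class q n p = (\<lambda>h. h + p) ` hecke_ideal q n"
  by (auto simp: hecke_class_def a_r_coset_def')

lemma hecke_class_eq_iff:
  assumes "p \<in> free_carrier n" "p' \<in> free_carrier n"
  shows "hecke_class q n p = hecke_class q n p' \<longleftrightarrow> hcong q n p p'"
proof
  assume "hecke_class q n p = hecke_class q n p'"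
  moreover have "p \<in> hecke_class q n p" unfolding hecke_class_eq by (rule image_eqI[of _ _ 0]) auto
  ultimately obtain h where "h \<in> hecke_ideal q n" "p = h + p'" by (auto simp: hecke_class_eq)
  then show "hcong q n p p'" using assms by (simp add: hcong_def)
next
  have sub: "hecke_class q n a \<subseteq> hecke_class q n b" if "hcong q n a b" for a b
  proof
    fix x assume "x \<in> hecke_class q n a"
    then obtain h where h: "h \<in> hecke_ideal q n" "x = h + a" by (auto simp: hecke_class_eq)
    then have "x = (h + (a - b)) + b" "h + (a - b) \<in> hecke_ideal q n"
      using that hecke_ideal_add by (auto simp: hcong_def)
    then show "x \<in> hecke_class q n b" unfolding hecke_class_eq by blast
  qed
  assume "hcong q n p p'"
  then show "hecke_class q n p = hecke_class q n p'" using sub hcong_sym by blast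
qed

lemma carrier_hecke: "carrier (hecke q n) = hecke_class q n ` free_carrier n"
  by (auto simp: hecke_def FactRing_def A_RCOSETS_def' hecke_class_def)

lemma hecke_class_hom: "hecke_class q n \<in> ring_hom (free_algebra n) (hecke q n)"
  using ideal.rcos_ring_hom[OF ideal_hecke_ideal] by (simp add: hecke_class_def[abs_def] hecke_def)

lemma
  assumes "p \<in> free_carrier n"
  shows hecke_class_closed: "hecke_class q n p \<in> carrier (hecke q n)"
    and hecke_class_mult: "p' \<in> free_carrier n \<Longrightarrow>
      hecke_class q n p \<otimes>\<^bsub>hecke q n\<^esub> hecke_class q n p' = hecke_class q n (p * p')"
    and hecke_class_add: "p' \<in> free_carrier n \<Longrightarrow>
      hecke_class q n p \<oplus>\<^bsub>hecke q n\<^esub> hecke_class q n p' = hecke_class q n (p + p')"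
  using ring_hom_closed[OF hecke_class_hom assms] ring_hom_mult[OF hecke_class_hom assms]
    ring_hom_add[OF hecke_class_hom assms] by auto

lemma hecke_class_one: "\<one>\<^bsub>hecke q n\<^esub> = hecke_class q n 1"
  using ring_hom_one[OF hecke_class_hom[of q n]] by simp

lemma hecke_class_zero: "\<zero>\<^bsub>hecke q n\<^esub> = hecke_class q n 0"
  using ring_hom_zero[OF hecke_class_hom[of q n] ring_free_algebra ring_hecke] by simp

lemma hecke_class_sum:
  assumes "\<And>x. x \<in> X \<Longrightarrow> p x \<in> free_carrier n"
  shows "(\<Oplus>\<^bsub>hecke q n\<^esub>x\<in>X. hecke_class q n (p x)) = hecke_class q n (sum p X)"
  using assms
proof (induction X rule: infinite_finite_induct)
  case (infinite X)
  interpret ring "hecke q n" by (rule ring_hecke)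
  show ?case using infinite by (simp add: hecke_class_zero finsum_infinite)
next
  case empty
  interpret ring "hecke q n" by (rule ring_hecke)
  show ?case by (simp add: hecke_class_zero)
next
  case (insert x X)
  interpret ring "hecke q n" by (rule ring_hecke)
  show ?case
    using insert by (subst finsum_insert) (auto simp: hecke_class_closed hecke_class_add sum_in_free_carrier)
qed

lemma hecke_smult_class:
  "p \<in> free_carrier n \<Longrightarrow> hecke_smult q n c (hecke_class q n p) = hecke_class q n (const c * p)"
  by (simp add: hecke_smult_def hecke_class_mult)

section \<open>The elements $T_w$\<close>

definition word_gen :: "nat list \<Rightarrow> 'f::field free_alg" where
  "word_gen is = prod_list (map gen is)"

lemma word_gen_simps [simp]:
  "word_gen [] = 1" "word_gen (i # is) = gen i * word_gen is"
  "word_gen (is @ js) = word_gen is * word_gen js"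
  by (simp_all add: word_gen_def)

lemma word_gen_in_free_carrier: "set is \<subseteq> {1..<n} \<Longrightarrow> word_gen is \<in> free_carrier n"
  by (induction "is") (auto intro!: mult_in_free_carrier gen_in_free_carrier)

lemma hecke_word_eq: "set is \<subseteq> {1..<n} \<Longrightarrow> hecke_word q n is = hecke_class q n (word_gen is)"
  by (induction "is") (auto simp: hecke_class_one hecke_class_mult gen_in_free_carrier word_gen_in_free_carrier)

lemma reduced_expression_Cons:
  assumes "reduced_expression n w (i # is)"
  shows "reduced_expression n (w \<circ> simple_transp i) is" "i \<in> {1..<n}" "w (i + 1) < w i"
proof -
  let ?w = "word_perm is"
  have i: "i \<in> {1..<n}" and "is": "set is \<subseteq> {1..<n}" and w: "w = ?w \<circ> simple_transp i"
    and len: "Suc (length is) = ilen w"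
    using assms by (auto simp: reduced_expression_iff word_perm_Cons)
  have p: "?w permutes {1..n}" using "is" by (rule word_perm_permutes)
  have w': "w \<circ> simple_transp i = ?w" unfolding w by (simp add: comp_assoc)
  have le: "ilen ?w \<le> length is" using "is" by (rule ilen_word_perm_le)
  have "?w i \<noteq> ?w (i + 1)" using permutes_inj[OF p] by (auto simp: inj_eq)
  moreover have "\<not> ?w (i + 1) < ?w i"
    using ilen_comp_simple'[OF p i] le len w by auto
  ultimately have lt: "?w i < ?w (i + 1)" by auto
  then show "w (i + 1) < w i" unfolding w by (simp add: simple_transp_apply)
  show "i \<in> {1..<n}" by (rule i)
  have "ilen w = Suc (ilen ?w)" using ilen_comp_simple[OF p i lt] w by simp
  then show "reduced_expression n (w \<circ> simple_transp i) is"
    using "is" len by (simp add: reduced_expression_iff w')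
qed

lemma reduced_expression_ConsI:
  assumes "w permutes {1..n}" "i \<in> {1..<n}" "w (i + 1) < w i"
    "reduced_expression n (w \<circ> simple_transp i) is"
  shows "reduced_expression n w (i # is)"
proof -
  have "w = w \<circ> simple_transp i \<circ> simple_transp i" by (simp add: comp_assoc)
  then show ?thesis
    using assms ilen_comp_simple'[OF assms(1-3)] by (auto simp: reduced_expression_iff word_perm_Cons)
qed

lemma reduced_expression_permutes: "reduced_expression n w is \<Longrightarrow> w permutes {1..n}"
  using word_perm_permutes by (auto simp: reduced_expression_iff)

text \<open>Induction on the length, by comparing first letters \<open>i\<close> and
  \<open>j\<close>. Both are descents of \<open>w\<close>. If they differ, \<open>w\<close> has
  reduced expressions beginning with i j and j i, or with i j i and j i j, and with the same tail;
  these are related by one commutation or braid relation.\<close>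

lemma matsumoto:
  assumes "reduced_expression n w is" "reduced_expression n w js"
  shows "hcong q n (word_gen is) (word_gen js)"
  using assms
proof (induction "length is" arbitrary: w "is" js rule: less_induct)
  case less
  have len: "length is = length js" using less.prems by (simp add: reduced_expression_iff)
  have w: "w permutes {1..n}" using less.prems(1) by (rule reduced_expression_permutes)
  show ?case
  proof (cases "is")
    case Nil
    then show ?thesis using len by (simp add: hcong_refl)
  next
    case (Cons i is')
    then obtain j js' where js: "js = j # js'" using len by (cases js) auto
    note I = reduced_expression_Cons[OF less.prems(1)[unfolded Cons]]
    note J = reduced_expression_Cons[OF less.prems(2)[unfolded js]]
    have IH: "hcong q n (word_gen as) (word_gen bs)"
      if "reduced_expression n v as" "reduced_expression n v bs" "length as = length is'" for v as bs
      using less.hyps[of as v bs] that Cons by simp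
    have cl: "gen i \<in> free_carrier n" "gen j \<in> free_carrier n"
      using I(2) J(2) by (auto intro: gen_in_free_carrier)
    \<comment> \<open>It suffices to find one congruent pair of reduced expressions with first
      letters \<open>i\<close> and \<open>j\<close>; the induction hypothesis, applied below each
      first letter, links them to the given words.\<close>
    have common: "hcong q n (word_gen is) (word_gen js)"
      if ij: "hcong q n (gen i * word_gen as) (gen j * word_gen bs)"
        and as: "reduced_expression n (w \<circ> simple_transp i) as"
        and bs: "reduced_expression n (w \<circ> simple_transp j) bs" for as bs
    proof -
      have "length as = length is'" "length js' = length is'"
        using as I(1) len Cons js by (auto simp: reduced_expression_iff)
      then have "hcong q n (word_gen is') (word_gen as)" "hcong q n (word_gen bs) (word_gen js')"
        using IH[OF as I(1)] IH[OF J(1) bs] hcong_sym by auto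
      then have "hcong q n (word_gen is) (gen i * word_gen as)"
        "hcong q n (gen j * word_gen bs) (word_gen js)"
        using cl by (auto simp: Cons js intro!: hcong_mult hcong_refl)
      then show ?thesis using ij hcong_trans by blast
    qed
    have far: "hcong q n (word_gen is) (word_gen js)"
      if ij: "i + 2 \<le> j \<or> j + 2 \<le> i"
    proof -
      \<comment> \<open>The permutation that is left after both commuting descents have been split
        off; a reduced expression of it is the common tail.\<close>
      let ?v = "w \<circ> simple_transp i \<circ> simple_transp j"
      have perm: "w \<circ> simple_transp i permutes {1..n}" "w \<circ> simple_transp j permutes {1..n}"
        "?v permutes {1..n}"
        using w I(2) J(2) by (auto intro!: permutes_compose simple_transp_permutes)
      have v: "?v = w \<circ> simple_transp j \<circ> simple_transp i"
        using ij by (auto simp: fun_eq_iff simple_transp_apply)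
      obtain zs where zs: "reduced_expression n ?v zs" using exists_reduced_expression perm(3) by blast
      have "reduced_expression n (w \<circ> simple_transp i) (j # zs)"
        using zs J(2,3) ij by (intro reduced_expression_ConsI perm) (auto simp: simple_transp_apply)
      moreover have "reduced_expression n (w \<circ> simple_transp j) (i # zs)"
        using zs[unfolded v] I(2,3) ij by (intro reduced_expression_ConsI perm) (auto simp: simple_transp_apply)
      moreover have "hcong q n (gen i * gen j) (gen j * gen i)"
        using ij I(2) J(2) hcong_commute hcong_sym by blast
      then have "hcong q n (gen i * gen j * word_gen zs) (gen j * gen i * word_gen zs)"
        using zs hcong_mult[OF _ hcong_refl[OF word_gen_in_free_carrier]]
        by (auto simp: reduced_expression_iff)
      then have "hcong q n (gen i * word_gen (j # zs)) (gen j * word_gen (i # zs))"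
        by (simp add: mult.assoc)
      ultimately show ?thesis using common by blast
    qed
    have near: "hcong q n (word_gen is) (word_gen js)"
      if ij: "i = j + 1 \<or> j = i + 1"
    proof -
      \<comment> \<open>Two neighbouring descents make \<open>w\<close> decreasing on three
        consecutive points, so the longest element of the symmetric group on these points splits
        off, and \<open>?v\<close> is what remains.\<close>
      let ?v = "w \<circ> simple_transp i \<circ> simple_transp j \<circ> simple_transp i"
      have perm: "w \<circ> simple_transp i permutes {1..n}" "w \<circ> simple_transp j permutes {1..n}"
        "w \<circ> simple_transp i \<circ> simple_transp j permutes {1..n}"
        "w \<circ> simple_transp j \<circ> simple_transp i permutes {1..n}"
        "?v permutes {1..n}"
        using w I(2) J(2) by (auto intro!: permutes_compose simple_transp_permutes)
      have v: "?v = w \<circ> simple_transp j \<circ> simple_transp i \<circ> simple_transp j"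
        using ij by (auto simp: fun_eq_iff simple_transp_apply)
      obtain zs where zs: "reduced_expression n ?v zs" using exists_reduced_expression perm(5) by blast
      have "reduced_expression n (w \<circ> simple_transp i) (j # i # zs)"
        using zs I(2,3) J(2,3) ij
        by (intro reduced_expression_ConsI perm) (auto simp: simple_transp_apply)
      moreover have "reduced_expression n (w \<circ> simple_transp j) (i # j # zs)"
        using zs[unfolded v] I(2,3) J(2,3) ij
        by (intro reduced_expression_ConsI perm) (auto simp: simple_transp_apply)
      moreover have "hcong q n (gen i * gen j * gen i) (gen j * gen i * gen j)"
        using ij I(2) J(2) hcong_braid hcong_sym by blast
      then have "hcong q n (gen i * gen j * gen i * word_gen zs) (gen j * gen i * gen j * word_gen zs)"
        using zs hcong_mult[OF _ hcong_refl[OF word_gen_in_free_carrier]]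
        by (auto simp: reduced_expression_iff)
      then have "hcong q n (gen i * word_gen (j # i # zs)) (gen j * word_gen (i # j # zs))"
        by (simp add: mult.assoc)
      ultimately show ?thesis using common by blast
    qed
    consider "i = j" | "i + 2 \<le> j \<or> j + 2 \<le> i" | "i = j + 1 \<or> j = i + 1" by linarith
    then show ?thesis
    proof cases
      case 1
      then have "hcong q n (word_gen is') (word_gen js')" using IH[of _ is' js'] I(1) J(1) by simp
      then show ?thesis using 1 cl by (auto simp: Cons js intro!: hcong_mult hcong_refl)
    qed (use far near in auto)
  qed
qed

text \<open>Uses the same choice of reduced expression as \<open>hecke_T\<close>, so that its class
  is T_w on the nose. As a polynomial it does not involve q.\<close>

definition tgen :: "nat \<Rightarrow> (nat \<Rightarrow> nat) \<Rightarrow> 'f::field free_alg" where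
  "tgen n w = word_gen (SOME is. reduced_expression n w is)"

lemma tgen_reduced:
  assumes "w permutes {1..n}"
  obtains "is" where "tgen n w = word_gen is" "reduced_expression n w is"
  using someI_ex[OF exists_reduced_expression[OF assms]] by (auto simp: tgen_def)

lemma tgen_in_free_carrier: "w permutes {1..n} \<Longrightarrow> tgen n w \<in> free_carrier n"
  by (metis tgen_reduced reduced_expression_iff word_gen_in_free_carrier)

lemma hecke_T_eq: "w permutes {1..n} \<Longrightarrow> hecke_T q n w = hecke_class q n (tgen n w)"
  using someI_ex[OF exists_reduced_expression]
  unfolding hecke_T_def tgen_def by (metis hecke_word_eq reduced_expression_iff)

text \<open>With additive lengths the concatenation of reduced expressions is reduced, and
  Matsumoto's theorem compares it with the chosen one. The factor \<open>u\<close> comes first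
  because permutations act on the right.\<close>

lemma tgen_mult:
  assumes "u permutes {1..n}" "v permutes {1..n}" "ilen (v \<circ> u) = ilen u + ilen v"
  shows "hcong q n (tgen n (v \<circ> u)) (tgen n u * tgen n v)"
proof -
  have vu: "v \<circ> u permutes {1..n}" using assms by (intro permutes_compose)
  obtain as bs cs where "tgen n u = (word_gen as :: 'a free_alg)" "reduced_expression n u as"
    "tgen n v = (word_gen bs :: 'a free_alg)" "reduced_expression n v bs"
    "tgen n (v \<circ> u) = (word_gen cs :: 'a free_alg)" "reduced_expression n (v \<circ> u) cs"
    using assms(1,2) vu tgen_reduced by metis
  moreover from this have "reduced_expression n (v \<circ> u) (as @ bs)"
    using assms(3) by (auto simp: reduced_expression_iff word_perm_append perm_mult_def)
  ultimately show ?thesis using matsumoto[of n "v \<circ> u" cs "as @ bs" q] by simp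
qed

text \<open>A reduced expression in the smaller group stays reduced in the larger one, because
  \<open>ilen\<close> does not refer to the ambient group; the chosen words may differ, hence only a
  congruence.\<close>

lemma tgen_mono:
  assumes "w permutes {1..m}" "m \<le> n"
  shows "hcong q n (tgen m w) (tgen n w)"
proof -
  have w: "w permutes {1..n}" using assms by (auto intro: permutes_subset)
  obtain as bs where "tgen m w = (word_gen as :: 'a free_alg)" "reduced_expression m w as"
    "tgen n w = (word_gen bs :: 'a free_alg)" "reduced_expression n w bs"
    using assms(1) w tgen_reduced by metis
  moreover from this have "reduced_expression n w as"
    using assms(2) by (auto simp: reduced_expression_iff)
  ultimately show ?thesis using matsumoto by metis
qed

text \<open>Over a Young subgroup, \<open>c = 1\<close> gives x and \<open>c = inverse (- q)\<close>
  gives y. The power of \<open>c\<close> is multiplicative along factorisations with additive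
  lengths, so both cases are treated together.\<close>

definition tsum :: "nat \<Rightarrow> 'f::field \<Rightarrow> (nat \<Rightarrow> nat) set \<Rightarrow> 'f free_alg" where
  "tsum n c X = (\<Sum>w\<in>X. const (c ^ ilen w) * tgen n w)"

lemma tsum_in_free_carrier: "(\<And>w. w \<in> X \<Longrightarrow> w permutes {1..n}) \<Longrightarrow> tsum n c X \<in> free_carrier n"
  unfolding tsum_def by (intro sum_in_free_carrier mult_in_free_carrier tgen_in_free_carrier const_in_free_carrier)

lemma tsum_mono:
  assumes "\<And>w. w \<in> X \<Longrightarrow> w permutes {1..m}" "m \<le> n"
  shows "hcong q n (tsum m c X) (tsum n c X)"
  unfolding tsum_def using assms by (intro hcong_sum hcong_mult hcong_refl tgen_mono const_in_free_carrier)

text \<open>The bridge from combinatorics to algebra: every later factorisation of elements comes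
  from a bijection of this kind, apart from commutation and conjugation identities.\<close>

lemma tsum_mult:
  assumes perm: "\<And>u. u \<in> X \<Longrightarrow> u permutes {1..n}" "\<And>v. v \<in> Y \<Longrightarrow> v permutes {1..n}"
    and bij: "bij_betw (\<lambda>(u, v). v \<circ> u) (X \<times> Y) Z"
    and len: "\<And>u v. u \<in> X \<Longrightarrow> v \<in> Y \<Longrightarrow> ilen (v \<circ> u) = ilen u + ilen v"
  shows "hcong q n (tsum n c Z) (tsum n c X * tsum n c Y)"
proof -
  let ?f = "\<lambda>w. const (c ^ ilen w) * tgen n w :: 'a free_alg"
  have "tsum n c Z = (\<Sum>(u, v)\<in>X \<times> Y. ?f (v \<circ> u))"
    unfolding tsum_def sum.reindex_bij_betw[OF bij, symmetric] by (simp add: case_prod_unfold)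
  moreover have "hcong q n (\<Sum>(u, v)\<in>X \<times> Y. ?f (v \<circ> u)) (\<Sum>(u, v)\<in>X \<times> Y. ?f u * ?f v)"
  proof (rule hcong_sum, clarify)
    fix u v assume uv: "u \<in> X" "v \<in> Y"
    have "?f u * ?f v = const (c ^ ilen u) * (const (c ^ ilen v) * (tgen n u * tgen n v))"
      using const_commute[of "c ^ ilen v" "tgen n u"] by (simp add: mult.assoc[symmetric])
    also have "\<dots> = const (c ^ ilen (v \<circ> u)) * (tgen n u * tgen n v)"
      using len[OF uv] by (simp add: power_add const_mult mult.assoc)
    finally show "hcong q n (?f (v \<circ> u)) (?f u * ?f v)"
      using tgen_mult[of u n v q] perm uv len[OF uv] by (simp add: hcong_mult hcong_refl)
  qed
  moreover have "(\<Sum>(u, v)\<in>X \<times> Y. ?f u * ?f v) = tsum n c X * tsum n c Y"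
    unfolding tsum_def by (simp add: sum_product sum.cartesian_product)
  ultimately show ?thesis by simp
qed

section \<open>Coset factorisations\<close>

definition cinc :: "nat \<Rightarrow> (nat \<Rightarrow> nat) \<Rightarrow> (nat \<Rightarrow> nat) set" where
  "cinc n \<rho> = {e. e permutes {1..n} \<and> pinv e \<in> incr n \<rho>}"

lemma cinc_permutes: "e \<in> cinc n \<rho> \<Longrightarrow> e permutes {1..n}"
  by (simp add: cinc_def)

lemma pinv_comp:
  assumes "u permutes S" "v permutes S"
  shows "pinv (u \<circ> v) = pinv v \<circ> pinv u"
  using assms by (intro o_inv_distrib permutes_bij)

text \<open>Taking inverses preserves length and turns this into
  \<open>ilen_incr_comp_stab\<close>.\<close>

lemma ilen_cinc:
  assumes "e \<in> cinc n \<rho>" "v \<in> stab n \<rho>" "mono_on {1..n} \<rho>"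
  shows "ilen (v \<circ> e) = ilen e + ilen v"
proof -
  have p: "e permutes {1..n}" "v permutes {1..n}" using assms cinc_permutes stab_permutes by auto
  have "ilen (v \<circ> e) = ilen (pinv e \<circ> pinv v)"
    using p ilen_inv[of "v \<circ> e" n] pinv_comp[OF p(2,1)] permutes_compose[OF p] by simp
  also have "\<dots> = ilen (pinv v) + ilen (pinv e)"
    using assms by (intro ilen_incr_comp_stab stab_inv) (auto simp: cinc_def)
  finally show ?thesis using p by (simp add: ilen_inv)
qed

lemma inj_on_cinc:
  assumes "mono_on {1..n} \<rho>"
  shows "inj_on (\<lambda>(e, v). v \<circ> e) (cinc n \<rho> \<times> stab n \<rho>)"
proof (rule inj_onI, clarify)
  fix e v e' v' assume *: "e \<in> cinc n \<rho>" "v \<in> stab n \<rho>" "e' \<in> cinc n \<rho>" "v' \<in> stab n \<rho>" 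
    "v \<circ> e = v' \<circ> e'"
  note p = *(1,3)[THEN cinc_permutes] *(2,4)[THEN stab_permutes]
  have "pinv e \<circ> pinv v = pinv e' \<circ> pinv v'"
    using *(5) pinv_comp[OF p(3,1)] pinv_comp[OF p(4,2)] by simp
  then have "pinv e = pinv e' \<and> pinv v = pinv v'"
    using * assms by (intro incr_comp_stab_unique stab_inv) (auto simp: cinc_def)
  then show "e = e' \<and> v = v'" using p by (metis permutes_inv_inv)
qed

lemma cinc_decomp:
  assumes "w permutes {1..n}" "mono_on {1..n} \<rho>"
  shows "\<exists>e\<in>cinc n \<rho>. \<exists>v\<in>stab n \<rho>. w = v \<circ> e"
proof -
  obtain d v where dv: "d \<in> incr n \<rho>" "v \<in> stab n \<rho>" "pinv w = d \<circ> v"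
    using incr_stab_decomp[OF permutes_inv[OF assms(1)] assms(2)] by blast
  then have p: "d permutes {1..n}" "v permutes {1..n}" using incr_permutes stab_permutes by auto
  have "w = pinv v \<circ> pinv d"
    using pinv_comp[OF p] dv(3) permutes_inv_inv[OF assms(1)] by simp
  moreover have "pinv d \<in> cinc n \<rho>"
    using dv(1) p(1) by (simp add: cinc_def permutes_inv permutes_inv_inv)
  ultimately show ?thesis using stab_inv[OF dv(2)] by blast
qed

text \<open>By the closure assumption \<open>Y\<close> is a union of cosets, so the minimal
  representatives of its elements lie in \<open>Y\<close> again. Since \<open>d \<circ> v\<close> is
  the product v d, the sum over the stabiliser stands on the left; in \<open>tsum_cinc\<close> it
  stands on the right.\<close>

lemma tsum_incr:
  assumes "mono_on {1..n} \<rho>" and Y: "\<And>y. y \<in> Y \<Longrightarrow> y permutes {1..n}"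
    "\<And>y v. y \<in> Y \<Longrightarrow> v \<in> stab n \<rho> \<Longrightarrow> y \<circ> v \<in> Y"
  shows "hcong q n (tsum n c Y) (tsum n c (stab n \<rho>) * tsum n c (incr n \<rho> \<inter> Y))"
proof (rule tsum_mult)
  show "bij_betw (\<lambda>(v, d). d \<circ> v) (stab n \<rho> \<times> (incr n \<rho> \<inter> Y)) Y"
  proof (rule bij_betw_imageI)
    show "inj_on (\<lambda>(v, d). d \<circ> v) (stab n \<rho> \<times> (incr n \<rho> \<inter> Y))"
      using incr_comp_stab_unique[OF _ _ _ _ assms(1)] by (auto simp: inj_on_def)
    show "(\<lambda>(v, d). d \<circ> v) ` (stab n \<rho> \<times> (incr n \<rho> \<inter> Y)) = Y"
    proof
      show "Y \<subseteq> (\<lambda>(v, d). d \<circ> v) ` (stab n \<rho> \<times> (incr n \<rho> \<inter> Y))"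
      proof
        fix y assume y: "y \<in> Y"
        obtain d v where dv: "d \<in> incr n \<rho>" "v \<in> stab n \<rho>" "y = d \<circ> v"
          using incr_stab_decomp[OF Y(1)[OF y] assms(1)] by blast
        then have "d = y \<circ> pinv v"
          using permutes_inv_o(1)[OF stab_permutes[OF dv(2)]] by (simp add: comp_assoc)
        then have "d \<in> Y" using Y(2)[OF y stab_inv[OF dv(2)]] by simp
        then show "y \<in> (\<lambda>(v, d). d \<circ> v) ` (stab n \<rho> \<times> (incr n \<rho> \<inter> Y))" using dv by auto
      qed
    qed (use Y(2) in auto)
  qed
qed (use assms in \<open>auto simp: stab_permutes incr_permutes ilen_incr_comp_stab\<close>)

lemma tsum_cinc:
  assumes "mono_on {1..n} \<rho>" and Y: "\<And>y. y \<in> Y \<Longrightarrow> y permutes {1..n}"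
    "\<And>y v. y \<in> Y \<Longrightarrow> v \<in> stab n \<rho> \<Longrightarrow> v \<circ> y \<in> Y"
  shows "hcong q n (tsum n c Y) (tsum n c (cinc n \<rho> \<inter> Y) * tsum n c (stab n \<rho>))"
proof (rule tsum_mult)
  show "bij_betw (\<lambda>(e, v). v \<circ> e) ((cinc n \<rho> \<inter> Y) \<times> stab n \<rho>) Y"
  proof (rule bij_betw_imageI)
    show "inj_on (\<lambda>(e, v). v \<circ> e) ((cinc n \<rho> \<inter> Y) \<times> stab n \<rho>)"
      by (rule inj_on_subset[OF inj_on_cinc[OF assms(1)]]) auto
    show "(\<lambda>(e, v). v \<circ> e) ` ((cinc n \<rho> \<inter> Y) \<times> stab n \<rho>) = Y"
    proof
      show "Y \<subseteq> (\<lambda>(e, v). v \<circ> e) ` ((cinc n \<rho> \<inter> Y) \<times> stab n \<rho>)"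
      proof
        fix y assume y: "y \<in> Y"
        obtain e v where ev: "e \<in> cinc n \<rho>" "v \<in> stab n \<rho>" "y = v \<circ> e"
          using cinc_decomp[OF Y(1)[OF y] assms(1)] by blast
        then have "e = pinv v \<circ> y"
          using permutes_inv_o(2)[OF stab_permutes[OF ev(2)]] by (simp add: comp_assoc[symmetric])
        then have "e \<in> Y" using Y(2)[OF y stab_inv[OF ev(2)]] by simp
        then show "y \<in> (\<lambda>(e, v). v \<circ> e) ` ((cinc n \<rho> \<inter> Y) \<times> stab n \<rho>)" using ev by auto
      qed
    qed (use Y(2) in auto)
  qed
qed (use assms in \<open>auto simp: stab_permutes cinc_permutes ilen_cinc\<close>)

section \<open>Compositions and their diagrams\<close>

text \<open>With \<open>colf\<close> it recovers the box of \<open>p\<close> in the tableau filled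
  along rows, for \<open>p\<close> in {1..n}. Empty rows are skipped, because \<open>LEAST\<close>
  picks the first row at which the partial sum reaches \<open>p\<close>.\<close>

definition rowf :: "(nat \<Rightarrow> nat) \<Rightarrow> nat \<Rightarrow> nat" where
  "rowf lam p = (LEAST a. p \<le> (\<Sum>i\<in>{1..a}. lam i))"

definition colf :: "(nat \<Rightarrow> nat) \<Rightarrow> nat \<Rightarrow> nat" where
  "colf lam p = p - (\<Sum>i\<in>{1..<rowf lam p}. lam i)"

lemma sum_atLeastLessThan_plus:
  fixes lam :: "nat \<Rightarrow> nat"
  shows "1 \<le> a \<Longrightarrow> (\<Sum>i\<in>{1..<a}. lam i) + lam a = (\<Sum>i\<in>{1..a}. lam i)"
  by (simp add: sum.last_plus)

lemma rowf_row_tableau: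
  assumes "(a, b) \<in> diagram lam"
  shows "rowf lam (row_tableau lam a b) = a"
  unfolding rowf_def
proof (rule Least_equality)
  show "row_tableau lam a b \<le> (\<Sum>i\<in>{1..a}. lam i)"
    using assms sum_atLeastLessThan_plus[of a lam] by (simp add: row_tableau_def diagram_def)
  show "a \<le> y" if "row_tableau lam a b \<le> (\<Sum>i\<in>{1..y}. lam i)" for y
  proof (rule ccontr)
    assume "\<not> a \<le> y"
    then have "(\<Sum>i\<in>{1..y}. lam i) \<le> (\<Sum>i\<in>{1..<a}. lam i)" by (intro sum_mono2) auto
    then show False using that assms by (simp add: row_tableau_def diagram_def)
  qed
qed

lemma colf_row_tableau: "(a, b) \<in> diagram lam \<Longrightarrow> colf lam (row_tableau lam a b) = b"
  by (simp add: colf_def rowf_row_tableau) (simp add: row_tableau_def)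

lemma is_compositionD:
  assumes "is_composition n lam"
  shows "lam 0 = 0" "finite {i. lam i \<noteq> 0}" "(\<Sum>i | lam i \<noteq> 0. lam i) = n"
  using assms by (simp_all add: is_composition_def)

lemma partial_sum_le:
  assumes "is_composition n lam" shows "(\<Sum>i\<in>{1..a}. lam i) \<le> n"
proof -
  have "(\<Sum>i\<in>{1..a}. lam i) = (\<Sum>i\<in>{i \<in> {1..a}. lam i \<noteq> 0}. lam i)"
    by (rule sum.mono_neutral_right) auto
  also have "\<dots> \<le> (\<Sum>i | lam i \<noteq> 0. lam i)"
    using is_compositionD[OF assms] by (intro sum_mono2) auto
  finally show ?thesis using is_compositionD[OF assms] by simp
qed

lemma partial_sum_eq:
  assumes "is_composition n lam" shows "\<exists>a. (\<Sum>i\<in>{1..a}. lam i) = n"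
proof -
  note c = is_compositionD[OF assms]
  obtain a where "\<forall>i\<in>{i. lam i \<noteq> 0}. i \<le> a"
    using c(2) unfolding finite_nat_set_iff_bounded_le ..
  then have "i \<in> {1..a}" if "lam i \<noteq> 0" for i using that c(1) by (cases i) auto
  then have "{i. lam i \<noteq> 0} \<subseteq> {1..a}" by blast
  then have "(\<Sum>i\<in>{1..a}. lam i) = n"
    unfolding c(3)[symmetric] by (intro sum.mono_neutral_right) auto
  then show ?thesis ..
qed

lemma row_tableau_mem:
  assumes "is_composition n lam" "(a, b) \<in> diagram lam"
  shows "row_tableau lam a b \<in> {1..n}"
  using assms(2) partial_sum_le[OF assms(1), of a] sum_atLeastLessThan_plus[of a lam]
  by (auto simp: row_tableau_def diagram_def)

lemma rowf_colf:
  assumes "is_composition n lam" "p \<in> {1..n}"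
  shows "(rowf lam p, colf lam p) \<in> diagram lam" "row_tableau lam (rowf lam p) (colf lam p) = p"
proof -
  let ?S = "\<lambda>a. \<Sum>i\<in>{1..a}. lam i"
  obtain a where "?S a = n" using partial_sum_eq[OF assms(1)] ..
  then have "p \<le> ?S a" using assms(2) by simp
  then have le: "p \<le> ?S (rowf lam p)" unfolding rowf_def by (rule LeastI)
  then have pos: "1 \<le> rowf lam p" using assms(2) by (cases "rowf lam p") auto
  have "\<not> p \<le> ?S (rowf lam p - 1)"
    using pos unfolding rowf_def by (intro not_less_Least) simp
  moreover have "{1..rowf lam p - 1} = {1..<rowf lam p}" using pos by auto
  ultimately have "(\<Sum>i\<in>{1..<rowf lam p}. lam i) < p" by simp
  then show "(rowf lam p, colf lam p) \<in> diagram lam" "row_tableau lam (rowf lam p) (colf lam p) = p"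
    using le pos sum_atLeastLessThan_plus[OF pos, of lam]
    by (auto simp: diagram_def colf_def row_tableau_def)
qed

lemma bij_betw_row_tableau:
  assumes "is_composition n lam"
  shows "bij_betw (\<lambda>(a, b). row_tableau lam a b) (diagram lam) {1..n}"
  by (rule bij_betw_byWitness[where f' = "\<lambda>p. (rowf lam p, colf lam p)"])
    (use row_tableau_mem[OF assms] rowf_colf[OF assms] in
      \<open>auto simp: rowf_row_tableau colf_row_tableau\<close>)

lemma finite_diagram:
  assumes "is_composition n lam" shows "finite (diagram lam)"
  using bij_betw_finite[OF bij_betw_row_tableau[OF assms]] by simp

lemma mono_on_rowf:
  assumes "is_composition n lam" shows "mono_on {1..n} (rowf lam)"
proof (rule mono_onI)
  fix p p' assume *: "p \<in> {1..n}" "p' \<in> {1..n}" "p \<le> p'"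
  obtain a where "(\<Sum>i\<in>{1..a}. lam i) = n" using partial_sum_eq[OF assms] ..
  then have "p' \<le> (\<Sum>i\<in>{1..a}. lam i)" using *(2) by simp
  then have "p' \<le> (\<Sum>i\<in>{1..rowf lam p'}. lam i)" unfolding rowf_def by (rule LeastI)
  then have "p \<le> (\<Sum>i\<in>{1..rowf lam p'}. lam i)" using *(3) by simp
  then show "rowf lam p \<le> rowf lam p'" unfolding rowf_def[of lam p] by (rule Least_le)
qed

lemma rowf_image:
  assumes "is_composition n lam" "1 \<le> a"
  shows "row_tableau lam a ` {1..lam a} = {p \<in> {1..n}. rowf lam p = a}"
proof (intro equalityI subsetI)
  fix p assume "p \<in> row_tableau lam a ` {1..lam a}"
  then obtain b where "(a, b) \<in> diagram lam" "p = row_tableau lam a b"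
    using assms(2) by (auto simp: diagram_def)
  then show "p \<in> {p \<in> {1..n}. rowf lam p = a}"
    using row_tableau_mem[OF assms(1)] rowf_row_tableau by auto
next
  fix p assume "p \<in> {p \<in> {1..n}. rowf lam p = a}"
  then show "p \<in> row_tableau lam a ` {1..lam a}"
    using rowf_colf[OF assms(1), of p] by (auto simp: diagram_def intro!: image_eqI[of _ _ "colf lam p"])
qed

lemma rowf_pos: "is_composition n lam \<Longrightarrow> p \<in> {1..n} \<Longrightarrow> 1 \<le> rowf lam p"
  using rowf_colf(1)[of n lam p] by (simp add: diagram_def)

lemma card_rowf:
  assumes "is_composition n lam"
  shows "card {p \<in> {1..n}. rowf lam p = a} = lam a"
proof (cases "a = 0")
  case True
  then have "{p \<in> {1..n}. rowf lam p = a} = {}" using rowf_pos[OF assms] by force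
  then show ?thesis using True is_compositionD(1)[OF assms] by simp
next
  case False
  then have "card {p \<in> {1..n}. rowf lam p = a} = card (row_tableau lam a ` {1..lam a})"
    using rowf_image[OF assms, of a] by simp
  also have "\<dots> = lam a" by (subst card_image) (auto simp: row_tableau_def inj_on_def)
  finally show ?thesis .
qed

text \<open>Puts the Young subgroup into the form required by the coset results: the blocks are the
  fibres of the monotone function \<open>rowf lam\<close>.\<close>

lemma young_subgroup_eq:
  assumes "is_composition n lam"
  shows "young_subgroup n lam = stab n (rowf lam)"
proof (intro equalityI subsetI)
  fix w assume w: "w \<in> young_subgroup n lam"
  then have p: "w permutes {1..n}" by (simp add: young_subgroup_def)
  have "rowf lam (w x) = rowf lam x" if "x \<in> {1..n}" for x
  proof -
    let ?B = "{p \<in> {1..n}. rowf lam p = rowf lam x}"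
    have "\<forall>a\<ge>1. w ` row_tableau lam a ` {1..lam a} = row_tableau lam a ` {1..lam a}"
      using w unfolding young_subgroup_def by blast
    then have "w ` ?B = ?B"
      using rowf_pos[OF assms that] unfolding rowf_image[OF assms rowf_pos[OF assms that], symmetric] by blast
    then have "w x \<in> ?B" using that by blast
    then show ?thesis by simp
  qed
  then show "w \<in> stab n (rowf lam)" using p by (simp add: stab_def)
next
  fix w assume w: "w \<in> stab n (rowf lam)"
  then have p: "w permutes {1..n}" by (rule stab_permutes)
  have "w ` {p \<in> {1..n}. rowf lam p = a} = {p \<in> {1..n}. rowf lam p = a}" for a
  proof (rule card_subset_eq)
    show "w ` {p \<in> {1..n}. rowf lam p = a} \<subseteq> {p \<in> {1..n}. rowf lam p = a}"
      using w permutes_in_image[OF p] by (auto simp: stab_def)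
    show "card (w ` {p \<in> {1..n}. rowf lam p = a}) = card {p \<in> {1..n}. rowf lam p = a}"
      by (rule card_image) (rule inj_on_subset[OF permutes_inj[OF p] subset_UNIV])
  qed simp
  then show "w \<in> young_subgroup n lam"
    unfolding young_subgroup_def using p by (simp add: rowf_image[OF assms])
qed

lemma diagram_eq_Sigma:
  assumes "lam 0 = 0" shows "diagram lam = Sigma {i. lam i \<noteq> 0} (\<lambda>i. {1..lam i})"
proof -
  have "1 \<le> a" if "1 \<le> b" "b \<le> lam a" for a b
    using assms that by (cases a) auto
  then show ?thesis by (auto simp: diagram_def)
qed

lemma is_composition_iff_card:
  assumes "lam 0 = 0" "finite {i. lam i \<noteq> 0}"
  shows "is_composition n lam \<longleftrightarrow> card (diagram lam) = n"
  using assms by (simp add: is_composition_def diagram_eq_Sigma)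

text \<open>Equally large fibres of \<open>f\<close> and \<open>g\<close> are matched by bijections,
  and these are glued together. This supplies both the permutation of a tableau and the elements
  that link two members of a double coset.\<close>

lemma exists_permutes_fibres:
  assumes "finite S" "\<And>k. card {x \<in> S. f x = k} = card {x \<in> S. g x = k}"
  shows "\<exists>w. w permutes S \<and> (\<forall>x\<in>S. g (w x) = f x)"
proof -
  have "\<exists>h. bij_betw h {x \<in> S. f x = k} {x \<in> S. g x = k}" for k
    using assms by (intro finite_same_card_bij) auto
  then obtain h where h: "\<And>k. bij_betw (h k) {x \<in> S. f x = k} {x \<in> S. g x = k}" by metis
  define w where "w = (\<lambda>x. if x \<in> S then h (f x) x else x)"
  have w: "w x \<in> S" "g (w x) = f x" if "x \<in> S" for x
    using bij_betw_apply[OF h, of x "f x"] that by (auto simp: w_def)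
  have "inj_on w S"
  proof (rule inj_onI)
    fix x y assume xy: "x \<in> S" "y \<in> S" "w x = w y"
    then have "f x = f y" using w by metis
    then show "x = y"
      using xy bij_betw_imp_inj_on[OF h[of "f x"]] by (auto simp: w_def inj_on_def)
  qed
  moreover have "w ` S \<subseteq> S" using w by auto
  ultimately have "bij_betw w S S" using assms(1) by (simp add: bij_betw_def endo_inj_surj)
  then have "w permutes S" by (rule bij_imp_permutes) (simp add: w_def)
  then show ?thesis using w by blast
qed

section \<open>The permutation and the double coset of a tableau\<close>

text \<open>Reads the tableau as a function on 1, ..., n; the condition on 1_A then becomes that the
  entry at the image of \<open>x\<close> is the row of \<open>x\<close> in \<lambda>.\<close>

definition entry :: "(nat \<Rightarrow> nat) \<Rightarrow> tableau \<Rightarrow> nat \<Rightarrow> nat" where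
  "entry \<mu> A p = A (rowf \<mu> p) (colf \<mu> p)"

lemma content_eq_entry:
  assumes "is_composition n \<mu>"
  shows "content \<mu> A i = card {p \<in> {1..n}. entry \<mu> A p = i}"
proof -
  have "bij_betw (\<lambda>(a, b). row_tableau \<mu> a b) {(a, b) \<in> diagram \<mu>. A a b = i} {p \<in> {1..n}. entry \<mu> A p = i}"
    by (rule bij_betw_byWitness[where f' = "\<lambda>p. (rowf \<mu> p, colf \<mu> p)"])
      (use row_tableau_mem[OF assms] rowf_colf[OF assms] in
        \<open>auto simp: rowf_row_tableau colf_row_tableau entry_def\<close>)
  then show ?thesis unfolding content_def by (rule bij_betw_same_card)
qed

lemma is_composition_content:
  assumes "is_composition n \<mu>" "content \<mu> A 0 = 0"
  shows "is_composition n (content \<mu> A)"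
proof -
  have c: "content \<mu> A i = card {p \<in> {1..n}. entry \<mu> A p = i}" for i
    by (rule content_eq_entry[OF assms(1)])
  have "{i. content \<mu> A i \<noteq> 0} = entry \<mu> A ` {1..n}"
    unfolding c by auto
  moreover have "(\<Sum>i\<in>entry \<mu> A ` {1..n}. card {p \<in> {1..n}. entry \<mu> A p = i}) = n"
    using sum.image_gen[of "{1..n}" "\<lambda>_. 1 :: nat" "entry \<mu> A"] by simp
  ultimately show ?thesis using assms(2) unfolding is_composition_def c by simp
qed

text \<open>The double coset of \<open>A\<close>, described by the invariant that determines it: the number of positions
  in row \<open>a\<close> of the shape \<open>lam\<close> that are sent to row \<open>b\<close> of the shape \<open>\<mu>\<close>.\<close>

definition dcs :: "nat \<Rightarrow> (nat \<Rightarrow> nat) \<Rightarrow> (nat \<Rightarrow> nat) \<Rightarrow> tableau \<Rightarrow> (nat \<Rightarrow> nat) set" where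
  "dcs n lam \<mu> A = {w. w permutes {1..n} \<and> (\<forall>a b.
     card {x \<in> {1..n}. rowf lam x = a \<and> rowf \<mu> (w x) = b} = card {c \<in> {1..\<mu> b}. A b c = a})}"

lemma card_entry_rowf:
  assumes "is_composition n \<mu>"
  shows "card {p \<in> {1..n}. entry \<mu> A p = a \<and> rowf \<mu> p = b} = card {c \<in> {1..\<mu> b}. A b c = a}"
proof (cases "b = 0")
  case True
  then have "{p \<in> {1..n}. entry \<mu> A p = a \<and> rowf \<mu> p = b} = {}" using rowf_pos[OF assms] by force
  then show ?thesis using True is_compositionD(1)[OF assms] by simp
next
  case False
  then have D: "(b, c) \<in> diagram \<mu> \<longleftrightarrow> c \<in> {1..\<mu> b}" for c by (auto simp: diagram_def)
  have c: "row_tableau \<mu> b c \<in> {1..n}" "rowf \<mu> (row_tableau \<mu> b c) = b"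
    "colf \<mu> (row_tableau \<mu> b c) = c" if "c \<in> {1..\<mu> b}" for c
    using that row_tableau_mem[OF assms] rowf_row_tableau colf_row_tableau unfolding D[symmetric] by auto
  have p: "colf \<mu> p \<in> {1..\<mu> b}" "row_tableau \<mu> b (colf \<mu> p) = p"
    if "p \<in> {1..n}" "rowf \<mu> p = b" for p
    using rowf_colf[OF assms that(1)] that(2) D by auto
  have "bij_betw (row_tableau \<mu> b) {c \<in> {1..\<mu> b}. A b c = a} {p \<in> {1..n}. entry \<mu> A p = a \<and> rowf \<mu> p = b}"
  proof (rule bij_betw_byWitness[where f' = "colf \<mu>"])
    show "row_tableau \<mu> b ` {c \<in> {1..\<mu> b}. A b c = a} \<subseteq> {p \<in> {1..n}. entry \<mu> A p = a \<and> rowf \<mu> p = b}"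
      using c by (auto simp: entry_def)
    show "colf \<mu> ` {p \<in> {1..n}. entry \<mu> A p = a \<and> rowf \<mu> p = b} \<subseteq> {c \<in> {1..\<mu> b}. A b c = a}"
      using p by (auto simp: entry_def)
  qed (use c p in auto)
  then show ?thesis by (rule bij_betw_same_card[symmetric])
qed

text \<open>Justifies the definite description of 1_A: among the permutations that match rows of
  \<lambda> with entries of \<open>A\<close>, a single coset of the Young subgroup of \<lambda>, it
  is the minimal representative.\<close>

lemma tableau_perm_props:
  assumes \<mu>: "is_composition n \<mu>" and lam: "is_composition n lam" "lam = content \<mu> A"
  shows "tableau_perm n \<mu> lam A \<in> incr n (rowf lam) \<and>
    (\<forall>x\<in>{1..n}. entry \<mu> A (tableau_perm n \<mu> lam A x) = rowf lam x)"
proof -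
  \<comment> \<open>The reformulation of \<open>?R\<close> without columns; existence and uniqueness
    are proved for \<open>?Q\<close>.\<close>
  let ?Q = "\<lambda>w. w \<in> incr n (rowf lam) \<and> (\<forall>x\<in>{1..n}. entry \<mu> A (w x) = rowf lam x)"
  let ?R = "\<lambda>w. w permutes {1..n} \<and>
    (\<forall>a b. (a, b) \<in> diagram lam \<and> (a, b + 1) \<in> diagram lam \<longrightarrow>
       w (row_tableau lam a b) < w (row_tableau lam a (b + 1))) \<and>
    (\<forall>(a, b)\<in>diagram \<mu>. \<exists>c. (A a b, c) \<in> diagram lam \<and>
       w (row_tableau lam (A a b) c) = row_tableau \<mu> a b)"
  have mono: "mono_on {1..n} (rowf lam)" by (rule mono_on_rowf[OF lam(1)])
  have RQ: "?Q w" if R: "?R w" for w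
  proof
    from R have w: "w permutes {1..n}" by blast
    show "w \<in> incr n (rowf lam)"
    proof (rule incr_if_adjacent[OF w mono])
      fix i assume i: "i \<in> {1..<n}" "rowf lam i = rowf lam (i + 1)"
      let ?a = "rowf lam i"
      have c: "(?a, colf lam i) \<in> diagram lam" "row_tableau lam ?a (colf lam i) = i"
        "(?a, colf lam (i + 1)) \<in> diagram lam" "row_tableau lam ?a (colf lam (i + 1)) = i + 1"
        using rowf_colf[OF lam(1), of i] rowf_colf[OF lam(1), of "i + 1"] i by auto
      then have "colf lam (i + 1) = colf lam i + 1" by (auto simp: row_tableau_def)
      then show "w i < w (i + 1)" using R c by metis
    qed
    show "\<forall>x\<in>{1..n}. entry \<mu> A (w x) = rowf lam x"
    proof
      fix x assume x: "x \<in> {1..n}"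
      then have "w x \<in> {1..n}" using permutes_in_image[OF w] by simp
      note rc = rowf_colf[OF \<mu> this]
      obtain c where c: "(entry \<mu> A (w x), c) \<in> diagram lam"
        "w (row_tableau lam (entry \<mu> A (w x)) c) = row_tableau \<mu> (rowf \<mu> (w x)) (colf \<mu> (w x))"
        using R rc(1) unfolding entry_def by blast
      then have "row_tableau lam (entry \<mu> A (w x)) c = x"
        using rc(2) permutes_inj[OF w] by (simp add: inj_eq)
      then show "entry \<mu> A (w x) = rowf lam x" using rowf_row_tableau[OF c(1)] by simp
    qed
  qed
  have QR: "?R w" if Q: "?Q w" for w
  proof (intro conjI allI impI ballI)
    from Q have w: "w \<in> incr n (rowf lam)" by blast
    then show p: "w permutes {1..n}" by (rule incr_permutes)
    fix a b assume *: "(a, b) \<in> diagram lam \<and> (a, b + 1) \<in> diagram lam"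
    then have "rowf lam (row_tableau lam a b) = rowf lam (row_tableau lam a (b + 1))"
      by (simp add: rowf_row_tableau)
    moreover have "row_tableau lam a b < row_tableau lam a (b + 1)" by (simp add: row_tableau_def)
    ultimately show "w (row_tableau lam a b) < w (row_tableau lam a (b + 1))"
      using w * row_tableau_mem[OF lam(1)] by (auto simp: incr_def)
  next
    from Q have p: "w permutes {1..n}" using incr_permutes by blast
    fix x assume "x \<in> diagram \<mu>"
    then obtain a b where x: "x = (a, b)" and ab: "(a, b) \<in> diagram \<mu>" by (cases x) auto
    let ?y = "pinv w (row_tableau \<mu> a b)"
    have y: "?y \<in> {1..n}" "w ?y = row_tableau \<mu> a b"
      using permutes_in_image[OF permutes_inv[OF p]] permutes_inverses[OF p] row_tableau_mem[OF \<mu> ab] by auto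
    then have "rowf lam ?y = A a b"
      using Q ab by (metis entry_def rowf_row_tableau colf_row_tableau)
    then have "(A a b, colf lam ?y) \<in> diagram lam \<and> w (row_tableau lam (A a b) (colf lam ?y)) = row_tableau \<mu> a b"
      using rowf_colf[OF lam(1) y(1)] y(2) by simp
    then show "case x of (a, b) \<Rightarrow> \<exists>c. (A a b, c) \<in> diagram lam \<and>
       w (row_tableau lam (A a b) c) = row_tableau \<mu> a b"
      unfolding x by auto
  qed
  obtain w\<^sub>0 where w\<^sub>0: "?Q w\<^sub>0"
  proof -
    \<comment> \<open>Both sides are the part \<open>lam k\<close>, since \<open>lam\<close> is the
      content of \<open>A\<close>; this gives some matching permutation, which is then replaced by
      its coset representative \<open>d\<close>.\<close>
    have "card {x \<in> {1..n}. rowf lam x = k} = card {x \<in> {1..n}. entry \<mu> A x = k}" for k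
      using card_rowf[OF lam(1)] content_eq_entry[OF \<mu>, of A k] lam(2) by simp
    then obtain w where w: "w permutes {1..n}" "\<And>x. x \<in> {1..n} \<Longrightarrow> entry \<mu> A (w x) = rowf lam x"
      using exists_permutes_fibres[of "{1..n}" "rowf lam" "entry \<mu> A"] by auto
    obtain d v where dv: "d \<in> incr n (rowf lam)" "v \<in> stab n (rowf lam)" "w = d \<circ> v"
      using incr_stab_decomp[OF w(1) mono] by blast
    have vp: "v permutes {1..n}" using dv(2) by (rule stab_permutes)
    have "entry \<mu> A (d x) = rowf lam x" if x: "x \<in> {1..n}" for x
    proof -
      have y: "pinv v x \<in> {1..n}" "v (pinv v x) = x"
        using x permutes_in_image[OF permutes_inv[OF vp]] permutes_inverses[OF vp] by auto
      then have "entry \<mu> A (d x) = rowf lam (pinv v x)" using w(2)[OF y(1)] dv(3) by simp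
      also have "\<dots> = rowf lam x" using stab_inv[OF dv(2)] x by (simp add: stab_def)
      finally show ?thesis .
    qed
    then show ?thesis using dv(1) that by blast
  qed
  have uniq: "w = w'" if Q: "?Q w" "?Q w'" for w w'
  proof -
    have p: "w permutes {1..n}" "w' permutes {1..n}" using Q incr_permutes by auto
    let ?v = "pinv w' \<circ> w"
    have vp: "?v permutes {1..n}" using p by (intro permutes_compose permutes_inv)
    have "rowf lam (?v x) = rowf lam x" if "x \<in> {1..n}" for x
    proof -
      have "?v x \<in> {1..n}" using that permutes_in_image[OF vp] by simp
      then have "rowf lam (?v x) = entry \<mu> A (w' (?v x))" using Q(2) by simp
      also have "w' (?v x) = w x" using permutes_inverses[OF p(2)] by simp
      finally show ?thesis using Q(1) that by simp
    qed
    then have "?v \<in> stab n (rowf lam)" using vp by (simp add: stab_def)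
    moreover have "w' \<circ> ?v = w \<circ> id" using permutes_inv_o[OF p(2)] by (simp add: comp_assoc[symmetric])
    ultimately show ?thesis using incr_comp_stab_unique[of w' n "rowf lam" w ?v id] Q mono id_in_stab by auto
  qed
  have "\<exists>!w. ?R w"
  proof (rule ex1I[of _ w\<^sub>0])
    show "?R w\<^sub>0" using w\<^sub>0 by (rule QR)
    show "w = w\<^sub>0" if "?R w" for w using RQ[OF that] w\<^sub>0 by (rule uniq)
  qed
  then have "?R (tableau_perm n \<mu> lam A)" unfolding tableau_perm_def by (rule theI')
  then show ?thesis by (rule RQ)
qed

lemma card_permutes_Collect:
  assumes "u permutes S"
  shows "card {x \<in> S. P (u x)} = card {x \<in> S. P x}"
proof -
  have "u ` {x \<in> S. P (u x)} = {x \<in> S. P x}"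
  proof (intro equalityI subsetI)
    fix x assume "x \<in> {x \<in> S. P x}"
    then show "x \<in> u ` {x \<in> S. P (u x)}"
      using permutes_inverses[OF assms] permutes_in_image[OF permutes_inv[OF assms]]
      by (intro image_eqI[of _ _ "pinv u x"]) auto
  qed (use permutes_in_image[OF assms] in auto)
  moreover have "inj_on u {x \<in> S. P (u x)}" using permutes_inj[OF assms] by (rule inj_on_subset) auto
  ultimately show ?thesis using card_image by metis
qed

text \<open>Composing with the two Young subgroups does not change the matrix of counts. Conversely,
  equal matrices mean that the pair of rows of \<open>x\<close> and of its image has equally large
  fibres for both permutations; a matching \<open>u\<close> exists, and what remains preserves the
  rows of \<mu>.\<close>

lemma double_coset_eq:
  assumes \<mu>: "is_composition n \<mu>" and lam: "is_composition n lam" "lam = content \<mu> A"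
  shows "double_coset n lam (tableau_perm n \<mu> lam A) \<mu> = dcs n lam \<mu> A"
proof -
  define d where "d = tableau_perm n \<mu> lam A"
  have d: "d permutes {1..n}" "\<And>x. x \<in> {1..n} \<Longrightarrow> entry \<mu> A (d x) = rowf lam x"
    using tableau_perm_props[OF assms] incr_permutes by (auto simp: d_def)
  have dm: "d x \<in> {1..n} \<longleftrightarrow> x \<in> {1..n}" for x using permutes_in_image[OF d(1)] .
  \<comment> \<open>The matrix of 1_A itself: its entry at (a, b) is the number of occurrences of
    \<open>a\<close> in row \<open>b\<close> of \<open>A\<close>.\<close>
  have cnt: "card {x \<in> {1..n}. rowf lam x = a \<and> rowf \<mu> (d x) = b} = card {c \<in> {1..\<mu> b}. A b c = a}" for a b
  proof -
    have "{x \<in> {1..n}. rowf lam x = a \<and> rowf \<mu> (d x) = b}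
        = {x \<in> {1..n}. entry \<mu> A (d x) = a \<and> rowf \<mu> (d x) = b}"
      using d(2) by auto
    then show ?thesis
      using card_permutes_Collect[OF d(1), of "\<lambda>p. entry \<mu> A p = a \<and> rowf \<mu> p = b"]
        card_entry_rowf[OF \<mu>, of A a b] by simp
  qed
  have "double_coset n lam d \<mu> = {v \<circ> d \<circ> u | u v. u \<in> stab n (rowf lam) \<and> v \<in> stab n (rowf \<mu>)}"
    by (auto simp: double_coset_def perm_mult_def young_subgroup_eq[OF \<mu>] young_subgroup_eq[OF lam(1)] comp_assoc)
  also have "\<dots> = dcs n lam \<mu> A"
  proof (intro equalityI subsetI)
    fix w assume "w \<in> {v \<circ> d \<circ> u | u v. u \<in> stab n (rowf lam) \<and> v \<in> stab n (rowf \<mu>)}"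
    then obtain u v where uv: "u \<in> stab n (rowf lam)" "v \<in> stab n (rowf \<mu>)" "w = v \<circ> d \<circ> u" by blast
    have p: "u permutes {1..n}" "v permutes {1..n}" using uv stab_permutes by auto
    have "card {x \<in> {1..n}. rowf lam x = a \<and> rowf \<mu> (w x) = b} = card {c \<in> {1..\<mu> b}. A b c = a}" for a b
    proof -
      have "{x \<in> {1..n}. rowf lam x = a \<and> rowf \<mu> (w x) = b}
          = {x \<in> {1..n}. rowf lam (u x) = a \<and> rowf \<mu> (d (u x)) = b}"
        using uv permutes_in_image[OF p(1)] dm by (auto simp: stab_def)
      then show ?thesis
        using card_permutes_Collect[OF p(1), of "\<lambda>x. rowf lam x = a \<and> rowf \<mu> (d x) = b"] cnt by simp
    qed
    then show "w \<in> dcs n lam \<mu> A" using uv(3) p d(1) by (simp add: dcs_def permutes_compose)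
  next
    fix w assume w: "w \<in> dcs n lam \<mu> A"
    then have wp: "w permutes {1..n}" by (simp add: dcs_def)
    let ?f = "\<lambda>w x. (rowf lam x, rowf \<mu> (w x))"
    have "card {x \<in> {1..n}. ?f w x = k} = card {x \<in> {1..n}. ?f d x = k}" for k
      using w cnt[of "fst k" "snd k"] by (cases k) (simp add: dcs_def)
    then obtain u where u: "u permutes {1..n}" "\<And>x. x \<in> {1..n} \<Longrightarrow> ?f d (u x) = ?f w x"
      using exists_permutes_fibres[of "{1..n}" "?f w" "?f d"] by auto
    have us: "u \<in> stab n (rowf lam)" using u by (simp add: stab_def)
    define v where "v = w \<circ> pinv u \<circ> pinv d"
    have vp: "v permutes {1..n}"
      unfolding v_def using wp u(1) d(1) by (intro permutes_compose permutes_inv)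
    have "rowf \<mu> (v x) = rowf \<mu> x" if x: "x \<in> {1..n}" for x
    proof -
      let ?y = "pinv u (pinv d x)"
      have y: "?y \<in> {1..n}" "d (u ?y) = x"
        using x permutes_in_image[OF permutes_inv[OF u(1)]] permutes_in_image[OF permutes_inv[OF d(1)]]
          permutes_inverses[OF u(1)] permutes_inverses[OF d(1)] by auto
      have "rowf \<mu> (v x) = rowf \<mu> (w ?y)" by (simp add: v_def)
      also have "\<dots> = rowf \<mu> (d (u ?y))" using u(2)[OF y(1)] by simp
      finally show ?thesis using y(2) by simp
    qed
    then have "v \<in> stab n (rowf \<mu>)" using vp by (simp add: stab_def)
    moreover have "w = v \<circ> d \<circ> u"
      using permutes_inverses[OF u(1)] permutes_inverses[OF d(1)] by (auto simp: v_def fun_eq_iff)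
    ultimately show "w \<in> {v \<circ> d \<circ> u | u v. u \<in> stab n (rowf lam) \<and> v \<in> stab n (rowf \<mu>)}"
      using us by blast
  qed
  finally show ?thesis by (simp add: d_def)
qed

section \<open>The homomorphisms and the Specht module\<close>

lemma finsum_hecke_class:
  assumes "\<And>x. x \<in> X \<Longrightarrow> f x = hecke_class q n (p x)" "\<And>x. x \<in> X \<Longrightarrow> p x \<in> free_carrier n"
  shows "(\<Oplus>\<^bsub>hecke q n\<^esub>x\<in>X. f x) = hecke_class q n (sum p X)"
proof -
  interpret ring "hecke q n" by (rule ring_hecke)
  have "(\<Oplus>\<^bsub>hecke q n\<^esub>x\<in>X. f x) = (\<Oplus>\<^bsub>hecke q n\<^esub>x\<in>X. hecke_class q n (p x))"
    using assms by (intro finsum_cong') (auto simp: hecke_class_closed)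
  then show ?thesis using hecke_class_sum[OF assms(2)] by simp
qed

lemma finsum_hecke_T:
  assumes "\<And>w. w \<in> X \<Longrightarrow> w permutes {1..n}"
  shows "(\<Oplus>\<^bsub>hecke q n\<^esub>w\<in>X. hecke_T q n w) = hecke_class q n (tsum n 1 X)"
proof -
  have "(\<Oplus>\<^bsub>hecke q n\<^esub>w\<in>X. hecke_T q n w) = hecke_class q n (sum (tgen n) X)"
    using assms by (intro finsum_hecke_class hecke_T_eq tgen_in_free_carrier)
  then show ?thesis by (simp add: tsum_def)
qed

lemma x_elt_eq:
  assumes "is_composition n \<mu>"
  shows "x_elt q n \<mu> = hecke_class q n (tsum n 1 (stab n (rowf \<mu>)))"
  unfolding x_elt_def young_subgroup_eq[OF assms] by (intro finsum_hecke_T stab_permutes)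

lemma y_elt_eq:
  assumes "is_composition n \<mu>"
  shows "y_elt q n \<mu> = hecke_class q n (tsum n (inverse (- q)) (stab n (rowf \<mu>)))"
  unfolding y_elt_def young_subgroup_eq[OF assms] tsum_def
proof (rule finsum_hecke_class)
  fix w assume "w \<in> stab n (rowf \<mu>)"
  then have w: "w permutes {1..n}" by (rule stab_permutes)
  show "hecke_smult q n ((- q) powi (- int (coxeter_length n w))) (hecke_T q n w)
      = hecke_class q n (const (inverse (- q) ^ ilen w) * tgen n w)"
    unfolding coxeter_length_eq_ilen[OF w] hecke_T_eq[OF w] hecke_smult_class[OF tgen_in_free_carrier[OF w]]
    by (simp only: power_int_minus power_int_of_nat power_inverse)
  show "const (inverse (- q) ^ ilen w) * tgen n w \<in> free_carrier n"
    using w by (intro mult_in_free_carrier tgen_in_free_carrier const_in_free_carrier)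
qed

lemma dcs_permutes: "w \<in> dcs n lam \<mu> A \<Longrightarrow> w permutes {1..n}"
  by (simp add: dcs_def)

lemma dcs_comp_stab:
  assumes "w \<in> dcs n lam \<mu> A" "u \<in> stab n (rowf lam)"
  shows "w \<circ> u \<in> dcs n lam \<mu> A"
proof -
  have p: "w permutes {1..n}" "u permutes {1..n}"
    using assms dcs_permutes stab_permutes by auto
  have "{x \<in> {1..n}. rowf lam x = a \<and> rowf \<mu> ((w \<circ> u) x) = b}
      = {x \<in> {1..n}. rowf lam (u x) = a \<and> rowf \<mu> (w (u x)) = b}" for a b
    using assms(2) by (auto simp: stab_def)
  then show ?thesis
    using assms(1) p card_permutes_Collect[OF p(2), of "\<lambda>x. rowf lam x = a \<and> rowf \<mu> (w x) = b" for a b]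
    by (simp add: dcs_def permutes_compose)
qed

lemma stab_comp_dcs:
  assumes "w \<in> dcs n lam \<mu> A" "v \<in> stab n (rowf \<mu>)"
  shows "v \<circ> w \<in> dcs n lam \<mu> A"
proof -
  have p: "w permutes {1..n}" "v permutes {1..n}"
    using assms dcs_permutes stab_permutes by auto
  have m: "w x \<in> {1..n} \<longleftrightarrow> x \<in> {1..n}" for x
    using permutes_in_image[OF p(1)] .
  have "{x \<in> {1..n}. rowf lam x = a \<and> rowf \<mu> ((v \<circ> w) x) = b}
      = {x \<in> {1..n}. rowf lam x = a \<and> rowf \<mu> (w x) = b}" for a b
    using assms(2) m by (auto simp: stab_def)
  then show ?thesis
    using assms(1) p by (simp add: dcs_def permutes_compose)
qed

lemma tsum_dcs_in_free_carrier: "tsum n c (dcs n lam \<mu> A) \<in> free_carrier n"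
  by (intro tsum_in_free_carrier dcs_permutes)

lemma tsum_stab_in_free_carrier: "tsum n c (stab n \<rho>) \<in> free_carrier n"
  by (intro tsum_in_free_carrier stab_permutes)

lemma hecke_hom_PiE: "f \<in> hecke_hom q n M N \<Longrightarrow> f \<in> M \<rightarrow>\<^sub>E N"
  by (simp add: hecke_hom_def)

text \<open>The definite description in \<open>phi\<close> has to be resolved. The double coset sum
  \<open>D\<close> is \<open>g\<close> times x_\<mu>, and left multiplication by \<open>g\<close>
  commutes with the right action. It lands in M^\<lambda> because \<open>D\<close> is also
  x_\<lambda> times \<open>g'\<close>. Uniqueness holds since x_\<mu> generates M^\<mu>.\<close>

lemma phi_eq:
  assumes \<mu>: "is_composition n \<mu>" and A: "content \<mu> A 0 = 0" and h: "h \<in> free_carrier n"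
  shows "phi q n \<mu> A (hecke_class q n (tsum n 1 (stab n (rowf \<mu>)) * h)) =
    hecke_class q n (tsum n 1 (dcs n (content \<mu> A) \<mu> A) * h)"
proof -
  interpret ring "hecke q n" by (rule ring_hecke)
  define lam where "lam = content \<mu> A"
  define x where "x = hecke_class q n (tsum n 1 (stab n (rowf \<mu>)))"
  define D where "D = hecke_class q n (tsum n 1 (dcs n lam \<mu> A))"
  have lam: "is_composition n lam" unfolding lam_def by (rule is_composition_content[OF \<mu> A])
  let ?G = "tsum n 1 (cinc n (rowf \<mu>) \<inter> dcs n lam \<mu> A) :: 'a free_alg"
  let ?G' = "tsum n 1 (incr n (rowf lam) \<inter> dcs n lam \<mu> A) :: 'a free_alg"
  have G: "?G \<in> free_carrier n" "?G' \<in> free_carrier n"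
    by (auto intro: tsum_in_free_carrier dcs_permutes)
  define g where "g = hecke_class q n ?G"
  define g' where "g' = hecke_class q n ?G'"
  have gc: "g \<in> carrier (hecke q n)" "g' \<in> carrier (hecke q n)"
    unfolding g_def g'_def using G by (auto intro: hecke_class_closed)
  have xc: "x \<in> carrier (hecke q n)" "x_elt q n lam \<in> carrier (hecke q n)"
    unfolding x_def x_elt_eq[OF lam] by (intro hecke_class_closed tsum_stab_in_free_carrier)+
  have "hcong q n (tsum n 1 (dcs n lam \<mu> A)) (?G * tsum n 1 (stab n (rowf \<mu>)))"
    by (intro tsum_cinc mono_on_rowf \<mu> dcs_permutes stab_comp_dcs)
  then have Dg: "D = g \<otimes>\<^bsub>hecke q n\<^esub> x"
    unfolding D_def g_def x_def using G(1) hecke_class_eq_iff hcong_carrier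
    by (metis hecke_class_mult tsum_stab_in_free_carrier)
  have "hcong q n (tsum n 1 (dcs n lam \<mu> A)) (tsum n 1 (stab n (rowf lam)) * ?G')"
    by (intro tsum_incr mono_on_rowf lam dcs_permutes dcs_comp_stab)
  then have Dg': "D = x_elt q n lam \<otimes>\<^bsub>hecke q n\<^esub> g'"
    unfolding D_def g'_def x_elt_eq[OF lam] using G(2) hecke_class_eq_iff hcong_carrier
    by (metis hecke_class_mult tsum_stab_in_free_carrier)
  have M: "perm_module q n \<mu> = {x \<otimes>\<^bsub>hecke q n\<^esub> h | h. h \<in> carrier (hecke q n)}"
    unfolding perm_module_def x_elt_eq[OF \<mu>] x_def ..
  have xM: "x \<in> perm_module q n \<mu>" unfolding M using xc by (auto intro!: exI[of _ "\<one>\<^bsub>hecke q n\<^esub>"])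
  have Mc: "perm_module q n \<mu> \<subseteq> carrier (hecke q n)" unfolding M using xc by auto
  have Mr: "v \<otimes>\<^bsub>hecke q n\<^esub> k \<in> perm_module q n \<mu>"
    if "v \<in> perm_module q n \<mu>" "k \<in> carrier (hecke q n)" for v k
    using that xc unfolding M by (auto simp: m_assoc intro!: m_closed)
  have Ma: "u \<oplus>\<^bsub>hecke q n\<^esub> v \<in> perm_module q n \<mu>"
    if "u \<in> perm_module q n \<mu>" "v \<in> perm_module q n \<mu>" for u v
    using that xc unfolding M by (auto simp: r_distr[symmetric])
  have dc: "(\<Oplus>\<^bsub>hecke q n\<^esub> w\<in>double_coset n lam (tableau_perm n \<mu> lam A) \<mu>. hecke_T q n w) = D"
    unfolding double_coset_eq[OF \<mu> lam lam_def] D_def by (intro finsum_hecke_T dcs_permutes)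
  let ?P = "\<lambda>f. f \<in> hecke_hom q n (perm_module q n \<mu>) (perm_module q n lam) \<and> f x = D"
  let ?r = "restrict (\<lambda>v. g \<otimes>\<^bsub>hecke q n\<^esub> v) (perm_module q n \<mu>)"
  have r: "?P ?r"
  proof
    show "restrict (\<lambda>v. g \<otimes>\<^bsub>hecke q n\<^esub> v) (perm_module q n \<mu>) x = D"
      using xM Dg by simp
    have "g \<otimes>\<^bsub>hecke q n\<^esub> v \<in> perm_module q n lam" if v: "v \<in> perm_module q n \<mu>" for v
    proof -
      obtain k where k: "k \<in> carrier (hecke q n)" "v = x \<otimes>\<^bsub>hecke q n\<^esub> k"
        using v unfolding M by blast
      then have "g \<otimes>\<^bsub>hecke q n\<^esub> v = x_elt q n lam \<otimes>\<^bsub>hecke q n\<^esub> (g' \<otimes>\<^bsub>hecke q n\<^esub> k)"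
        using Dg Dg' gc xc by (simp add: m_assoc[symmetric])
      then show ?thesis unfolding perm_module_def using gc k(1) by blast
    qed
    moreover have "v \<in> carrier (hecke q n)" if "v \<in> perm_module q n \<mu>" for v
      using Mc that by blast
    ultimately show "restrict (\<lambda>v. g \<otimes>\<^bsub>hecke q n\<^esub> v) (perm_module q n \<mu>)
        \<in> hecke_hom q n (perm_module q n \<mu>) (perm_module q n lam)"
      unfolding hecke_hom_def
      by (intro CollectI conjI ballI) (simp_all add: Ma Mr gc r_distr m_assoc)
  qed
  have uniq: "f v = D \<otimes>\<^bsub>hecke q n\<^esub> k"
    if f: "?P f" and k: "k \<in> carrier (hecke q n)" "v = x \<otimes>\<^bsub>hecke q n\<^esub> k" for f v k
    using f k xM unfolding hecke_hom_def by auto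
  have "\<exists>!f. ?P f"
  proof (rule ex1I[of _ ?r])
    show "?P ?r" by (rule r)
    show "f = ?r" if f: "?P f" for f
    proof (rule PiE_ext)
      show "f \<in> perm_module q n \<mu> \<rightarrow>\<^sub>E perm_module q n lam" "?r \<in> perm_module q n \<mu> \<rightarrow>\<^sub>E perm_module q n lam"
        by (rule hecke_hom_PiE[OF conjunct1[OF f]], rule hecke_hom_PiE[OF conjunct1[OF r]])
      fix v assume "v \<in> perm_module q n \<mu>"
      then obtain k where k: "k \<in> carrier (hecke q n)" "v = x \<otimes>\<^bsub>hecke q n\<^esub> k" unfolding M by blast
      show "f v = ?r v" unfolding uniq[OF f k] uniq[OF r k] ..
    qed
  qed
  then have "?P (THE f. ?P f)" by (rule theI')
  moreover have "phi q n \<mu> A = (THE f. ?P f)"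
    unfolding phi_def Let_def lam_def[symmetric] x_elt_eq[OF \<mu>] dc x_def ..
  ultimately have "?P (phi q n \<mu> A)" by simp
  then have "phi q n \<mu> A (x \<otimes>\<^bsub>hecke q n\<^esub> hecke_class q n h) = D \<otimes>\<^bsub>hecke q n\<^esub> hecke_class q n h"
    using h by (intro uniq) (auto intro: hecke_class_closed)
  then show ?thesis
    unfolding x_def D_def lam_def hecke_class_mult[OF tsum_stab_in_free_carrier h]
      hecke_class_mult[OF tsum_dcs_in_free_carrier h] .
qed

section \<open>Conjugate partitions, the permutation w_\<mu> and the Specht module\<close>

lemma downward_closed_eq_interval:
  assumes "finite S" "0 \<notin> S" "\<And>i j. j \<in> S \<Longrightarrow> 1 \<le> i \<Longrightarrow> i \<le> j \<Longrightarrow> i \<in> S"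
  shows "S = {1..card S}"
proof (cases "S = {}")
  case False
  then have M: "Max S \<in> S" "\<And>i. i \<in> S \<Longrightarrow> i \<le> Max S"
    using Max_in[OF assms(1)] Max_ge[OF assms(1)] by auto
  have "i \<in> S \<longleftrightarrow> i \<in> {1..Max S}" for i
    using assms(2) assms(3)[OF M(1), of i] M(2)[of i] by (cases i) auto
  then have "S = {1..Max S}" by blast
  then show ?thesis by (metis card_atLeastAtMost diff_Suc_1 One_nat_def)
qed simp

lemma is_partition_antimono:
  assumes "is_partition n \<mu>" "1 \<le> i" "i \<le> j" shows "\<mu> j \<le> \<mu> i"
  using assms(3)
proof (induction j rule: dec_induct)
  case (step k)
  have "\<mu> (k + 1) \<le> \<mu> k" using assms(1,2) step(1) by (auto simp: is_partition_def)
  then show ?case using step by (simp flip: Suc_eq_plus1)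
qed simp

lemma is_partition_is_composition: "is_partition n \<mu> \<Longrightarrow> is_composition n \<mu>"
  by (simp add: is_partition_def)

text \<open>For a partition the rows of length at least \<open>b\<close> form an initial segment, so
  membership in it is a comparison with its cardinality.\<close>

lemma diagram_conjugate:
  assumes "is_partition n \<mu>"
  shows "(b, a) \<in> diagram (conjugate \<mu>) \<longleftrightarrow> (a, b) \<in> diagram \<mu>"
proof (cases "1 \<le> b")
  case True
  note c = is_compositionD[OF is_partition_is_composition[OF assms]]
  let ?S = "{i. 1 \<le> i \<and> b \<le> \<mu> i}"
  have "?S = {1..card ?S}"
  proof (rule downward_closed_eq_interval)
    show "finite ?S" using True by (intro finite_subset[OF _ c(2)]) auto
    show "i \<in> ?S" if "j \<in> ?S" "1 \<le> i" "i \<le> j" for i j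
      using is_partition_antimono[OF assms that(2,3)] that by auto
  qed simp
  then have "1 \<le> a \<and> b \<le> \<mu> a \<longleftrightarrow> 1 \<le> a \<and> a \<le> card ?S" by (metis atLeastAtMost_iff mem_Collect_eq)
  then show ?thesis using True by (auto simp: diagram_def conjugate_def)
qed (auto simp: diagram_def)

lemma is_composition_conjugate:
  assumes "is_partition n \<mu>" shows "is_composition n (conjugate \<mu>)"
proof -
  have \<mu>: "is_composition n \<mu>" using assms by (rule is_partition_is_composition)
  have D: "diagram (conjugate \<mu>) = prod.swap ` diagram \<mu>"
    using diagram_conjugate[OF assms] by (force simp: image_iff)
  have "{b. conjugate \<mu> b \<noteq> 0} \<subseteq> fst ` diagram (conjugate \<mu>)"
  proof
    fix b assume "b \<in> {b. conjugate \<mu> b \<noteq> 0}"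
    then have "(b, 1) \<in> diagram (conjugate \<mu>)"
      by (cases "b = 0") (auto simp: diagram_def conjugate_def Suc_le_eq One_nat_def)
    then show "b \<in> fst ` diagram (conjugate \<mu>)" by force
  qed
  then have "finite {b. conjugate \<mu> b \<noteq> 0}"
    unfolding D using finite_diagram[OF \<mu>] by (meson finite_imageI finite_subset)
  moreover have "card (diagram (conjugate \<mu>)) = n"
    unfolding D using \<mu> is_composition_iff_card[of \<mu> n] is_compositionD[OF \<mu>]
    by (subst card_image) auto
  ultimately show ?thesis by (subst is_composition_iff_card) (auto simp: conjugate_def)
qed

lemma column_tableau_eq: "column_tableau \<mu> a b = row_tableau (conjugate \<mu>) b a"
  by (simp add: column_tableau_def row_tableau_def)

lemma specht_perm_props:
  assumes "is_partition n \<mu>"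
  shows "specht_perm n \<mu> permutes {1..n}"
    "(a, b) \<in> diagram \<mu> \<Longrightarrow> specht_perm n \<mu> (row_tableau \<mu> a b) = row_tableau (conjugate \<mu>) b a"
proof -
  have \<mu>: "is_composition n \<mu>" and \<mu>': "is_composition n (conjugate \<mu>)"
    using assms is_partition_is_composition is_composition_conjugate by auto
  note rc = rowf_colf[OF \<mu>]
  let ?R = "\<lambda>w. w permutes {1..n} \<and>
    (\<forall>(a, b)\<in>diagram \<mu>. w (row_tableau \<mu> a b) = column_tableau \<mu> a b)"
  \<comment> \<open>Reads the box of \<open>p\<close> along rows and returns its number along
    columns; the column reading is the row reading of the conjugate.\<close>
  define w where "w = (\<lambda>p. if p \<in> {1..n} then row_tableau (conjugate \<mu>) (colf \<mu> p) (rowf \<mu> p) else p)"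
  have "bij_betw w {1..n} {1..n}"
  proof (rule bij_betw_byWitness[where f' = "\<lambda>p. row_tableau \<mu> (colf (conjugate \<mu>) p) (rowf (conjugate \<mu>) p)"])
    note rc' = rowf_colf[OF \<mu>']
    show "\<forall>p\<in>{1..n}. row_tableau \<mu> (colf (conjugate \<mu>) (w p)) (rowf (conjugate \<mu>) (w p)) = p"
      using rc by (auto simp: w_def colf_row_tableau rowf_row_tableau diagram_conjugate[OF assms])
    show "\<forall>p\<in>{1..n}. w (row_tableau \<mu> (colf (conjugate \<mu>) p) (rowf (conjugate \<mu>) p)) = p"
      using rc' row_tableau_mem[OF \<mu>]
      by (auto simp: w_def colf_row_tableau rowf_row_tableau diagram_conjugate[OF assms])
    show "w ` {1..n} \<subseteq> {1..n}"
      using rc row_tableau_mem[OF \<mu>'] by (auto simp: w_def diagram_conjugate[OF assms])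
    show "(\<lambda>p. row_tableau \<mu> (colf (conjugate \<mu>) p) (rowf (conjugate \<mu>) p)) ` {1..n} \<subseteq> {1..n}"
      using rc' row_tableau_mem[OF \<mu>] by (auto simp: diagram_conjugate[OF assms])
  qed
  then have w: "w permutes {1..n}" by (rule bij_imp_permutes) (auto simp: w_def)
  have "\<exists>!w. ?R w"
  proof (rule ex1I[of _ w])
    have "w (row_tableau \<mu> a b) = column_tableau \<mu> a b" if "(a, b) \<in> diagram \<mu>" for a b
      using that row_tableau_mem[OF \<mu> that]
      by (simp add: w_def rowf_row_tableau colf_row_tableau column_tableau_eq)
    then show "?R w" using w by blast
    fix v assume v: "?R v"
    show "v = w"
    proof
      fix p
      show "v p = w p"
      proof (cases "p \<in> {1..n}")
        case True
        have "v (row_tableau \<mu> (rowf \<mu> p) (colf \<mu> p)) = column_tableau \<mu> (rowf \<mu> p) (colf \<mu> p)"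
          using v rc(1)[OF True] by blast
        then show ?thesis using True rc(2)[OF True] by (simp add: w_def column_tableau_eq)
      next
        case False
        then show ?thesis using v w by (metis permutes_not_in)
      qed
    qed
  qed
  then have R: "?R (specht_perm n \<mu>)" unfolding specht_perm_def by (rule theI')
  then show "specht_perm n \<mu> permutes {1..n}" by blast
  show "(a, b) \<in> diagram \<mu> \<Longrightarrow> specht_perm n \<mu> (row_tableau \<mu> a b) = row_tableau (conjugate \<mu>) b a"
    using R unfolding column_tableau_eq[symmetric] by blast
qed

text \<open>Reduces the vanishing of a combination of maps to congruences in the free algebra: an
  element of the Specht module is the class of x_\<mu> s h, and the map replaces x_\<mu> by the
  double coset sum. It is applied to the hypothesis over m and to the conclusion over n.\<close>

lemma phi_hat_combination_zero_iff:
  fixes q :: "'f::field" and A :: "'i \<Rightarrow> tableau"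
  assumes \<mu>: "is_partition n \<mu>" and A: "\<And>i. i \<in> I \<Longrightarrow> content \<mu> (A i) 0 = 0"
  shows "phi_hat_combination_zero q n \<mu> I c A \<longleftrightarrow>
    (\<forall>h\<in>free_carrier n. hcong q n
      (\<Sum>i\<in>I. const (c i) * (tsum n 1 (dcs n (content \<mu> (A i)) \<mu> (A i)) *
        (tgen n (specht_perm n \<mu>) * tsum n (inverse (- q)) (stab n (rowf (conjugate \<mu>))) * h))) 0)"
proof -
  let ?x = "tsum n 1 (stab n (rowf \<mu>)) :: 'f free_alg"
  let ?s = "tgen n (specht_perm n \<mu>) * tsum n (inverse (- q)) (stab n (rowf (conjugate \<mu>))) :: 'f free_alg"
  let ?D = "\<lambda>i. tsum n 1 (dcs n (content \<mu> (A i)) \<mu> (A i)) :: 'f free_alg"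
  have \<mu>c: "is_composition n \<mu>" and \<mu>': "is_composition n (conjugate \<mu>)"
    using \<mu> is_partition_is_composition is_composition_conjugate by auto
  have sc: "?s \<in> free_carrier n"
    by (intro mult_in_free_carrier tgen_in_free_carrier specht_perm_props[OF \<mu>] tsum_stab_in_free_carrier)
  have S: "specht_module q n \<mu> = {hecke_class q n (?x * (?s * h)) | h. h \<in> free_carrier n}"
  proof -
    note t = tgen_in_free_carrier[OF specht_perm_props(1)[OF \<mu>]]
    have "x_elt q n \<mu> \<otimes>\<^bsub>hecke q n\<^esub> hecke_T q n (specht_perm n \<mu>) \<otimes>\<^bsub>hecke q n\<^esub> y_elt q n (conjugate \<mu>)
        \<otimes>\<^bsub>hecke q n\<^esub> hecke_class q n h = hecke_class q n (?x * (?s * h))" if "h \<in> free_carrier n" for h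
      unfolding x_elt_eq[OF \<mu>c] y_elt_eq[OF \<mu>'] hecke_T_eq[OF specht_perm_props(1)[OF \<mu>]]
      by (simp add: hecke_class_mult mult_in_free_carrier tsum_stab_in_free_carrier t that mult.assoc)
    then show ?thesis unfolding specht_module_def carrier_hecke by (auto 4 3 simp: image_iff)
  qed
  have "(\<Oplus>\<^bsub>hecke q n\<^esub> i\<in>I. hecke_smult q n (c i) (phi_hat q n \<mu> (A i) (hecke_class q n (?x * (?s * h)))))
      = \<zero>\<^bsub>hecke q n\<^esub> \<longleftrightarrow> hcong q n (\<Sum>i\<in>I. const (c i) * (?D i * (?s * h))) 0"
    if h: "h \<in> free_carrier n" for h
  proof -
    have sh: "?s * h \<in> free_carrier n" using sc h by (rule mult_in_free_carrier)
    have Dc: "const (c i) * (?D i * (?s * h)) \<in> free_carrier n" for i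
      by (rule mult_in_free_carrier[OF const_in_free_carrier
            mult_in_free_carrier[OF tsum_dcs_in_free_carrier sh]])
    have "(\<Oplus>\<^bsub>hecke q n\<^esub> i\<in>I. hecke_smult q n (c i) (phi_hat q n \<mu> (A i) (hecke_class q n (?x * (?s * h)))))
        = hecke_class q n (\<Sum>i\<in>I. const (c i) * (?D i * (?s * h)))"
    proof (rule finsum_hecke_class[OF _ Dc])
      fix i assume i: "i \<in> I"
      have "hecke_class q n (?x * (?s * h)) \<in> specht_module q n \<mu>" using h S by blast
      then have "phi_hat q n \<mu> (A i) (hecke_class q n (?x * (?s * h))) = hecke_class q n (?D i * (?s * h))"
        unfolding phi_hat_def using phi_eq[OF \<mu>c A[OF i] sh] by simp
      then show "hecke_smult q n (c i) (phi_hat q n \<mu> (A i) (hecke_class q n (?x * (?s * h))))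
          = hecke_class q n (const (c i) * (?D i * (?s * h)))"
        using hecke_smult_class[OF mult_in_free_carrier[OF tsum_dcs_in_free_carrier sh]] by metis
    qed
    then show ?thesis
      unfolding hecke_class_zero using Dc by (simp add: hecke_class_eq_iff sum_in_free_carrier)
  qed
  then show ?thesis unfolding phi_hat_combination_zero_def S by blast
qed

lemma row_less_iff:
  assumes lam: "is_composition n lam" and p: "p \<in> {1..n}" "p' \<in> {1..n}"
  shows "p < p' \<longleftrightarrow> rowf lam p < rowf lam p' \<or> rowf lam p = rowf lam p' \<and> colf lam p < colf lam p'"
proof -
  have mono: "rowf lam a \<le> rowf lam b" if "a \<in> {1..n}" "b \<in> {1..n}" "a \<le> b" for a b
    using mono_onD[OF mono_on_rowf[OF lam] that] .
  have eq: "row_tableau lam (rowf lam p) (colf lam p) = p" "row_tableau lam (rowf lam p') (colf lam p') = p'"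
    using rowf_colf(2)[OF lam] p by auto
  consider "rowf lam p < rowf lam p'" | "rowf lam p' < rowf lam p" | "rowf lam p = rowf lam p'" by linarith
  then show ?thesis
  proof cases
    case 1
    then show ?thesis using mono[OF p(2,1)] by (cases "p < p'") auto
  next
    case 2
    then show ?thesis using mono[OF p] by (cases "p < p'") auto
  next
    case 3
    then have "p < p' \<longleftrightarrow> colf lam p < colf lam p'"
      using eq unfolding row_tableau_def by (metis add_less_cancel_left)
    then show ?thesis using 3 by simp
  qed
qed

text \<open>For a weakly increasing function the points with value at most \<open>a\<close> form an
  initial interval whose length is a sum of fibre sizes. Hence the fibre sizes determine the
  function.\<close>

lemma mono_fibres_eq:
  fixes f g :: "nat \<Rightarrow> nat"
  assumes f: "mono_on {1..m} f" and g: "mono_on {1..m} g"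
    and card: "\<And>a. card {x \<in> {1..m}. f x = a} = card {x \<in> {1..m}. g x = a}"
    and x: "x \<in> {1..m}"
  shows "f x = g x"
proof -
  have seg: "{x \<in> {1..m}. h x \<le> a} = {1..\<Sum>b\<in>{..a}. card {x \<in> {1..m}. h x = b}}"
    if h: "mono_on {1..m} h" for h :: "nat \<Rightarrow> nat" and a
  proof -
    have "{x \<in> {1..m}. h x \<le> a} = {1..card {x \<in> {1..m}. h x \<le> a}}"
    proof (rule downward_closed_eq_interval)
      show "i \<in> {x \<in> {1..m}. h x \<le> a}" if "j \<in> {x \<in> {1..m}. h x \<le> a}" "1 \<le> i" "i \<le> j" for i j
        using that mono_onD[OF h, of i j] by auto
    qed auto
    moreover have "card {x \<in> {1..m}. h x \<le> a} = (\<Sum>b\<in>{..a}. card {x \<in> {1..m}. h x = b})"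
    proof -
      have "{x \<in> {1..m}. h x \<le> a} = (\<Union>b\<in>{..a}. {x \<in> {1..m}. h x = b})" by auto
      then show ?thesis by (simp only:) (rule card_UN_disjoint; auto)
    qed
    ultimately show ?thesis by simp
  qed
  have "f x \<le> a \<longleftrightarrow> g x \<le> a" for a
    using seg[OF f, of a] seg[OF g, of a] x unfolding card by blast
  then show ?thesis by (metis order_antisym order_refl)
qed

section \<open>The partition without its last row and the splitting of 1, ..., n at m\<close>

locale last_row =
  fixes n l :: nat and \<mu> :: "nat \<Rightarrow> nat"
  assumes partition: "is_partition n \<mu>" and pos: "0 < \<mu> l" and last: "\<And>j. l < j \<Longrightarrow> \<mu> j = 0"
begin

abbreviation m where "m \<equiv> n - \<mu> l"
abbreviation \<nu> where "\<nu> \<equiv> \<mu>(l := 0)"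

lemma comp_\<mu>: "is_composition n \<mu>"
  using partition by (rule is_partition_is_composition)

lemma l_pos: "1 \<le> l"
  using pos is_compositionD(1)[OF comp_\<mu>] by (cases l) auto

lemma comp_\<nu>: "is_composition m \<nu>"
proof -
  note c = is_compositionD[OF comp_\<mu>]
  have S: "{i. \<nu> i \<noteq> 0} = {i. \<mu> i \<noteq> 0} - {l}" by auto
  have "(\<Sum>i | \<mu> i \<noteq> 0. \<mu> i) = \<mu> l + (\<Sum>i\<in>{i. \<mu> i \<noteq> 0} - {l}. \<mu> i)"
    using c(2) pos by (intro sum.remove) auto
  moreover have "(\<Sum>i\<in>{i. \<mu> i \<noteq> 0} - {l}. \<nu> i) = (\<Sum>i\<in>{i. \<mu> i \<noteq> 0} - {l}. \<mu> i)"
    by (rule sum.cong) auto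
  ultimately have "(\<Sum>i | \<nu> i \<noteq> 0. \<nu> i) = m" using c(3) unfolding S by simp
  then show ?thesis using c unfolding is_composition_def S by auto
qed

lemma part_\<nu>: "is_partition m \<nu>"
  using comp_\<nu> partition last by (auto simp: is_partition_def)

lemma diagram_\<nu>: "(a, b) \<in> diagram \<nu> \<longleftrightarrow> (a, b) \<in> diagram \<mu> \<and> a < l"
proof -
  have "a \<le> l" if "(a, b) \<in> diagram \<mu>" using that last[of a] by (cases "a \<le> l") (auto simp: diagram_def)
  then show ?thesis by (auto simp: diagram_def)
qed

lemma diagram_last: "(a, b) \<in> diagram \<mu> \<Longrightarrow> \<not> a < l \<Longrightarrow> a = l \<and> b \<in> {1..\<mu> l}"
  using last[of a] by (cases "a = l") (auto simp: diagram_def)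

lemma row_tableau_\<nu>:
  assumes "a \<le> l" shows "row_tableau \<nu> a b = row_tableau \<mu> a b"
proof -
  have "(\<Sum>i\<in>{1..<a}. \<nu> i) = (\<Sum>i\<in>{1..<a}. \<mu> i)"
    using assms by (intro sum.cong) auto
  then show ?thesis by (simp only: row_tableau_def)
qed

lemma sum_before: "(\<Sum>i\<in>{1..<l}. \<mu> i) = m"
proof -
  obtain a where a: "(\<Sum>i\<in>{1..a}. \<mu> i) = n" using partial_sum_eq[OF comp_\<mu>] ..
  \<comment> \<open>It is unknown on which side of \<open>l\<close> the index \<open>a\<close> lies;
    the parts after \<open>l\<close> vanish, so both sums are compared with the one up to the
    maximum.\<close>
  have "(\<Sum>i\<in>{1..l}. \<mu> i) = (\<Sum>i\<in>{1..max a l}. \<mu> i)"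
    using last by (intro sum.mono_neutral_left) auto
  also have "\<dots> \<ge> n" unfolding a[symmetric] by (intro sum_mono2) auto
  finally have "(\<Sum>i\<in>{1..l}. \<mu> i) = n" using partial_sum_le[OF comp_\<mu>, of l] by simp
  then show ?thesis
    using sum_atLeastLessThan_plus[OF l_pos, of \<mu>] by auto
qed

lemma row_tableau_last: "row_tableau \<mu> l b = m + b"
  by (simp add: row_tableau_def sum_before)

lemma last_in_diagram: "b \<in> {1..\<mu> l} \<Longrightarrow> (l, b) \<in> diagram \<mu>"
  using l_pos by (auto simp: diagram_def)

lemma rowf_initial:
  assumes "p \<in> {1..m}"
  shows "rowf \<mu> p = rowf \<nu> p" "rowf \<mu> p < l" "colf \<mu> p = colf \<nu> p"
proof -
  have d: "(rowf \<nu> p, colf \<nu> p) \<in> diagram \<mu>" "rowf \<nu> p < l"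
    using rowf_colf(1)[OF comp_\<nu> assms] by (auto simp: diagram_\<nu>)
  have "row_tableau \<mu> (rowf \<nu> p) (colf \<nu> p) = p"
    using rowf_colf(2)[OF comp_\<nu> assms] row_tableau_\<nu> d(2) by simp
  then show "rowf \<mu> p = rowf \<nu> p" "colf \<mu> p = colf \<nu> p"
    using rowf_row_tableau[OF d(1)] colf_row_tableau[OF d(1)] by auto
  then show "rowf \<mu> p < l" using d(2) by simp
qed

lemma rowf_final:
  assumes "p \<in> {1..n}" "m < p"
  shows "rowf \<mu> p = l"
proof -
  have "1 \<le> p - m" "p - m \<le> \<mu> l" using assms by auto
  then have "p = row_tableau \<mu> l (p - m)" "(l, p - m) \<in> diagram \<mu>"
    using assms row_tableau_last last_in_diagram[of "p - m"] by auto
  then show ?thesis using rowf_row_tableau by metis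
qed

lemma rowf_eq_last_iff: "p \<in> {1..n} \<Longrightarrow> rowf \<mu> p = l \<longleftrightarrow> m < p"
  using rowf_final[of p] rowf_initial(2)[of p] by (cases "m < p") auto

text \<open>Its stabiliser is the product of the symmetric groups on {1..m} and {m+1..n}, and the
  minimal coset representatives are the shuffles.\<close>

definition side :: "nat \<Rightarrow> nat" where
  "side p = (if p \<le> m then 0 else 1)"

lemma mono_side: "mono_on {1..n} side"
  by (auto simp: mono_on_def side_def)

lemma permutes_initial: "u permutes {1..m} \<Longrightarrow> u permutes {1..n}"
  by (erule permutes_subset) auto

lemma permutes_final: "v permutes {m+1..n} \<Longrightarrow> v permutes {1..n}"
  by (erule permutes_subset) auto

lemma initial_in_stab_side: "u permutes {1..m} \<Longrightarrow> u \<in> stab n side"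
  using permutes_in_image[of u "{1..m}"] permutes_not_in[of u "{1..m}"]
  by (auto simp: stab_def permutes_initial side_def) (metis le_trans nle_le)+

lemma final_in_stab_side:
  assumes "v permutes {m+1..n}" shows "v \<in> stab n side"
proof -
  have "v p \<le> m \<longleftrightarrow> p \<le> m" if "p \<in> {1..n}" for p
    using permutes_in_image[OF assms, of p] permutes_not_in[OF assms, of p] that by (cases "p \<le> m") auto
  then show ?thesis using assms by (simp add: stab_def permutes_final side_def)
qed

lemma final_fixes: "v permutes {m+1..n} \<Longrightarrow> x \<le> m \<Longrightarrow> v x = x"
  by (erule permutes_not_in) simp

lemma initial_fixes: "u permutes {1..m} \<Longrightarrow> m < x \<Longrightarrow> u x = x"
  by (erule permutes_not_in) simp

lemma initial_final_comm:
  assumes "u permutes {1..m}" "v permutes {m+1..n}"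
  shows "u \<circ> v = v \<circ> u"
proof
  fix x
  show "(u \<circ> v) x = (v \<circ> u) x"
  proof (cases "x \<in> {1..m}")
    case True
    then show ?thesis using permutes_in_image[OF assms(1), of x] final_fixes[OF assms(2)] by simp
  next
    case False
    have "v x \<notin> {1..m}"
      using False permutes_in_image[OF assms(2), of x] permutes_not_in[OF assms(2), of x]
      by (cases "x \<in> {m+1..n}") auto
    then show ?thesis using False permutes_not_in[OF assms(1)] by simp
  qed
qed

lemma ilen_initial_final:
  assumes u: "u permutes {1..m}" and v: "v permutes {m+1..n}"
  shows "ilen (v \<circ> u) = ilen u + ilen v"
proof (rule ilen_comp[OF permutes_initial[OF u] permutes_final[OF v]])
  fix i j assume ij: "i < j" "u j < u i"
  then have "(i, j) \<in> {1..m} \<times> {1..m}" using inversions_subset[OF u] by (auto simp: inversions_def)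
  then have "u i \<le> m" "u j \<le> m" using permutes_in_image[OF u, of i] permutes_in_image[OF u, of j] by auto
  then show "v (u j) < v (u i)" using ij final_fixes[OF v] by simp
qed

text \<open>The element X of the overview is \<open>tsum n 1 finals\<close>.\<close>

definition finals :: "(nat \<Rightarrow> nat) set" where
  "finals = {v. v permutes {m+1..n}}"

lemma tsum_finals_in_free_carrier: "tsum n c finals \<in> free_carrier n"
  by (intro tsum_in_free_carrier) (simp add: finals_def permutes_final)

text \<open>\<open>u\<close> and \<open>v\<close> move disjoint intervals, so they commute and their
  lengths add. Both T_u T_v and T_v T_u are therefore the element of the same permutation.\<close>

lemma tsum_finals_comm_tgen:
  assumes u: "u permutes {1..m}"
  shows "hcong q n (tsum n c finals * tgen n u) (tgen n u * tsum n c finals)"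
proof -
  have "hcong q n (tgen n v * tgen n u) (tgen n u * tgen n v)" if "v \<in> finals" for v
  proof -
    have v: "v permutes {m+1..n}" using that by (simp add: finals_def)
    note p = permutes_initial[OF u] permutes_final[OF v]
    have "hcong q n (tgen n v * tgen n u) (tgen n (u \<circ> v))"
      using ilen_initial_final[OF u v] initial_final_comm[OF u v] p
      by (intro hcong_sym[OF tgen_mult]) auto
    also have "hcong q n (tgen n (u \<circ> v)) (tgen n u * tgen n v)"
      unfolding initial_final_comm[OF u v] using ilen_initial_final[OF u v] p by (intro tgen_mult)
    finally show ?thesis .
  qed
  then have "hcong q n (\<Sum>v\<in>finals. const (c ^ ilen v) * (tgen n v * tgen n u))
      (\<Sum>v\<in>finals. const (c ^ ilen v) * (tgen n u * tgen n v))"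
    by (intro hcong_sum hcong_mult[OF hcong_refl]) auto
  moreover have "const (c ^ ilen v) * (tgen n u * tgen n v) = tgen n u * (const (c ^ ilen v) * tgen n v)" for v
    using const_commute[of "c ^ ilen v" "tgen n u"] by (simp add: mult.assoc[symmetric])
  ultimately show ?thesis
    unfolding tsum_def by (simp add: sum_distrib_left sum_distrib_right mult.assoc)
qed

lemma tsum_finals_comm:
  assumes "\<And>u. u \<in> V \<Longrightarrow> u permutes {1..m}"
  shows "hcong q n (tsum n c finals * tsum n c' V) (tsum n c' V * tsum n c finals)"
proof -
  have "hcong q n (\<Sum>u\<in>V. const (c' ^ ilen u) * (tsum n c finals * tgen n u))
      (\<Sum>u\<in>V. const (c' ^ ilen u) * (tgen n u * tsum n c finals))"
    using assms by (intro hcong_sum hcong_mult[OF hcong_refl] tsum_finals_comm_tgen) auto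
  moreover have "const (c' ^ ilen u) * (tsum n c finals * tgen n u)
      = tsum n c finals * (const (c' ^ ilen u) * tgen n u)" for u
    using const_commute[of "c' ^ ilen u" "tsum n c finals"] by (simp add: mult.assoc[symmetric])
  ultimately show ?thesis
    unfolding tsum_def[of n c'] by (simp add: sum_distrib_left sum_distrib_right mult.assoc)
qed

section \<open>Factorisation of the Specht generator\<close>

lemma comp_conj_\<mu>: "is_composition n (conjugate \<mu>)" and comp_conj_\<nu>: "is_composition m (conjugate \<nu>)"
  using is_composition_conjugate partition part_\<nu> by auto

text \<open>The element $d$ with $w_\mu = w_{\tilde\mu} d$.\<close>

definition insertion :: "nat \<Rightarrow> nat" where
  "insertion = specht_perm n \<mu> \<circ> pinv (specht_perm m \<nu>)"

lemma specht_perm_\<nu>_permutes: "specht_perm m \<nu> permutes {1..m}"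
  by (rule specht_perm_props[OF part_\<nu>])

lemma insertion_permutes: "insertion permutes {1..n}"
  unfolding insertion_def
  by (intro permutes_compose permutes_inv specht_perm_props(1)[OF partition]
      permutes_initial[OF specht_perm_\<nu>_permutes])

lemma specht_perm_eq: "specht_perm n \<mu> = insertion \<circ> specht_perm m \<nu>"
  unfolding insertion_def using permutes_inv_o(2)[OF specht_perm_\<nu>_permutes] by (simp add: comp_assoc)

text \<open>Such an \<open>x\<close> is the entry of a box in the column filling of the smaller
  shape, and d sends it to the entry of the same box for \<mu>. In the conjugate shape,
  \<open>rowf\<close> is the column of that box and \<open>colf\<close> its row.\<close>

lemma insertion_initial:
  assumes "x \<in> {1..m}"
  shows "rowf (conjugate \<mu>) (insertion x) = rowf (conjugate \<nu>) x"
    "colf (conjugate \<mu>) (insertion x) = colf (conjugate \<nu>) x"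
    "colf (conjugate \<mu>) (insertion x) < l"
proof -
  define a b where "a = colf (conjugate \<nu>) x" and "b = rowf (conjugate \<nu>) x"
  have x: "x = row_tableau (conjugate \<nu>) b a" and "(b, a) \<in> diagram (conjugate \<nu>)"
    using rowf_colf[OF comp_conj_\<nu> assms] by (auto simp: a_def b_def)
  then have ab: "(a, b) \<in> diagram \<nu>" using diagram_conjugate[OF part_\<nu>] by simp
  then have al: "a < l" and ab': "(a, b) \<in> diagram \<mu>" by (auto simp: diagram_\<nu>)
  have "specht_perm m \<nu> (row_tableau \<mu> a b) = x"
    using specht_perm_props(2)[OF part_\<nu> ab] row_tableau_\<nu> al x by simp
  then have "pinv (specht_perm m \<nu>) x = row_tableau \<mu> a b"
    using permutes_inverses(2)[OF specht_perm_\<nu>_permutes] by metis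
  then have i: "insertion x = row_tableau (conjugate \<mu>) b a"
    using specht_perm_props(2)[OF partition ab'] by (simp add: insertion_def)
  have "(b, a) \<in> diagram (conjugate \<mu>)" using diagram_conjugate[OF partition] ab' by simp
  then have "rowf (conjugate \<mu>) (insertion x) = b" "colf (conjugate \<mu>) (insertion x) = a"
    unfolding i by (auto simp: rowf_row_tableau colf_row_tableau)
  then show "rowf (conjugate \<mu>) (insertion x) = rowf (conjugate \<nu>) x"
    "colf (conjugate \<mu>) (insertion x) = colf (conjugate \<nu>) x"
    "colf (conjugate \<mu>) (insertion x) < l"
    using al by (auto simp: a_def b_def)
qed

text \<open>The smaller w fixes \<open>x\<close>, which occupies column \<open>x - m\<close> of row
  \<open>l\<close> in the filling along rows; d therefore sends it to the bottom of that
  column.\<close>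

lemma insertion_final:
  assumes "x \<in> {1..n}" "m < x"
  shows "rowf (conjugate \<mu>) (insertion x) = x - m" "colf (conjugate \<mu>) (insertion x) = l"
proof -
  define b where "b = x - m"
  have "1 \<le> b" "b \<le> \<mu> l" using assms by (auto simp: b_def)
  then have b: "(l, b) \<in> diagram \<mu>" by (intro last_in_diagram) simp
  have x: "x = row_tableau \<mu> l b" using assms row_tableau_last by (simp add: b_def)
  have "pinv (specht_perm m \<nu>) x = x"
    using permutes_not_in[OF permutes_inv[OF specht_perm_\<nu>_permutes]] assms by simp
  then have i: "insertion x = row_tableau (conjugate \<mu>) b l"
    using specht_perm_props(2)[OF partition b] x by (simp add: insertion_def)
  have "(b, l) \<in> diagram (conjugate \<mu>)" using diagram_conjugate[OF partition] b by simp
  then show "rowf (conjugate \<mu>) (insertion x) = x - m" "colf (conjugate \<mu>) (insertion x) = l"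
    unfolding i b_def[symmetric] by (auto simp: rowf_row_tableau colf_row_tableau)
qed

lemma insertion_mem: "insertion x \<in> {1..n} \<longleftrightarrow> x \<in> {1..n}"
  using permutes_in_image[OF insertion_permutes] .

text \<open>On the boxes above row \<open>l\<close> the column reading orders of both shapes agree,
  and along row \<open>l\<close> the entries grow with the column. Thus d is a shuffle and lengths
  add in w_\<mu> = w_\<nu> d.\<close>

lemma insertion_incr: "insertion \<in> incr n side"
proof -
  have "insertion i < insertion j" if ij: "i \<in> {1..n}" "j \<in> {1..n}" "i < j" "side i = side j" for i j
  proof -
    have mem: "insertion i \<in> {1..n}" "insertion j \<in> {1..n}" using ij insertion_mem by auto
    show ?thesis
    proof (cases "j \<le> m")
      case True
      then have "i \<in> {1..m}" "j \<in> {1..m}" using ij by auto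
      then show ?thesis
        using row_less_iff[OF comp_conj_\<mu> mem] row_less_iff[OF comp_conj_\<nu>, of i j] ij(3)
        by (simp add: insertion_initial)
    next
      case False
      then have "m < i" "m < j" using ij(4) by (auto simp: side_def split: if_splits)
      then show ?thesis
        using row_less_iff[OF comp_conj_\<mu> mem] ij by (simp add: insertion_final)
    qed
  qed
  then show ?thesis using insertion_permutes by (simp add: incr_def)
qed

text \<open>Separates, within each column of the tableau of \<open>\<mu>\<close> filled down the columns, the entry in
  row \<open>l\<close> from the entries above it.\<close>

definition split_col :: "nat \<Rightarrow> nat" where
  "split_col p = 2 * rowf (conjugate \<mu>) p + (if colf (conjugate \<mu>) p = l then 1 else 0)"

lemma colf_conj_le: "p \<in> {1..n} \<Longrightarrow> colf (conjugate \<mu>) p \<le> l"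
  using rowf_colf(1)[OF comp_conj_\<mu>, of p] diagram_conjugate[OF partition]
    diagram_last[of "colf (conjugate \<mu>) p"] by (cases "colf (conjugate \<mu>) p < l") auto

text \<open>The box in row \<open>l\<close>, if there is one, is the lowest of its column, so its
  entry comes after all others of that column.\<close>

lemma mono_split_col: "mono_on {1..n} split_col"
proof (rule mono_onI)
  fix p p' assume p: "p \<in> {1..n}" "p' \<in> {1..n}" "p \<le> p'"
  show "split_col p \<le> split_col p'"
  proof (cases "p = p'")
    case False
    then have "p < p'" using p(3) by simp
    then show ?thesis
      using row_less_iff[OF comp_conj_\<mu> p(1,2)] colf_conj_le[OF p(1)] colf_conj_le[OF p(2)]
      by (auto simp: split_col_def)
  qed simp
qed

lemma split_col_eq:
  "split_col p = split_col p' \<longleftrightarrow> rowf (conjugate \<mu>) p = rowf (conjugate \<mu>) p' \<and>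
     (colf (conjugate \<mu>) p = l \<longleftrightarrow> colf (conjugate \<mu>) p' = l)"
  unfolding split_col_def by (auto split: if_splits) presburger+

text \<open>Each box of row \<open>l\<close> is a block by itself, so two different points in one
  block come from boxes above that row.\<close>

lemma split_col_insertion:
  assumes "x \<in> {1..n}" "y \<in> {1..n}" "split_col (insertion x) = split_col (insertion y)"
  shows "x = y \<or> x \<le> m \<and> y \<le> m"
proof (cases "m < x \<and> m < y")
  case True
  then have "x - m = y - m" using assms by (simp add: split_col_eq insertion_final)
  then show ?thesis using True by arith
next
  case False
  then show ?thesis
    using assms insertion_initial(3)[of x] insertion_initial(3)[of y] insertion_final(2)[of x]
      insertion_final(2)[of y]
    by (cases "x \<le> m"; cases "y \<le> m") (auto simp: split_col_eq)
qed

text \<open>Two different points in one block are images of points in {1..m}, where d is increasing.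
  So d is minimal for the refined column blocks as well, on the other side than in
  \<open>insertion_incr\<close>.\<close>

lemma insertion_cinc: "insertion \<in> cinc n split_col"
proof -
  note P = insertion_permutes
  have "pinv insertion i < pinv insertion j"
    if ij: "i \<in> {1..n}" "j \<in> {1..n}" "i < j" "split_col i = split_col j" for i j
  proof -
    define x y where "x = pinv insertion i" and "y = pinv insertion j"
    have xy: "x \<in> {1..n}" "y \<in> {1..n}" "insertion x = i" "insertion y = j"
      unfolding x_def y_def using ij permutes_in_image[OF permutes_inv[OF P]] permutes_inverses[OF P] by auto
    then have "x = y \<or> x \<le> m \<and> y \<le> m" using split_col_insertion ij(4) by simp
    then have "x \<le> m" "y \<le> m" using xy ij(3) by auto
    then have "side y = side x" by (simp add: side_def)
    then have "insertion y < insertion x" if "y < x"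
      using that insertion_incr xy(1,2) unfolding incr_def by blast
    then have "\<not> y < x" using xy ij(3) by auto
    then have "x < y" using xy ij(3) by (cases "x = y") auto
    then show ?thesis by (simp add: x_def y_def)
  qed
  then show ?thesis using P permutes_inv[OF P] by (simp add: cinc_def incr_def)
qed

abbreviation col_stab where "col_stab \<equiv> stab m (rowf (conjugate \<nu>))"

text \<open>d carries each column of the smaller shape onto the part of the same column of \<mu>
  above row \<open>l\<close>. The remaining blocks of \<open>split_col\<close> are singletons and
  contribute nothing to its stabiliser.\<close>

lemma conj_insertion_bij:
  "bij_betw (\<lambda>v. insertion \<circ> v \<circ> pinv insertion) col_stab (stab n split_col)"
proof -
  note P = insertion_permutes
  have I: "pinv insertion (insertion x) = x" "insertion (pinv insertion x) = x" for x
    using permutes_inverses[OF P] by auto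
  have Im: "pinv insertion x \<in> {1..n} \<longleftrightarrow> x \<in> {1..n}" for x
    using permutes_in_image[OF permutes_inv[OF P]] .
  show ?thesis
  proof (rule bij_betw_byWitness[where f' = "\<lambda>w. pinv insertion \<circ> w \<circ> insertion"])
    show "(\<lambda>v. insertion \<circ> v \<circ> pinv insertion) ` col_stab \<subseteq> stab n split_col"
    proof clarify
      fix v assume v: "v \<in> col_stab"
      then have vp: "v permutes {1..m}" by (rule stab_permutes)
      have "split_col (insertion (v x)) = split_col (insertion x)" if "x \<in> {1..n}" for x
      proof (cases "x \<le> m")
        case True
        then have "x \<in> {1..m}" "v x \<in> {1..m}" using that permutes_in_image[OF vp] by auto
        then show ?thesis
          using v insertion_initial[of x] insertion_initial[of "v x"] by (auto simp: split_col_eq stab_def)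
      next
        case False
        then show ?thesis using initial_fixes[OF vp] by simp
      qed
      then have "split_col ((insertion \<circ> v \<circ> pinv insertion) y) = split_col y" if "y \<in> {1..n}" for y
        using that Im[of y] I(2)[of y] by (metis comp_apply)
      then show "insertion \<circ> v \<circ> pinv insertion \<in> stab n split_col"
        using permutes_initial[OF vp] P permutes_inv[OF P] by (simp add: stab_def permutes_compose)
    qed
    show "(\<lambda>w. pinv insertion \<circ> w \<circ> insertion) ` stab n split_col \<subseteq> col_stab"
    proof clarify
      fix w assume w: "w \<in> stab n split_col"
      then have wp: "w permutes {1..n}" by (rule stab_permutes)
      define v where "v = pinv insertion \<circ> w \<circ> insertion"
      have vn: "v permutes {1..n}" unfolding v_def by (intro permutes_compose permutes_inv P wp)
      have iv: "insertion (v x) = w (insertion x)" for x by (simp add: v_def I)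
      have vx: "v x = x \<or> v x \<le> m \<and> x \<le> m" "split_col (insertion (v x)) = split_col (insertion x)"
        if "x \<in> {1..n}" for x
      proof -
        show "split_col (insertion (v x)) = split_col (insertion x)"
          unfolding iv using w insertion_mem that by (simp add: stab_def)
        moreover have "v x \<in> {1..n}" using that permutes_in_image[OF vn] by simp
        ultimately show "v x = x \<or> v x \<le> m \<and> x \<le> m" using that split_col_insertion by simp
      qed
      \<comment> \<open>A point that \<open>v\<close> moves shares its refined block with another
        point, so it lies in {1..m}.\<close>
      have vp: "v permutes {1..m}"
        by (rule permutes_superset[OF vn]) (use vx(1) in auto)
      have "rowf (conjugate \<nu>) (v x) = rowf (conjugate \<nu>) x" if "x \<in> {1..m}" for x
      proof -
        have "v x \<in> {1..m}" using that permutes_in_image[OF vp] by simp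
        moreover have "x \<in> {1..n}" using that by auto
        ultimately show ?thesis using vx(2)[of x] that by (simp add: split_col_eq insertion_initial)
      qed
      then have "v \<in> col_stab" using vp by (simp add: stab_def)
      then show "pinv insertion \<circ> w \<circ> insertion \<in> col_stab" by (simp add: v_def)
    qed
  qed (auto simp: fun_eq_iff I)
qed

text \<open>The permutation \<open>w \<circ> insertion = insertion \<circ> v\<close> is factored in
  two ways, and lengths add in both because d is minimal on both sides. Equality of the lengths of
  \<open>v\<close> and \<open>w\<close> is what keeps the weights of y intact under
  conjugation.\<close>

lemma ilen_conj_insertion:
  assumes v: "v \<in> col_stab"
  defines "w \<equiv> insertion \<circ> v \<circ> pinv insertion"
  shows "ilen w = ilen v" "hcong q n (tgen n insertion * tgen n w) (tgen n v * tgen n insertion)"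
proof -
  have w: "w \<in> stab n split_col" using bij_betw_apply[OF conj_insertion_bij v] by (simp add: w_def)
  have wv: "w \<circ> insertion = insertion \<circ> v"
    using permutes_inverses[OF insertion_permutes] by (auto simp: w_def fun_eq_iff)
  have vp: "v permutes {1..m}" using v by (rule stab_permutes)
  have 1: "ilen (w \<circ> insertion) = ilen insertion + ilen w"
    by (rule ilen_cinc[OF insertion_cinc w mono_split_col])
  have 2: "ilen (insertion \<circ> v) = ilen v + ilen insertion"
    by (rule ilen_incr_comp_stab[OF insertion_incr initial_in_stab_side[OF vp] mono_side])
  show "ilen w = ilen v" using 1 2 wv by simp
  have "hcong q n (tgen n insertion * tgen n w) (tgen n (w \<circ> insertion))"
    by (rule hcong_sym[OF tgen_mult[OF insertion_permutes stab_permutes[OF w] 1]])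
  also have "hcong q n (tgen n (w \<circ> insertion)) (tgen n v * tgen n insertion)"
    unfolding wv by (rule tgen_mult[OF permutes_initial[OF vp] insertion_permutes 2])
  finally show "hcong q n (tgen n insertion * tgen n w) (tgen n v * tgen n insertion)" .
qed

lemma tgen_insertion_tsum:
  "hcong q n (tgen n insertion * tsum n c (stab n split_col)) (tsum n c col_stab * tgen n insertion)"
proof -
  let ?h = "\<lambda>v. insertion \<circ> v \<circ> pinv insertion"
  have "tgen n insertion * tsum n c (stab n split_col)
      = (\<Sum>v\<in>col_stab. tgen n insertion * (const (c ^ ilen (?h v)) * tgen n (?h v)))"
    unfolding tsum_def sum_distrib_left by (rule sum.reindex_bij_betw[OF conj_insertion_bij, symmetric])
  also have "\<dots> = (\<Sum>v\<in>col_stab. const (c ^ ilen v) * (tgen n insertion * tgen n (?h v)))"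
  proof (rule sum.cong)
    fix v assume "v \<in> col_stab"
    then show "tgen n insertion * (const (c ^ ilen (?h v)) * tgen n (?h v))
        = const (c ^ ilen v) * (tgen n insertion * tgen n (?h v))"
      using ilen_conj_insertion(1) const_commute[of "c ^ ilen v" "tgen n insertion"]
      by (simp add: mult.assoc[symmetric])
  qed simp
  also have "hcong q n \<dots> (\<Sum>v\<in>col_stab. const (c ^ ilen v) * (tgen n v * tgen n insertion))"
    by (intro hcong_sum hcong_mult[OF hcong_refl] ilen_conj_insertion(2)) auto
  also have "(\<Sum>v\<in>col_stab. const (c ^ ilen v) * (tgen n v * tgen n insertion)) = tsum n c col_stab * tgen n insertion"
    by (simp add: tsum_def sum_distrib_right mult.assoc)
  finally show ?thesis .
qed

text \<open>The witness is T_d Z, with Z the weighted sum over the minimal representatives of the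
  cosets of \<open>stab n split_col\<close> inside the Young subgroup of the conjugate of
  \<mu>.\<close>

lemma specht_generator_factor:
  "\<exists>z\<in>free_carrier n. hcong q n (tgen n (specht_perm n \<mu>) * tsum n c (stab n (rowf (conjugate \<mu>))))
     (tgen n (specht_perm m \<nu>) * tsum n c col_stab * z)"
proof -
  let ?t = "tgen n (specht_perm m \<nu>) :: 'a free_alg" and ?d = "tgen n insertion :: 'a free_alg"
  let ?S = "stab n (rowf (conjugate \<mu>))"
  let ?Z = "tsum n c (incr n split_col \<inter> ?S)" and ?Y = "tsum n c (stab n split_col)"
  have Z: "?Z \<in> free_carrier n" by (rule tsum_in_free_carrier) (auto intro: stab_permutes)
  have d: "?d \<in> free_carrier n" by (rule tgen_in_free_carrier[OF insertion_permutes])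
  have t: "?t \<in> free_carrier n"
    by (rule tgen_in_free_carrier[OF permutes_initial[OF specht_perm_\<nu>_permutes]])
  \<comment> \<open>The refined blocks lie inside the columns, so their stabiliser is a
    subgroup.\<close>
  have sub: "v \<in> ?S" if "v \<in> stab n split_col" for v
    using that by (auto simp: stab_def split_col_eq)
  have 1: "hcong q n (tgen n (specht_perm n \<mu>)) (?t * ?d)"
    unfolding specht_perm_eq
    by (intro tgen_mult permutes_initial specht_perm_\<nu>_permutes insertion_permutes
        ilen_incr_comp_stab[OF insertion_incr _ mono_side] initial_in_stab_side)
  have 2: "hcong q n (tsum n c ?S) (?Y * ?Z)"
    by (rule tsum_incr[OF mono_split_col]) (auto intro: stab_permutes stab_comp sub)
  have "hcong q n (tgen n (specht_perm n \<mu>) * tsum n c ?S) (?t * ?d * (?Y * ?Z))"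
    by (rule hcong_mult[OF 1 2])
  also have "?t * ?d * (?Y * ?Z) = ?t * (?d * ?Y) * ?Z" by (simp add: mult.assoc)
  also have "hcong q n \<dots> (?t * (tsum n c col_stab * ?d) * ?Z)"
    by (intro hcong_mult[OF hcong_mult[OF hcong_refl[OF t] tgen_insertion_tsum] hcong_refl[OF Z]])
  also have "?t * (tsum n c col_stab * ?d) * ?Z = ?t * tsum n c col_stab * (?d * ?Z)"
    by (simp add: mult.assoc)
  finally show ?thesis using mult_in_free_carrier[OF d Z] by blast
qed

section \<open>Factorisation of the double coset sum\<close>

definition last_count :: "tableau \<Rightarrow> nat \<Rightarrow> nat" where
  "last_count A a = card {c \<in> {1..\<mu> l}. A l c = a}"

text \<open>The sum over this set is E. A shuffle is determined by the set of positions sent beyond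
  \<open>m\<close>; only the number \<open>r a\<close> of them in each row \<open>a\<close> is
  prescribed. The tableau enters through its type and its last row alone.\<close>

definition row_shuffles :: "(nat \<Rightarrow> nat) \<Rightarrow> (nat \<Rightarrow> nat) \<Rightarrow> (nat \<Rightarrow> nat) set" where
  "row_shuffles lam r = {e \<in> cinc n side. \<forall>a. card {x \<in> {1..n}. rowf lam x = a \<and> m < e x} = r a}"

lemma content_delete_row:
  "content \<mu> A a = content \<nu> (delete_row l A) a + last_count A a"
proof -
  let ?X = "{(i, j). (i, j) \<in> diagram \<nu> \<and> delete_row l A i j = a}"
  let ?Y = "Pair l ` {c \<in> {1..\<mu> l}. A l c = a}"
  have "{(i, j). (i, j) \<in> diagram \<mu> \<and> A i j = a} = ?X \<union> ?Y"
    using last_in_diagram diagram_last by (auto simp: diagram_\<nu> delete_row_def)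
  moreover have "?X \<inter> ?Y = {}" by (auto simp: diagram_\<nu>)
  moreover have "finite ?X" by (rule finite_subset[OF _ finite_diagram[OF comp_\<nu>]]) auto
  moreover have "card ?Y = last_count A a"
    unfolding last_count_def by (rule card_image) (simp add: inj_on_def)
  ultimately show ?thesis unfolding content_def by (simp add: card_Un_disjoint)
qed

text \<open>On {1..m} the inverse of the shuffle is increasing, so the left side is weakly
  increasing in \<open>x\<close>. Its fibre sizes are those of the type of \<open>A\<close> minus
  the entries used in row \<open>l\<close>, which is the type of the shortened tableau, and
  \<open>mono_fibres_eq\<close> applies.\<close>

lemma rowf_shuffle:
  assumes A: "content \<mu> A 0 = 0" and e: "e \<in> row_shuffles (content \<mu> A) (last_count A)" and x: "x \<in> {1..m}"
  shows "rowf (content \<mu> A) (pinv e x) = rowf (content \<nu> (delete_row l A)) x"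
proof -
  let ?lam = "content \<mu> A" and ?lam' = "content \<nu> (delete_row l A)"
  have lam: "is_composition n ?lam" by (rule is_composition_content[OF comp_\<mu> A])
  have lam': "is_composition m ?lam'"
    using A content_delete_row[of A 0] by (intro is_composition_content[OF comp_\<nu>]) simp
  have ep: "e permutes {1..n}" and ei: "pinv e \<in> incr n side"
    using e by (auto simp: row_shuffles_def cinc_def)
  have eim: "pinv e y \<in> {1..n}" if "y \<in> {1..m}" for y
    using that permutes_in_image[OF permutes_inv[OF ep], of y] by auto
  show ?thesis
  proof (rule mono_fibres_eq[where f = "\<lambda>x. rowf ?lam (pinv e x)", OF _ mono_on_rowf[OF lam'] _ x])
    show "mono_on {1..m} (\<lambda>x. rowf ?lam (pinv e x))"
    proof (rule mono_onI)
      fix y z assume yz: "y \<in> {1..m}" "z \<in> {1..m}" "y \<le> z"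
      have "pinv e y \<le> pinv e z"
      proof (cases "y = z")
        case False
        have "side y = side z" using yz by (simp add: side_def)
        moreover have "y \<in> {1..n}" "z \<in> {1..n}" using yz by auto
        ultimately have "pinv e y < pinv e z" using ei yz False unfolding incr_def by auto
        then show ?thesis by simp
      qed simp
      then show "rowf ?lam (pinv e y) \<le> rowf ?lam (pinv e z)"
        using eim yz by (intro mono_onD[OF mono_on_rowf[OF lam]])
    qed
    fix a
    let ?P = "\<lambda>x. rowf ?lam (pinv e x) = a \<and> x \<le> m"
    have "card {x \<in> {1..m}. rowf ?lam (pinv e x) = a} = card {x \<in> {1..n}. ?P x}"
      by (rule arg_cong[of _ _ card]) auto
    also have "\<dots> = card {y \<in> {1..n}. ?P (e y)}" by (rule card_permutes_Collect[OF ep, symmetric])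
    \<comment> \<open>A position of row \<open>a\<close> either is sent beyond \<open>m\<close>, and
      is counted by \<open>last_count A a\<close>, or ends in {1..m}.\<close>
    also have "\<dots> = card ({y \<in> {1..n}. rowf ?lam y = a} - {y \<in> {1..n}. rowf ?lam y = a \<and> m < e y})"
      using permutes_inverses[OF ep] by (intro arg_cong[of _ _ card]) auto
    also have "\<dots> = ?lam a - last_count A a"
      using e card_rowf[OF lam, of a] by (subst card_Diff_subset) (auto simp: row_shuffles_def)
    also have "\<dots> = ?lam' a" using content_delete_row[of A a] by simp
    also have "\<dots> = card {x \<in> {1..m}. rowf ?lam' x = a}" by (rule card_rowf[OF lam', symmetric])
    finally show "card {x \<in> {1..m}. rowf ?lam (pinv e x) = a} = card {x \<in> {1..m}. rowf ?lam' x = a}" .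
  qed
qed

text \<open>The count matrices are compared column by column. Column \<open>l\<close> is correct by
  the choice of \<open>e\<close>. In the other columns \<open>v\<close> has no influence, and
  \<open>rowf_shuffle\<close> translates the counts for \<open>u \<circ> e\<close> into those for
  \<open>u\<close> over m.\<close>

lemma dcs_shuffle_iff:
  assumes A: "content \<mu> A 0 = 0" and e: "e \<in> row_shuffles (content \<mu> A) (last_count A)"
    and u: "u permutes {1..m}" and v: "v \<in> finals"
  shows "v \<circ> u \<circ> e \<in> dcs n (content \<mu> A) \<mu> A \<longleftrightarrow>
    u \<in> dcs m (content \<nu> (delete_row l A)) \<nu> (delete_row l A)"
proof -
  let ?lam = "content \<mu> A" and ?lam' = "content \<nu> (delete_row l A)"
  have vp: "v permutes {m+1..n}" using v by (simp add: finals_def)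
  have ep: "e permutes {1..n}" using e by (auto simp: row_shuffles_def cinc_def)
  have gp: "v \<circ> u permutes {1..n}" "v \<circ> u \<circ> e permutes {1..n}"
    by (intro permutes_compose permutes_initial[OF u] permutes_final[OF vp] ep)+
  have g_in: "(v \<circ> u) y = u y" "u y \<in> {1..m}" if "y \<in> {1..m}" for y
    using that permutes_in_image[OF u, of y] final_fixes[OF vp] by auto
  have g_out: "m < (v \<circ> u) y" "(v \<circ> u) y \<in> {1..n}" if "y \<in> {1..n}" "m < y" for y
    using that initial_fixes[OF u] permutes_in_image[OF vp, of y] by auto
  have count_last: "card {x \<in> {1..n}. rowf ?lam x = a \<and> rowf \<mu> ((v \<circ> u \<circ> e) x) = l} = last_count A a" for a
  proof -
    have "rowf \<mu> ((v \<circ> u \<circ> e) x) = l \<longleftrightarrow> m < e x" if "x \<in> {1..n}" for x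
    proof -
      have mem: "e x \<in> {1..n}" "(v \<circ> u \<circ> e) x \<in> {1..n}"
        using that permutes_in_image[OF ep] permutes_in_image[OF gp(2)] by blast+
      then have "rowf \<mu> ((v \<circ> u \<circ> e) x) = l \<longleftrightarrow> m < (v \<circ> u) (e x)"
        using rowf_eq_last_iff by simp
      also have "\<dots> \<longleftrightarrow> m < e x"
        using g_in[of "e x"] g_out[of "e x"] mem(1) by (cases "m < e x") auto
      finally show ?thesis .
    qed
    then have "{x \<in> {1..n}. rowf ?lam x = a \<and> rowf \<mu> ((v \<circ> u \<circ> e) x) = l}
        = {x \<in> {1..n}. rowf ?lam x = a \<and> m < e x}" by blast
    then show ?thesis using e by (simp only: row_shuffles_def mem_Collect_eq)
  qed
  have count: "card {x \<in> {1..n}. rowf ?lam x = a \<and> rowf \<mu> ((v \<circ> u \<circ> e) x) = b}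
      = card {y \<in> {1..m}. rowf ?lam' y = a \<and> rowf \<nu> (u y) = b}" if b: "b \<noteq> l" for a b
  proof -
    let ?P = "\<lambda>y. rowf ?lam (pinv e y) = a \<and> rowf \<mu> ((v \<circ> u) y) = b"
    have "card {x \<in> {1..n}. rowf ?lam x = a \<and> rowf \<mu> ((v \<circ> u \<circ> e) x) = b} = card {x \<in> {1..n}. ?P (e x)}"
      using permutes_inverses(2)[OF ep] by simp
    also have "\<dots> = card {y \<in> {1..n}. ?P y}" by (rule card_permutes_Collect[OF ep])
    also have "{y \<in> {1..n}. ?P y} = {y \<in> {1..m}. rowf ?lam' y = a \<and> rowf \<nu> (u y) = b}"
    proof (intro equalityI subsetI)
      fix y assume y: "y \<in> {y \<in> {1..n}. ?P y}"
      then have "\<not> m < y" using b rowf_final[OF g_out(2,1), of y] by auto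
      then have "y \<in> {1..m}" using y by auto
      then show "y \<in> {y \<in> {1..m}. rowf ?lam' y = a \<and> rowf \<nu> (u y) = b}"
        using y rowf_shuffle[OF A e] g_in[of y] rowf_initial(1)[of "u y"] by auto
    next
      fix y assume y: "y \<in> {y \<in> {1..m}. rowf ?lam' y = a \<and> rowf \<nu> (u y) = b}"
      then have "y \<in> {1..m}" by blast
      then show "y \<in> {y \<in> {1..n}. ?P y}"
        using y rowf_shuffle[OF A e] g_in[of y] rowf_initial(1)[of "u y"] by auto
    qed
    finally show ?thesis .
  qed
  have rows: "card {c \<in> {1..\<nu> b}. delete_row l A b c = a} = card {c \<in> {1..\<mu> b}. A b c = a}"
    if "b \<noteq> l" for a b
    using that by (simp add: delete_row_def)
  \<comment> \<open>In the smaller shape row \<open>l\<close> is empty, so its column of the matrix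
    holds only zeros on both sides.\<close>
  have "card {y \<in> {1..m}. rowf ?lam' y = a \<and> rowf \<nu> (u y) = l} = card {c \<in> {1..\<nu> l}. delete_row l A l c = a}"
    for a
  proof -
    have "rowf \<nu> (u y) \<noteq> l" if "y \<in> {1..m}" for y
      using g_in(2)[OF that] rowf_initial[of "u y"] by auto
    then have "{y \<in> {1..m}. rowf ?lam' y = a \<and> rowf \<nu> (u y) = l} = {}" by blast
    then show ?thesis by simp
  qed
  note last' = this
  define F where "F a b = card {x \<in> {1..n}. rowf ?lam x = a \<and> rowf \<mu> ((v \<circ> u \<circ> e) x) = b}" for a b
  define F' where "F' a b = card {y \<in> {1..m}. rowf ?lam' y = a \<and> rowf \<nu> (u y) = b}" for a b
  define G where "G a b = card {c \<in> {1..\<mu> b}. A b c = a}" for a b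
  define G' where "G' a b = card {c \<in> {1..\<nu> b}. delete_row l A b c = a}" for a b
  have "F a b = G a b \<longleftrightarrow> F' a b = G' a b" for a b
  proof (cases "b = l")
    case True
    then show ?thesis
      using count_last last' unfolding F_def F'_def G_def G'_def last_count_def by simp
  next
    case False
    then show ?thesis using count rows unfolding F_def F'_def G_def G'_def by simp
  qed
  then have "(\<forall>a b. F a b = G a b) \<longleftrightarrow> (\<forall>a b. F' a b = G' a b)" by blast
  then show ?thesis
    unfolding dcs_def mem_Collect_eq F_def F'_def G_def G'_def using u gp(2) by blast
qed

lemma stab_side_decomp:
  assumes g: "g \<in> stab n side"
  shows "\<exists>u v. u permutes {1..m} \<and> v \<in> finals \<and> g = v \<circ> u"
proof -
  have gp: "g permutes {1..n}" using g by (rule stab_permutes)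
  have gm: "g x \<in> {1..m}" if "x \<in> {1..m}" for x
  proof -
    have x: "x \<in> {1..n}" using that by auto
    then have "side (g x) = side x" using g by (simp add: stab_def)
    moreover have "g x \<in> {1..n}" using x permutes_in_image[OF gp] by blast
    ultimately show ?thesis using that by (auto simp: side_def split: if_splits)
  qed
  define u where "u = (\<lambda>x. if x \<in> {1..m} then g x else x)"
  have "inj_on u {1..m} \<longleftrightarrow> inj_on g {1..m}" by (rule inj_on_cong) (simp add: u_def)
  then have "inj_on u {1..m}" using inj_on_subset[OF permutes_inj[OF gp] subset_UNIV] by simp
  moreover have "u ` {1..m} \<subseteq> {1..m}" using gm by (auto simp: u_def)
  ultimately have "bij_betw u {1..m} {1..m}" by (simp add: bij_betw_def endo_inj_surj)
  then have u: "u permutes {1..m}" by (rule bij_imp_permutes) (auto simp: u_def)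
  define v where "v = g \<circ> pinv u"
  have vn: "v permutes {1..n}"
    unfolding v_def by (intro permutes_compose permutes_inv permutes_initial[OF u] gp)
  have "v x = x" if "x \<in> {1..n} - {m+1..n}" for x
  proof -
    have "x \<in> {1..m}" using that by auto
    then have "pinv u x \<in> {1..m}" using permutes_in_image[OF permutes_inv[OF u]] by blast
    then have "g (pinv u x) = u (pinv u x)" by (simp add: u_def)
    then show ?thesis using permutes_inverses(1)[OF u] by (simp add: v_def)
  qed
  then have "v \<in> finals" unfolding finals_def using permutes_superset[OF vn] by blast
  moreover have "g = v \<circ> u" using permutes_inverses(2)[OF u] by (auto simp: v_def fun_eq_iff)
  ultimately show ?thesis using u by blast
qed

lemma finals_comp_in_stab_side:
  assumes "u permutes {1..m}" "v \<in> finals" shows "v \<circ> u \<in> stab n side"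
  using assms by (intro stab_comp initial_in_stab_side final_in_stab_side) (auto simp: finals_def)

text \<open>Each \<open>w\<close> is uniquely \<open>v \<circ> u \<circ> e\<close>, with
  \<open>e\<close> the shuffle that represents its coset and \<open>v \<circ> u\<close> preserving
  both intervals. Lengths add at both splittings, so \<open>tsum_mult\<close> is applied
  twice.\<close>

lemma tsum_dcs_factor:
  assumes A: "content \<mu> A 0 = 0"
  shows "hcong q n (tsum n c (dcs n (content \<mu> A) \<mu> A))
    (tsum n c (row_shuffles (content \<mu> A) (last_count A)) *
      (tsum n c (dcs m (content \<nu> (delete_row l A)) \<nu> (delete_row l A)) * tsum n c finals))"
proof -
  let ?E = "row_shuffles (content \<mu> A) (last_count A)"
  let ?U = "dcs m (content \<nu> (delete_row l A)) \<nu> (delete_row l A)"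
  let ?D = "dcs n (content \<mu> A) \<mu> A"
  let ?G = "(\<lambda>(u, v). v \<circ> u) ` (?U \<times> finals)"
  have Up: "u permutes {1..m}" if "u \<in> ?U" for u using that by (rule dcs_permutes)
  have Vp: "v permutes {m+1..n}" if "v \<in> finals" for v using that by (simp add: finals_def)
  have Ec: "e \<in> cinc n side" if "e \<in> ?E" for e using that by (simp add: row_shuffles_def)
  have G: "g \<in> stab n side" if "g \<in> ?G" for g using that Up finals_comp_in_stab_side by auto
  have UV: "hcong q n (tsum n c ?G) (tsum n c ?U * tsum n c finals)"
  proof (rule tsum_mult)
    show "bij_betw (\<lambda>(u, v). v \<circ> u) (?U \<times> finals) ?G"
    proof (rule inj_on_imp_bij_betw, rule inj_onI)
      fix p p' assume p: "p \<in> ?U \<times> finals" "p' \<in> ?U \<times> finals"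
        "(case p of (u, v) \<Rightarrow> v \<circ> u) = (case p' of (u, v) \<Rightarrow> v \<circ> u)"
      obtain u v u' v' where uv: "p = (u, v)" "p' = (u', v')" by (cases p, cases p') auto
      then have *: "u \<in> ?U" "v \<in> finals" "u' \<in> ?U" "v' \<in> finals" "v \<circ> u = v' \<circ> u'"
        using p by simp_all
      have "u x = u' x" for x
      proof (cases "x \<in> {1..m}")
        case True
        then have "u x \<in> {1..m}" "u' x \<in> {1..m}" 
          using permutes_in_image[OF Up[OF *(1)], of x] permutes_in_image[OF Up[OF *(3)], of x] by simp_all
        then have "(v \<circ> u) x = u x" "(v' \<circ> u') x = u' x" 
          using final_fixes[OF Vp[OF *(2)]] final_fixes[OF Vp[OF *(4)]] by simp_all
        then show ?thesis using *(5) by simp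
      next
        case False
        then show ?thesis
          using permutes_not_in[OF Up[OF *(1)]] permutes_not_in[OF Up[OF *(3)]] by simp
      qed
      then have "u = u'" by (rule ext)
      moreover have "v = v'"
        using *(5) permutes_inv_o(1)[OF Up[OF *(1)]] unfolding \<open>u = u'\<close>[symmetric]
        by (metis comp_assoc comp_id)
      ultimately show "p = p'" by (simp add: uv)
    qed
  qed (rule permutes_initial permutes_final ilen_initial_final; rule Up Vp; assumption)+
  have EG: "hcong q n (tsum n c ?D) (tsum n c ?E * tsum n c ?G)"
  proof (rule tsum_mult)
    have "(\<lambda>(e, g). g \<circ> e) ` (?E \<times> ?G) = ?D"
    proof (intro equalityI subsetI)
      fix w assume "w \<in> (\<lambda>(e, g). g \<circ> e) ` (?E \<times> ?G)"
      then obtain e u v where "e \<in> ?E" "u \<in> ?U" "v \<in> finals" "w = v \<circ> u \<circ> e" by auto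
      then show "w \<in> ?D" using dcs_shuffle_iff[OF A] Up by simp
    next
      fix w assume w: "w \<in> ?D"
      then have wp: "w permutes {1..n}" by (rule dcs_permutes)
      obtain e g where eg: "e \<in> cinc n side" "g \<in> stab n side" "w = g \<circ> e"
        using cinc_decomp[OF wp mono_side] by blast
      obtain u v where uv: "u permutes {1..m}" "v \<in> finals" "g = v \<circ> u"
        using stab_side_decomp[OF eg(2)] by blast
      \<comment> \<open>As \<open>g\<close> preserves the two intervals, column \<open>l\<close> of
        the matrix of \<open>w\<close> counts the positions that \<open>e\<close> sends beyond
        \<open>m\<close>; so \<open>e\<close> has the prescribed row counts.\<close>
      have "m < e x \<longleftrightarrow> rowf \<mu> (w x) = l" if "x \<in> {1..n}" for x
      proof -
        have mem: "e x \<in> {1..n}" "w x \<in> {1..n}"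
          using that permutes_in_image[OF cinc_permutes[OF eg(1)]] permutes_in_image[OF wp] by blast+
        then have "side (w x) = side (e x)" using eg by (simp add: stab_def)
        then show ?thesis using rowf_eq_last_iff[OF mem(2)] by (auto simp: side_def split: if_splits)
      qed
      then have "{x \<in> {1..n}. rowf (content \<mu> A) x = a \<and> m < e x}
          = {x \<in> {1..n}. rowf (content \<mu> A) x = a \<and> rowf \<mu> (w x) = l}" for a by blast
      then have e: "e \<in> ?E" using eg(1) w by (simp add: row_shuffles_def last_count_def dcs_def)
      then have "u \<in> ?U" using dcs_shuffle_iff[OF A e uv(1,2)] w eg(3) uv(3) by simp
      then show "w \<in> (\<lambda>(e, g). g \<circ> e) ` (?E \<times> ?G)" using e uv eg(3) by force
    qed
    moreover have "inj_on (\<lambda>(e, g). g \<circ> e) (?E \<times> ?G)"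
      by (rule inj_on_subset[OF inj_on_cinc[OF mono_side]]) (use Ec G in auto)
    ultimately show "bij_betw (\<lambda>(e, g). g \<circ> e) (?E \<times> ?G) ?D" by (simp add: bij_betw_def)
    show "ilen (g \<circ> e) = ilen e + ilen g" if "e \<in> ?E" "g \<in> ?G" for e g
      by (rule ilen_cinc[OF Ec[OF that(1)] G[OF that(2)] mono_side])
  qed (rule cinc_permutes[OF Ec] stab_permutes[OF G], assumption)+
  have Ecar: "tsum n c ?E \<in> free_carrier n" by (rule tsum_in_free_carrier[OF cinc_permutes[OF Ec]])
  show ?thesis using hcong_trans[OF EG hcong_mult[OF hcong_refl[OF Ecar] UV]] .
qed

text \<open>The two factorisations leave X between the double coset sum and the Specht generator of
  the smaller shape. Moving X to the right joins these two into the image of that generator, the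
  expression about which the hypothesis speaks.\<close>

lemma specht_image_factor:
  assumes A: "content \<mu> A 0 = 0" and z: "z \<in> free_carrier n"
    and zc: "hcong q n (tgen n (specht_perm n \<mu>) * tsum n c (stab n (rowf (conjugate \<mu>))))
      (tgen n (specht_perm m \<nu>) * tsum n c col_stab * z)"
  defines "e \<equiv> tsum n 1 (row_shuffles (content \<mu> A) (last_count A))"
  shows "hcong q n (tsum n 1 (dcs n (content \<mu> A) \<mu> A) *
      (tgen n (specht_perm n \<mu>) * tsum n c (stab n (rowf (conjugate \<mu>)))))
    (e * (tsum m 1 (dcs m (content \<nu> (delete_row l A)) \<nu> (delete_row l A)) *
      (tgen m (specht_perm m \<nu>) * tsum m c col_stab)) * (tsum n 1 finals * z))"
proof -
  let ?U = "dcs m (content \<nu> (delete_row l A)) \<nu> (delete_row l A)"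
  let ?u = "tsum n 1 ?U" and ?t = "tgen n (specht_perm m \<nu>)" and ?y = "tsum n c col_stab"
    and ?f = "tsum n 1 finals"
  have Up: "w permutes {1..m}" if "w \<in> ?U" for w using that by (rule dcs_permutes)
  have Sp: "w permutes {1..m}" if "w \<in> col_stab" for w using that by (rule stab_permutes)
  have f: "?f \<in> free_carrier n" by (rule tsum_finals_in_free_carrier)
  have u: "?u \<in> free_carrier n" by (intro tsum_in_free_carrier permutes_initial Up)
  have t: "?t \<in> free_carrier n" by (intro tgen_in_free_carrier permutes_initial specht_perm_\<nu>_permutes)
  have y: "?y \<in> free_carrier n" by (intro tsum_in_free_carrier permutes_initial Sp)
  have e: "e \<in> free_carrier n"
    unfolding e_def by (rule tsum_in_free_carrier) (auto simp: row_shuffles_def cinc_def)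
  have fty: "hcong q n (?f * (?t * ?y)) (?t * ?y * ?f)"
  proof -
    have "hcong q n (?f * ?t * ?y) (?t * ?f * ?y)"
      by (rule hcong_mult[OF tsum_finals_comm_tgen[OF specht_perm_\<nu>_permutes] hcong_refl[OF y]])
    moreover have "hcong q n (?t * (?f * ?y)) (?t * (?y * ?f))"
      by (rule hcong_mult[OF hcong_refl[OF t] tsum_finals_comm[OF Sp]])
    ultimately show ?thesis using hcong_trans by (simp add: mult.assoc)
  qed
  have "hcong q n (tsum n 1 (dcs n (content \<mu> A) \<mu> A) *
      (tgen n (specht_perm n \<mu>) * tsum n c (stab n (rowf (conjugate \<mu>)))))
      (e * (?u * ?f) * (?t * ?y * z))"
    unfolding e_def by (rule hcong_mult[OF tsum_dcs_factor[OF A] zc])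
  also have "e * (?u * ?f) * (?t * ?y * z) = e * ?u * (?f * (?t * ?y)) * z" by (simp add: mult.assoc)
  also have "hcong q n \<dots> (e * ?u * (?t * ?y * ?f) * z)"
    by (rule hcong_mult[OF hcong_mult[OF hcong_refl[OF mult_in_free_carrier[OF e u]] fty] hcong_refl[OF z]])
  also have "e * ?u * (?t * ?y * ?f) * z = e * (?u * (?t * ?y)) * (?f * z)" by (simp add: mult.assoc)
  \<comment> \<open>The middle factors are still written with representatives chosen over n; they
    are exchanged for those over m, as they occur in the hypothesis.\<close>
  also have "hcong q n \<dots> (e * (tsum m 1 ?U * (tgen m (specht_perm m \<nu>) * tsum m c col_stab)) * (?f * z))"
  proof -
    have "hcong q n ?u (tsum m 1 ?U)" by (rule hcong_sym[OF tsum_mono[OF Up diff_le_self]])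
    moreover have "hcong q n ?y (tsum m c col_stab)" by (rule hcong_sym[OF tsum_mono[OF Sp diff_le_self]])
    moreover have "hcong q n ?t (tgen m (specht_perm m \<nu>))"
      by (rule hcong_sym[OF tgen_mono[OF specht_perm_\<nu>_permutes diff_le_self]])
    ultimately show ?thesis
      by (intro hcong_mult[OF hcong_mult[OF hcong_refl[OF e]] hcong_refl[OF mult_in_free_carrier[OF f z]]]
          hcong_mult)
  qed
  finally show ?thesis .
qed

end

theorem proposition4p6:
  fixes q :: "'f::field"
    and n l r :: nat
    and \<mu> lam :: "nat \<Rightarrow> nat"
    and A :: "nat \<Rightarrow> tableau"
    and c :: "nat \<Rightarrow> 'f"
  assumes "q \<noteq> 0"
    and "is_partition n \<mu>"
    and "is_composition n lam"
    and "\<mu> l > 0" and "\<forall>j>l. \<mu> j = 0"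
    and "\<forall>i\<in>{1..r}. row_standard \<mu> (A i) \<and> has_type \<mu> lam (A i)"
    and "\<forall>i\<in>{1..r}. \<forall>j\<in>{1..r}. \<forall>b\<in>{1..\<mu> l}. A i l b = A j l b"
    and "phi_hat_combination_zero q (n - \<mu> l) (\<mu>(l := 0)) {1..r} c (\<lambda>i. delete_row l (A i))"
  shows "phi_hat_combination_zero q n \<mu> {1..r} c A"
proof -
  interpret last_row n l \<mu> using assms by unfold_locales auto
  let ?I = "{1..r}"
  have lam: "content \<mu> (A i) = lam" if "i \<in> ?I" for i
    using assms(6) that by (auto simp: has_type_def)
  have zero: "content \<mu> (A i) 0 = 0" if "i \<in> ?I" for i
    using lam[OF that] is_compositionD(1)[OF assms(3)] by simp
  have zero': "content \<nu> (delete_row l (A i)) 0 = 0" if "i \<in> ?I" for i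
    using zero[OF that] content_delete_row[of "A i" 0] by simp
  \<comment> \<open>The tableaux share row \<open>l\<close>, so the first one serves for all; it is
    an admissible index as soon as any index is.\<close>
  define R where "R = last_count (A 1)"
  have R: "last_count (A i) = R" if "i \<in> ?I" for i
  proof
    have "1 \<in> ?I" using that by auto
    then have "A i l b = A 1 l b" if "b \<in> {1..\<mu> l}" for b
      using assms(7) \<open>i \<in> ?I\<close> that by blast
    then show "last_count (A i) a = R a" for a
      unfolding R_def last_count_def by (intro arg_cong[of _ _ card]) auto
  qed
  let ?s = "tgen n (specht_perm n \<mu>) * tsum n (inverse (- q)) (stab n (rowf (conjugate \<mu>))) :: 'f free_alg"
  let ?s' = "tgen m (specht_perm m \<nu>) * tsum m (inverse (- q)) col_stab :: 'f free_alg"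
  let ?D = "\<lambda>i. tsum n 1 (dcs n (content \<mu> (A i)) \<mu> (A i)) :: 'f free_alg"
  let ?D' = "\<lambda>i. tsum m 1 (dcs m (content \<nu> (delete_row l (A i))) \<nu> (delete_row l (A i))) :: 'f free_alg"
  obtain z where z: "z \<in> free_carrier n"
    "hcong q n ?s (tgen n (specht_perm m \<nu>) * tsum n (inverse (- q)) col_stab * z)"
    using specht_generator_factor by blast
  define e where "e = (tsum n 1 (row_shuffles lam R) :: 'f free_alg)"
  have e: "e \<in> free_carrier n"
    unfolding e_def by (rule tsum_in_free_carrier) (auto simp: row_shuffles_def cinc_def)
  have fz: "tsum n 1 finals * z \<in> free_carrier n"
    by (rule mult_in_free_carrier[OF tsum_finals_in_free_carrier z(1)])
  \<comment> \<open>The hypothesis at \<open>h = 1\<close>, that is, at the generator of the smaller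
    Specht module; the congruence is then read over n.\<close>
  have "hcong q m (\<Sum>i\<in>?I. const (c i) * (?D' i * (?s' * 1))) 0"
    by (rule bspec[OF iffD1[OF phi_hat_combination_zero_iff[OF part_\<nu> zero'] assms(8)] one_in_free_carrier])
  then have 0: "hcong q n (\<Sum>i\<in>?I. const (c i) * (?D' i * ?s')) 0"
    unfolding mult_1_right by (rule hcong_mono[OF diff_le_self])
  have "hcong q n (\<Sum>i\<in>?I. const (c i) * (?D i * (?s * h))) 0" if h: "h \<in> free_carrier n" for h
  proof -
    have "hcong q n (\<Sum>i\<in>?I. const (c i) * (?D i * ?s))
        (\<Sum>i\<in>?I. const (c i) * (e * (?D' i * ?s') * (tsum n 1 finals * z)))"
    proof (rule hcong_sum, rule hcong_mult[OF hcong_refl[OF const_in_free_carrier]])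
      fix i assume i: "i \<in> ?I"
      show "hcong q n (?D i * ?s) (e * (?D' i * ?s') * (tsum n 1 finals * z))"
        using specht_image_factor[OF zero[OF i] z] unfolding e_def R[OF i] lam[OF i] .
    qed
    also have "(\<Sum>i\<in>?I. const (c i) * (e * (?D' i * ?s') * (tsum n 1 finals * z)))
        = e * (\<Sum>i\<in>?I. const (c i) * (?D' i * ?s')) * (tsum n 1 finals * z)"
    proof -
      \<comment> \<open>Scalars are central, so the outer factors, which do not depend on
        \<open>i\<close>, can be taken out of the sum.\<close>
      have "const (c i) * (e * (?D' i * ?s') * (tsum n 1 finals * z))
          = e * (const (c i) * (?D' i * ?s')) * (tsum n 1 finals * z)" for i
        using const_commute[of "c i" e] by (simp add: mult.assoc[symmetric])
      then show ?thesis by (simp add: sum_distrib_left sum_distrib_right)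
    qed
    also have "hcong q n \<dots> (e * 0 * (tsum n 1 finals * z))"
      by (intro hcong_mult[OF hcong_mult[OF hcong_refl[OF e] 0] hcong_refl[OF fz]])
    \<comment> \<open>Right multiplication by \<open>h\<close> passes from the generator to an
      arbitrary element of the Specht module.\<close>
    finally have "hcong q n ((\<Sum>i\<in>?I. const (c i) * (?D i * ?s)) * h) (e * 0 * (tsum n 1 finals * z) * h)"
      by (rule hcong_mult[OF _ hcong_refl[OF h]])
    moreover have "(\<Sum>i\<in>?I. const (c i) * (?D i * ?s)) * h = (\<Sum>i\<in>?I. const (c i) * (?D i * (?s * h)))"
      by (simp only: sum_distrib_right mult.assoc)
    ultimately show ?thesis by simp
  qed
  then show ?thesis by (intro iffD2[OF phi_hat_combination_zero_iff[OF partition zero]] ballI)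
qed

end
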